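(* Let $A\in\mathbb C^{n\times n}$, let $f$ be a scalar function such that $f(A)$ is defined, and let $\mathcal W\subset\mathbb C$ be a compact set containing the numerical range $\mathcal W(A)$. Assume that there are constants $C>0$ and $0\le q<1$ such that $$\min_{p_s\in\Pi_s}\max_{z\in\mathcal W}|f(z)-p_s(z)|\le Cq^s\qquad\text{for all } s,$$ where $\Pi_s$ is the set of all polynomials of degree $\le s$. Let $d$ be a positive integer, let $V_1,\dots,V_m$ be the color classes of a distance-$2d$ coloring of $|G(A)|$, let $v_\ell=\sum_{i\in V_\ell}e_i$, and define $$[f(A)^{[d]}]_{ij}=\begin{cases}[f(A)v_\ell]_i \text{ for } j\in V_\ell & \text{if } \bar{\mathrm d}(i,j)\le d,\\ 0 & \text{if } \bar{\mathrm d}(i,j)>d.\end{cases}$$ Then $$\|f(A)-f(A)^{[d]}\|_F\le 2K\sqrt n\,\varepsilon\qquad\text{with } \varepsilon=Cq^d,$$ where $K=1$ when $A$ is normal and $K=1+\sqrt2$ otherwise.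
   Context: The numerical range is $\mathcal W(A)=\{x^HAx:\|x\|_2=1\}$. The directed graph $G(A)$ of $A$ has vertices $V=\{1,\dots,n\}$ and edges $\{(i,j): a_{ij}\ne0,\ i\ne j\}$; $|G(A)|$ is the undirected graph obtained by removing the direction of the edges, and $\bar{\mathrm d}(i,j)$ is the geodesic distance in $|G(A)|$ ($\infty$ if there is no path). A distance-$k$ coloring of a graph is a mapping $\mathrm{col}:V\to\{1,\dots,m\}$ such that $\mathrm{col}(i)\ne\mathrm{col}(j)$ whenever $i\ne j$ and the distance from $i$ to $j$ is at most $k$; its color classes are $V_\ell=\{i:\mathrm{col}(i)=\ell\}$. $e_i$ is the $i$th canonical unit vector. $f(A)$ is the usual matrix function: the polynomial in $A$ interpolating $f$ on the spectrum of $A$ in the Hermite sense (with the required derivatives of $f$ assumed to exist). $\|\cdot\|_F$ is the Frobenius norm. *)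

theory Defs
  imports
    "HOL-Analysis.Analysis"
    "HOL-Computational_Algebra.Polynomial"
    "HOL-Library.Extended_Nat"
begin

section \<open>Matrices\<close>

text \<open>The ring operations of the type of vectors act componentwise, so powers of matrices have to be
  built from the matrix product. The scalar matrix with diagonal entry \<open>c\<close> is \<open>mat c\<close>.\<close>

definition matrix_power :: "complex^'n^'n \<Rightarrow> nat \<Rightarrow> complex^'n^'n" where
  "matrix_power A k = ((\<lambda>B. A ** B) ^^ k) (mat 1)"

definition matrix_poly :: "complex poly \<Rightarrow> complex^'n^'n \<Rightarrow> complex^'n^'n" where
  "matrix_poly p A = (\<Sum>k\<le>degree p. mat (coeff p k) ** matrix_power A k)"

definition conj_transpose :: "complex^'n^'n \<Rightarrow> complex^'n^'n" where
  "conj_transpose A = (\<chi> i j. cnj (A $ j $ i))"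

definition normal_matrix :: "complex^'n^'n \<Rightarrow> bool" where
  "normal_matrix A \<longleftrightarrow> conj_transpose A ** A = A ** conj_transpose A"

definition frobenius_norm :: "complex^'n^'n \<Rightarrow> real" where
  "frobenius_norm A = sqrt (\<Sum>i\<in>UNIV. \<Sum>j\<in>UNIV. (cmod (A $ i $ j))\<^sup>2)"

definition numerical_range :: "complex^'n^'n \<Rightarrow> complex set" where
  "numerical_range A = {\<Sum>i\<in>UNIV. cnj (x $ i) * (A *v x) $ i | x. norm x = 1}"

definition spectrum :: "complex^'n^'n \<Rightarrow> complex set" where
  "spectrum A = {\<mu>. \<exists>v. v \<noteq> 0 \<and> A *v v = \<mu> *s v}"

section \<open>Matrix functions by Hermite interpolation\<close>

definition minpoly :: "complex^'n^'n \<Rightarrow> complex poly" where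
  "minpoly A = (THE p. lead_coeff p = 1 \<and> matrix_poly p A = 0 \<and>
                       (\<forall>q. q \<noteq> 0 \<and> matrix_poly q A = 0 \<longrightarrow> degree p \<le> degree q))"

text \<open>The \<open>k\<close>-th complex derivative of \<open>f\<close> exists at \<open>z\<close>. The quantifier over a neighbourhood ensures
  that the lower derivatives, which \<open>deriv\<close> leaves unspecified where they do not exist, are genuine.\<close>

primrec has_nth_deriv :: "nat \<Rightarrow> (complex \<Rightarrow> complex) \<Rightarrow> complex \<Rightarrow> bool" where
  "has_nth_deriv 0 f z \<longleftrightarrow> True"
| "has_nth_deriv (Suc k) f z \<longleftrightarrow>
     (\<forall>\<^sub>F w in nhds z. has_nth_deriv k f w) \<and> (deriv ^^ k) f field_differentiable (at z)"

text \<open>The multiplicity of an eigenvalue as a root of the minimal polynomial is the size of its largest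
  Jordan block; derivatives up to that size minus one are needed.\<close>

definition defined_on_spectrum :: "(complex \<Rightarrow> complex) \<Rightarrow> complex^'n^'n \<Rightarrow> bool" where
  "defined_on_spectrum f A \<longleftrightarrow>
     (\<forall>\<mu>\<in>spectrum A. \<forall>k<order \<mu> (minpoly A). has_nth_deriv k f \<mu>)"

definition hermite_interpolates ::
    "complex poly \<Rightarrow> (complex \<Rightarrow> complex) \<Rightarrow> complex^'n^'n \<Rightarrow> bool" where
  "hermite_interpolates p f A \<longleftrightarrow>
     (\<forall>\<mu>\<in>spectrum A. \<forall>k<order \<mu> (minpoly A). poly ((pderiv ^^ k) p) \<mu> = (deriv ^^ k) f \<mu>)"

text \<open>The degree bound singles out one interpolating polynomial.\<close>

definition matrix_fun :: "(complex \<Rightarrow> complex) \<Rightarrow> complex^'n^'n \<Rightarrow> complex^'n^'n" where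
  "matrix_fun f A =
     matrix_poly (THE p. degree p < degree (minpoly A) \<and> hermite_interpolates p f A) A"

section \<open>Polynomial approximation\<close>

text \<open>Supremum and infimum are taken in the extended reals, so no boundedness has to be presupposed.
  For \<open>f\<close> continuous on a nonempty compact set \<open>W\<close> they are a maximum and a minimum.\<close>

definition best_approx_error :: "(complex \<Rightarrow> complex) \<Rightarrow> complex set \<Rightarrow> nat \<Rightarrow> ereal" where
  "best_approx_error f W s =
     (INF p\<in>{p. degree p \<le> s}. SUP z\<in>W. ereal (cmod (f z - poly p z)))"

section \<open>Graph, distance and colouring\<close>

definition graph_edges :: "complex^'n^'n \<Rightarrow> ('n \<times> 'n) set" where
  "graph_edges A = {(i, j). A $ i $ j \<noteq> 0 \<and> i \<noteq> j}"

definition undirected_edges :: "complex^'n^'n \<Rightarrow> ('n \<times> 'n) set" where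
  "undirected_edges A = graph_edges A \<union> (graph_edges A)\<inverse>"

text \<open>The least length of a walk from \<open>i\<close> to \<open>j\<close>; the infimum of the empty set is \<open>\<infinity>\<close>.\<close>

definition graph_dist :: "complex^'n^'n \<Rightarrow> 'n \<Rightarrow> 'n \<Rightarrow> enat" where
  "graph_dist A i j = (INF k\<in>{k. (i, j) \<in> undirected_edges A ^^ k}. enat k)"

definition distance_coloring :: "nat \<Rightarrow> complex^'n^'n \<Rightarrow> nat \<Rightarrow> ('n \<Rightarrow> nat) \<Rightarrow> bool" where
  "distance_coloring k A m col \<longleftrightarrow>
     (\<forall>i. col i \<in> {1..m}) \<and>
     (\<forall>i j. i \<noteq> j \<and> graph_dist A i j \<le> enat k \<longrightarrow> col i \<noteq> col j)"

definition color_class :: "('n \<Rightarrow> nat) \<Rightarrow> nat \<Rightarrow> 'n set" where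
  "color_class col l = {i. col i = l}"

definition probing_vector :: "('n::finite \<Rightarrow> nat) \<Rightarrow> nat \<Rightarrow> complex^'n" where
  "probing_vector col l = (\<Sum>i\<in>color_class col l. axis i 1)"

text \<open>The index \<open>j\<close> lies in exactly one colour class, the one with number \<open>col j\<close>.\<close>

definition probing_approx ::
    "(complex \<Rightarrow> complex) \<Rightarrow> complex^'n^'n \<Rightarrow> ('n \<Rightarrow> nat) \<Rightarrow> nat \<Rightarrow> complex^'n^'n" where
  "probing_approx f A col d =
     (\<chi> i j. if graph_dist A i j \<le> enat d
             then (matrix_fun f A *v probing_vector col (col j)) $ i else 0)"

end

theory Submission
  imports
    Defs
    "HOL-Complex_Analysis.Complex_Analysis"
    "HOL-Computational_Algebra.Fundamental_Theorem_Algebra"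
begin

text \<open>Let \<open>p\<close> be a polynomial of degree at most \<open>d\<close> with \<open>|f - p| \<le> \<epsilon>\<close> on \<open>W\<close> and put \<open>E = f(A) - p(A)\<close>.
  Since \<open>p(A)\<close> vanishes at pairs of distance more than \<open>d\<close>, the error equals \<open>E - M\<close>, where the entry
  \<open>(i, j)\<close> of \<open>M\<close> is \<open>(E v\<^sub>l)\<^sub>i\<close> if the distance is at most \<open>d\<close> and \<open>0\<close> otherwise. A row
  meets every colour class in at most one such \<open>j\<close>, so both \<open>E\<close> and \<open>M\<close> have Frobenius norm at most \<open>sqrt n\<close>
  times the operator norm of \<open>E\<close>, which is at most \<open>K \<epsilon>\<close>.

  For normal \<open>A\<close> the last bound follows from an eigenvector of \<open>A\<close> in the top eigenspace of \<open>p(A)\<^sup>* p(A)\<close>.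
  Otherwise it is the Crouzeix--Palencia theorem, proved by the argument of Ransford and Schwenninger: on a smooth convex
  domain around the numerical range, the Cauchy transform \<open>g\<close> of the conjugate of \<open>f\<close> satisfies \<open>|g| \<le> sup |f|\<close>,
  because the boundary sees the domain under the angle \<open>pi\<close>, and \<open>f(A) + g(A)\<^sup>*\<close> is the integral of \<open>f\<close>
  against a positive operator-valued measure of mass \<open>2\<close>. The bound passes from polynomials to \<open>f(A)\<close> because
  eigenvalues on the boundary of the numerical range are semisimple, while in its interior uniform convergence carries
  over to derivatives.\<close>

unbundle no fps_syntax

section \<open>Matrices and vectors\<close>

lemma mat_mult_component [simp]: "(mat c ** M) $ i $ j = c * M $ i $ j"
  for M :: "'a::comm_semiring_1^'n^'m"
  by (simp add: matrix_matrix_mult_def mat_def if_distrib[of "\<lambda>x. x * _"] cong: if_cong)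

lemma mult_mat_component [simp]: "(M ** mat c) $ i $ j = c * M $ i $ j"
  for M :: "'a::comm_semiring_1^'n^'m"
  by (simp add: matrix_matrix_mult_def mat_def if_distrib[of "\<lambda>x. _ * x"] mult.commute cong: if_cong)

lemma mat_mult_commute: "M ** mat c = mat c ** M" for M :: "'a::comm_semiring_1^'n^'n"
  by (simp add: vec_eq_iff)

lemma mat_mult_left_commute: "M ** (mat c ** N) = mat c ** (M ** N)"
  for M :: "'a::comm_semiring_1^'n^'n"
  by (metis mat_mult_commute matrix_mul_assoc)

lemma mat_mult_mat: "mat a ** mat b = mat (a * b)" for a :: "'a::comm_semiring_1"
  by (simp add: vec_eq_iff) (simp add: mat_def mult.commute)

lemma mat_add: "mat (a + b) = mat a + mat b" for a :: "'a::comm_semiring_1"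
  by (simp add: vec_eq_iff mat_def)

lemma mat_diff: "mat (a - b) = mat a - mat b" for a :: "'a::comm_ring_1"
  by (simp add: vec_eq_iff mat_def)

lemma mat_vector_mult [simp]: "mat c *v x = c *s x" for x :: "'a::comm_semiring_1^'n"
  by (simp add: vec_eq_iff matrix_vector_mult_def mat_def if_distrib[of "\<lambda>x. x * _"] cong: if_cong)

lemma matrix_mult_smult: "M *v (c *s x) = c *s (M *v x)" for x :: "'a::comm_semiring_1^'n"
  by (simp add: vec_eq_iff matrix_vector_mult_def sum_distrib_left mult_ac)

lemma norm_smult [simp]: "norm (c *s x) = cmod c * norm x" for x :: "complex^'n"
  by (simp add: norm_vec_def norm_mult L2_set_right_distrib)

lemma smult_of_real: "complex_of_real r *s x = r *\<^sub>R x" for x :: "complex^'n"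
  by (simp add: vec_eq_iff scaleR_conv_of_real[where 'a = complex])

text \<open>The operation \<open>*\<close> on the matrix type is componentwise. The three
  interpretations below give \<open>**\<close>, \<open>*v\<close> and \<open>*s\<close> the rules
  for limits, derivatives and integrals of bilinear maps.\<close>

lemma bounded_bilinear_matrix_mult:
  "bounded_bilinear ((**) :: complex^'n^'n \<Rightarrow> complex^'n^'n \<Rightarrow> complex^'n^'n)"
  unfolding bilinear_conv_bounded_bilinear[symmetric] bilinear_def
  by (auto intro!: linearI simp: matrix_add_ldistrib matrix_scaleR
      vec_eq_iff matrix_matrix_mult_def sum.distrib scaleR_sum_right algebra_simps)

interpretation matrix_mult: bounded_bilinear "(**) :: complex^'n^'n \<Rightarrow> complex^'n^'n \<Rightarrow> complex^'n^'n"
  by (rule bounded_bilinear_matrix_mult)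

lemma bounded_bilinear_matrix_vector_mult:
  "bounded_bilinear ((*v) :: complex^'n^'n \<Rightarrow> complex^'n \<Rightarrow> complex^'n)"
  unfolding bilinear_conv_bounded_bilinear[symmetric] bilinear_def
  by (auto intro!: linearI simp: vec_eq_iff matrix_vector_mult_def sum.distrib scaleR_sum_right algebra_simps)

interpretation matrix_vector: bounded_bilinear "(*v) :: complex^'n^'n \<Rightarrow> complex^'n \<Rightarrow> complex^'n"
  by (rule bounded_bilinear_matrix_vector_mult)

lemma bounded_linear_mat: "bounded_linear (mat :: complex \<Rightarrow> complex^'n^'n)"
  by (intro linear_conv_bounded_linear[THEN iffD1] linearI) (auto simp: vec_eq_iff mat_def)

lemma bounded_bilinear_smult: "bounded_bilinear ((*s) :: complex \<Rightarrow> complex^'n \<Rightarrow> complex^'n)"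
  unfolding bilinear_conv_bounded_bilinear[symmetric] bilinear_def
  by (auto intro!: linearI simp: vec_eq_iff algebra_simps)

interpretation smult: bounded_bilinear "(*s) :: complex \<Rightarrow> complex^'n \<Rightarrow> complex^'n"
  by (rule bounded_bilinear_smult)

text \<open>The norm of the matrix type is the Frobenius norm, so this is Cauchy--Schwarz row by
  row. Operator norm bounds are written throughout as
  \<open>norm (M *v x) \<le> c * norm x\<close>.\<close>

lemma norm_matrix_vector_mult_le: "norm (M *v x) \<le> norm M * norm x" for M :: "complex^'n^'n"
proof -
  have "norm ((M *v x) $ i) \<le> norm (M $ i) * norm x" for i
  proof -
    have "norm ((M *v x) $ i) \<le> (\<Sum>j\<in>UNIV. \<bar>cmod (M $ i $ j)\<bar> * \<bar>cmod (x $ j)\<bar>)"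
      unfolding matrix_vector_mult_def by (auto intro!: order_trans[OF norm_sum] simp: norm_mult)
    also have "\<dots> \<le> L2_set (\<lambda>j. cmod (M $ i $ j)) UNIV * L2_set (\<lambda>j. cmod (x $ j)) UNIV"
      by (rule L2_set_mult_ineq)
    finally show ?thesis by (simp add: norm_vec_def)
  qed
  then have "L2_set (\<lambda>i. norm ((M *v x) $ i)) UNIV \<le> L2_set (\<lambda>i. norm x * norm (M $ i)) UNIV"
    by (intro L2_set_mono) (auto simp: mult.commute)
  then show ?thesis by (simp add: norm_vec_def L2_set_right_distrib mult.commute)
qed

lemma frobenius_norm_eq_norm: "frobenius_norm M = norm M"
  by (simp add: frobenius_norm_def norm_vec_def L2_set_def sum_nonneg)

lemma norm_matrix_columns: "(norm M)\<^sup>2 = (\<Sum>j\<in>UNIV. (norm (M *v axis j 1))\<^sup>2)" for M :: "complex^'n^'n"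
proof -
  have "(M *v axis j 1) $ i = M $ i $ j" for i j
    by (simp add: matrix_vector_mult_def axis_def if_distrib cong: if_cong)
  then show ?thesis
    by (simp add: norm_vec_def L2_set_def sum_nonneg) (rule sum.swap)
qed

text \<open>The inner product of \<open>complex^'n\<close> is the real part of the Hermitian one;
  over the reals the adjoint is still the conjugate transpose.\<close>

lemma inner_conj_transpose: "x \<bullet> (M *v y) = (conj_transpose M *v x) \<bullet> y" for M :: "complex^'n^'n"
proof -
  have "x \<bullet> (M *v y) = (\<Sum>i\<in>UNIV. \<Sum>j\<in>UNIV. Re (cnj (x $ i) * (M $ i $ j * y $ j)))"
    by (simp add: inner_vec_def matrix_vector_mult_def inner_complex_def sum_distrib_left
        sum.distrib sum_subtractf algebra_simps)
  also have "\<dots> = (\<Sum>j\<in>UNIV. \<Sum>i\<in>UNIV. Re (cnj (x $ i) * (M $ i $ j * y $ j)))"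
    by (rule sum.swap)
  also have "\<dots> = (conj_transpose M *v x) \<bullet> y"
    by (simp add: inner_vec_def matrix_vector_mult_def inner_complex_def conj_transpose_def
        sum_distrib_right sum_distrib_left sum.distrib sum_subtractf algebra_simps)
  finally show ?thesis .
qed

lemma conj_transpose_involution [simp]: "conj_transpose (conj_transpose M) = M"
  by (simp add: conj_transpose_def vec_eq_iff)

lemma conj_transpose_add: "conj_transpose (M + N) = conj_transpose M + conj_transpose N"
  by (simp add: conj_transpose_def vec_eq_iff)

lemma conj_transpose_mult: "conj_transpose (M ** N) = conj_transpose N ** conj_transpose M"
  by (simp add: conj_transpose_def vec_eq_iff matrix_matrix_mult_def mult.commute)

lemma conj_transpose_mat [simp]: "conj_transpose (mat c) = mat (cnj c)"
  by (simp add: conj_transpose_def vec_eq_iff mat_def)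

lemma inner_smult_left: "(c *s x) \<bullet> y = x \<bullet> (cnj c *s y)" for x :: "complex^'n"
  using inner_conj_transpose[of x "mat (cnj c)" y] by simp

section \<open>Polynomials of a matrix\<close>

lemma matrix_power_0 [simp]: "matrix_power A 0 = mat 1"
  by (simp add: matrix_power_def)

lemma matrix_power_Suc [simp]: "matrix_power A (Suc k) = A ** matrix_power A k"
  by (simp add: matrix_power_def)

lemma matrix_poly_altdef:
  assumes "degree p \<le> N"
  shows "matrix_poly p A = (\<Sum>k\<le>N. mat (coeff p k) ** matrix_power A k)"
  unfolding matrix_poly_def using assms
  by (intro sum.mono_neutral_left) (auto simp: not_le coeff_eq_0)

lemma matrix_poly_0 [simp]: "matrix_poly 0 A = 0"
  by (simp add: matrix_poly_def)

lemma matrix_poly_pCons [simp]: "matrix_poly (pCons a p) A = mat a + A ** matrix_poly p A"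
proof -
  have "matrix_poly (pCons a p) A
      = (\<Sum>k\<le>Suc (degree p). mat (coeff (pCons a p) k) ** matrix_power A k)"
    by (rule matrix_poly_altdef) (rule degree_pCons_le)
  also have "\<dots> = mat a + (\<Sum>k\<le>degree p. mat (coeff p k) ** (A ** matrix_power A k))"
    by (simp add: sum.atMost_Suc_shift del: sum.atMost_Suc)
  also have "(\<Sum>k\<le>degree p. mat (coeff p k) ** (A ** matrix_power A k)) = A ** matrix_poly p A"
    by (simp add: matrix_poly_def matrix_mult.sum_right matrix_mul_assoc mat_mult_commute)
  finally show ?thesis .
qed

lemma matrix_poly_add: "matrix_poly (p + q) A = matrix_poly p A + matrix_poly q A"
  by (induction p q rule: poly_induct2) (simp_all add: mat_add matrix_add_ldistrib algebra_simps)

lemma matrix_poly_smult: "matrix_poly (smult c p) A = mat c ** matrix_poly p A"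
  by (induction p) (simp_all add: mat_mult_mat matrix_add_ldistrib mat_mult_left_commute)

lemma matrix_poly_diff: "matrix_poly (p - q) A = matrix_poly p A - matrix_poly q A"
  by (metis add_diff_cancel_right' diff_add_cancel matrix_poly_add)

lemma matrix_poly_mult: "matrix_poly (p * q) A = matrix_poly p A ** matrix_poly q A"
  by (induction p)
    (simp_all add: matrix_poly_add matrix_poly_smult matrix_mult.add_left matrix_mul_assoc)

lemma matrix_poly_commute: "matrix_poly p A ** matrix_poly q A = matrix_poly q A ** matrix_poly p A"
  by (metis matrix_poly_mult mult.commute)

lemma matrix_poly_sum: "matrix_poly (sum f S) A = (\<Sum>i\<in>S. matrix_poly (f i) A)"
  by (induction S rule: infinite_finite_induct) (auto simp: matrix_poly_add)

lemma matrix_poly_1 [simp]: "matrix_poly 1 A = mat 1"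
  by (simp add: one_pCons)

lemma matrix_poly_commute_self: "A ** matrix_poly p A = matrix_poly p A ** A"
  using matrix_poly_commute[of "[:0,1:]" A p] by simp

text \<open>Translating \<open>A\<close> by a point of its numerical range puts \<open>0\<close>
  inside the domain, as the curve construction requires.\<close>

lemma matrix_poly_pcompose_shift:
  "matrix_poly (p \<circ>\<^sub>p [:c, 1:]) (A - mat c) = matrix_poly p A"
  by (induction p) (simp_all add: pcompose_pCons matrix_poly_add matrix_poly_mult del: mult_pCons_left)

lemma matrix_poly_eigenvector:
  assumes "A *v v = \<mu> *s v"
  shows "matrix_poly p A *v v = poly p \<mu> *s v"
proof (induction p)
  case 0
  show ?case by simp
next
  case (pCons a p)
  have "matrix_poly (pCons a p) A *v v = a *s v + A *v (matrix_poly p A *v v)"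
    by (simp add: matrix_vector_mult_add_rdistrib matrix_vector_mul_assoc)
  also have "\<dots> = a *s v + poly p \<mu> *s (\<mu> *s v)"
    unfolding pCons.IH matrix_mult_smult assms ..
  also have "\<dots> = poly (pCons a p) \<mu> *s v"
    by (simp add: vec_eq_iff algebra_simps)
  finally show ?case .
qed

section \<open>The numerical range\<close>

text \<open>The Hermitian form whose values on the unit sphere make up the numerical range, kept for
  all vectors so that it scales with \<open>(norm x)^2\<close>.\<close>

definition qform :: "complex^'n^'n \<Rightarrow> complex^'n \<Rightarrow> complex" where
  "qform A x = (\<Sum>i\<in>UNIV. cnj (x $ i) * (A *v x) $ i)"

lemma Re_qform: "Re (qform A x) = x \<bullet> (A *v x)"
  by (simp add: qform_def inner_vec_def inner_complex_def)

lemma qform_mat_mult: "qform (mat c ** A) x = c * qform A x"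
  by (simp add: qform_def sum_distrib_left mult_ac flip: matrix_vector_mul_assoc)

lemma qform_mat: "qform (mat c) x = c * (norm x)\<^sup>2"
  by (simp add: qform_def norm_vec_def L2_set_def sum_nonneg sum_distrib_left complex_norm_square mult_ac
      del: of_real_power flip: of_real_power)

lemma qform_diff: "qform (A - B) x = qform A x - qform B x"
  by (simp add: qform_def matrix_vector_mult_diff_rdistrib right_diff_distrib sum_subtractf)

lemma qform_smult: "qform A (u *s x) = (cmod u)\<^sup>2 * qform A x"
  by (simp add: qform_def matrix_mult_smult sum_distrib_left complex_norm_square mult_ac
      del: of_real_power flip: of_real_power)

lemma qform_scaleR: "qform A (r *\<^sub>R x) = r\<^sup>2 * qform A x" for r :: real
  by (simp add: qform_def matrix_vector.scaleR_right sum_distrib_left power2_eq_square mult_ac scaleR_conv_of_real[where 'a=complex])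

lemma continuous_on_qform [continuous_intros]:
  "continuous_on S f \<Longrightarrow> continuous_on S (\<lambda>x. qform A (f x))"
  unfolding qform_def
  by (intro continuous_intros matrix_vector.continuous_on)

text \<open>The cross term of the form under addition; it is real bilinear, not
  sesquilinear.\<close>

definition qmixed :: "complex^'n^'n \<Rightarrow> complex^'n \<Rightarrow> complex^'n \<Rightarrow> complex" where
  "qmixed A x y = (\<Sum>i\<in>UNIV. cnj (x $ i) * (A *v y) $ i + cnj (y $ i) * (A *v x) $ i)"

lemma qform_add: "qform A (x + y) = qform A x + qform A y + qmixed A x y"
  by (simp add: qform_def qmixed_def matrix_vector_right_distrib algebra_simps sum.distrib)

lemma qmixed_scaleR: "qmixed A (s *\<^sub>R x) (t *\<^sub>R y) = of_real (s * t) * qmixed A x y"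
  by (simp add: qmixed_def matrix_vector.scaleR_right sum_distrib_left algebra_simps sum.distrib scaleR_conv_of_real[where 'a=complex])

lemma numerical_range_altdef: "numerical_range A = qform A ` sphere 0 1"
  by (auto simp: numerical_range_def qform_def)

lemma qform_eq:
  assumes "x \<noteq> 0"
  obtains w where "w \<in> numerical_range A" "qform A x = of_real ((norm x)\<^sup>2) * w"
proof -
  have "qform A (inverse (norm x) *\<^sub>R x) \<in> numerical_range A"
    unfolding numerical_range_altdef using assms by (intro imageI) auto
  moreover have "qform A x = (norm x)\<^sup>2 * qform A (inverse (norm x) *\<^sub>R x)"
    using assms by (simp add: qform_scaleR field_simps)
  ultimately show thesis by (rule that)
qed

lemma numerical_range_nonempty [simp]: "numerical_range A \<noteq> {}"
  by (simp add: numerical_range_altdef)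

lemma compact_numerical_range: "compact (numerical_range A)"
  unfolding numerical_range_altdef
  by (intro compact_continuous_image continuous_intros) auto

lemma spectrum_subset_numerical_range: "spectrum A \<subseteq> numerical_range A"
proof
  fix \<mu> assume "\<mu> \<in> spectrum A"
  then obtain v where v: "v \<noteq> 0" "A *v v = \<mu> *s v" by (auto simp: spectrum_def)
  have "qform A v = qform (mat \<mu>) v"
    by (simp only: qform_def v(2) mat_vector_mult)
  then have "qform A v = of_real ((norm v)\<^sup>2) * \<mu>"
    by (simp only: qform_mat mult.commute)
  moreover obtain w where "w \<in> numerical_range A" "qform A v = of_real ((norm v)\<^sup>2) * w"
    using qform_eq[OF v(1)] by blast
  ultimately show "\<mu> \<in> numerical_range A" using v(1) by simp
qed

text \<open>Toeplitz--Hausdorff. After an affine normalisation the two values are \<open>0\<close> and a positive real.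
  Replacing one vector by a unimodular multiple kills the imaginary part of the mixed term, so that the
  form is real along the segment between the two vectors.\<close>

lemma qmixed_real_rotation:
  obtains u where "cmod u = 1" "Im (qmixed B (u *s x) y) = 0"
proof -
  let ?h = "\<lambda>\<theta>. Im (qmixed B (cis \<theta> *s x) y)"
  have cont: "continuous_on {0..pi} ?h"
    unfolding qmixed_def
    by (intro continuous_intros matrix_vector.continuous_on smult.continuous_on)
  \<comment> \<open>Rotation by \<open>pi\<close> negates the mixed term, so its imaginary part has
    a zero in between.\<close>
  have "?h pi = - ?h 0"
    using qmixed_scaleR[of B "-1" x 1 y] by (simp add: vector_smult_lneg)
  then have "(?h 0 \<le> 0 \<and> 0 \<le> ?h pi) \<or> (?h pi \<le> 0 \<and> 0 \<le> ?h 0)" by linarith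
  then obtain \<theta> where "?h \<theta> = 0"
    using IVT'[of ?h 0 0 pi, OF _ _ _ cont] IVT2'[of ?h pi 0 0, OF _ _ _ cont] by (auto simp: less_imp_le)
  then show thesis using that[of "cis \<theta>"] by simp
qed

theorem convex_numerical_range: "convex (numerical_range A)"
proof (rule convexI)
  fix a b :: complex and s l :: real
  assume a: "a \<in> numerical_range A" and b: "b \<in> numerical_range A" and sl: "0 \<le> s" "0 \<le> l" "s + l = 1"
  show "s *\<^sub>R a + l *\<^sub>R b \<in> numerical_range A"
  proof (cases "a = b")
    case True
    then show ?thesis using a sl by (simp flip: scaleR_add_left)
  next
    case False
    define r where "r = (cmod (b - a))\<^sup>2"
    have r: "r > 0" using False by (simp add: r_def)
    \<comment> \<open>The form of \<open>B\<close> vanishes at \<open>x\<close> and equals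
      \<open>r\<close> at \<open>y\<close>; at unit vectors its values are
      \<open>cnj (b - a) * (w - a)\<close> with \<open>w\<close> in the range of
      \<open>A\<close>.\<close>
    define B where "B = mat (cnj (b - a)) ** (A - mat a)"
    have qB: "qform B x = cnj (b - a) * (qform A x - a * (norm x)\<^sup>2)" for x
      by (simp add: B_def qform_mat_mult qform_diff qform_mat)
    obtain x where x: "norm x = 1" "qform A x = a" using a by (auto simp: numerical_range_altdef)
    obtain y where y: "norm y = 1" "qform A y = b" using b by (auto simp: numerical_range_altdef)
    have Bx: "qform B x = 0" using x by (simp add: qB)
    have By: "qform B y = of_real r"
      using y unfolding qB r_def complex_norm_square by (simp add: mult.commute)
    obtain u where u: "cmod u = 1" "Im (qmixed B (u *s x) y) = 0" using qmixed_real_rotation .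
    have Bux: "qform B (u *s x) = 0" by (simp add: qform_smult Bx)
    define v where "v t = (1 - t) *\<^sub>R (u *s x) + t *\<^sub>R y" for t :: real
    have qv: "qform B (v t) = of_real (t\<^sup>2 * r) + of_real ((1 - t) * t) * qmixed B (u *s x) y" for t
      unfolding v_def qform_add qform_scaleR qmixed_scaleR Bux By by simp
    \<comment> \<open>The path avoids \<open>0\<close>: otherwise \<open>t = 1 / 2\<close> and
      \<open>y\<close> is a unimodular multiple of \<open>x\<close>, although the form is
      \<open>0\<close> at \<open>x\<close> and \<open>r > 0\<close> at \<open>y\<close>.\<close>
    have v0: "v t \<noteq> 0" for t
    proof
      assume eq: "v t = 0"
      then have "(1 - t) *\<^sub>R (u *s x) = - t *\<^sub>R y" by (simp add: v_def eq_neg_iff_add_eq_0)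
      then have "norm ((1 - t) *\<^sub>R (u *s x)) = norm (- t *\<^sub>R y)" by simp
      then have "\<bar>1 - t\<bar> = \<bar>t\<bar>" using x(1) y(1) u(1) by simp
      then have "t = 1 / 2" by linarith
      then have "2 *\<^sub>R v t = u *s x + y" unfolding v_def \<open>t = 1 / 2\<close>
        by (simp add: scaleR_add_right)
      then have "y = (-1) *\<^sub>R (u *s x)" using eq by (simp add: eq_neg_iff_add_eq_0 add.commute)
      then have "qform B y = 0" using Bux by (metis mult_zero_right qform_scaleR)
      with By r show False by simp
    qed
    \<comment> \<open>The Rayleigh quotient along the path runs continuously from \<open>0\<close>
      to \<open>r\<close> and so takes the value \<open>l * r\<close>.\<close>
    define \<phi> where "\<phi> t = Re (qform B (v t)) / (norm (v t))\<^sup>2" for t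
    have cont: "continuous_on {0..1} \<phi>"
      unfolding \<phi>_def v_def
      by (intro continuous_intros) (use v0 in \<open>auto simp: v_def\<close>)
    have "\<phi> 0 = 0" "\<phi> 1 = r" using y(1) by (simp_all add: \<phi>_def qv) (simp add: v_def)
    moreover have "0 \<le> l * r" "l * r \<le> r" using sl r by (auto intro: mult_left_le_one_le)
    ultimately obtain t where t: "\<phi> t = l * r"
      using IVT'[of \<phi> 0 "l * r" 1, OF _ _ _ cont] by auto
    define w where "w = inverse (norm (v t)) *\<^sub>R v t"
    have w: "norm w = 1" using v0 by (simp add: w_def)
    have "Im (qform B (v t)) = 0" using u(2) by (simp add: qv)
    then have "qform B (v t) = of_real (l * r) * (norm (v t))\<^sup>2"
      using t v0[of t] by (simp add: \<phi>_def complex_eq_iff field_simps)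
    then have "qform B w = of_real (l * r)"
      using v0[of t] by (simp add: w_def qform_scaleR field_simps)
    then have "cnj (b - a) * (qform A w - a) = cnj (b - a) * (l * (b - a))"
      using w unfolding qB r_def complex_norm_square of_real_mult by (simp add: mult_ac)
    then have "qform A w - a = l * (b - a)" using False by auto
    then have "qform A w = a + l * (b - a)" by (simp only: diff_eq_eq add.commute)
    also have "\<dots> = (1 - l) *\<^sub>R a + l *\<^sub>R b" by (simp add: scaleR_conv_of_real algebra_simps)
    also have "1 - l = s" using sl(3) by simp
    finally show ?thesis
      unfolding numerical_range_altdef using w by (intro image_eqI[of _ _ w]) auto
  qed
qed

lemma numerical_range_shift: "numerical_range (A - mat c) = (\<lambda>w. w - c) ` numerical_range A"
  unfolding numerical_range_altdef by (auto simp: qform_diff qform_mat image_iff)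

text \<open>With \<open>y = B x \<noteq> 0\<close> and \<open>B y = 0\<close>, the form at
  \<open>y + s x\<close> is \<open>s |y|^2 + s^2 (x \<bullet> y)\<close>, which is positive for
  small \<open>s > 0\<close>.\<close>

lemma dissipative_kernel_square:
  fixes B :: "complex^'n^'n"
  assumes diss: "\<And>x. x \<bullet> (B *v x) \<le> 0" and "B *v (B *v x) = 0"
  shows "B *v x = 0"
proof (rule ccontr)
  define y where "y = B *v x"
  assume "B *v x \<noteq> 0"
  then have y: "y \<bullet> y > 0" by (simp add: y_def)
  have "B *v (y + s *\<^sub>R x) = s *\<^sub>R y" for s
    using assms(2) by (simp add: y_def matrix_vector_right_distrib matrix_vector.scaleR_right)
  then have *: "s * (y \<bullet> y) + s\<^sup>2 * (x \<bullet> y) \<le> 0" for s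
    using diss[of "y + s *\<^sub>R x"]
    by (simp add: inner_add_left power2_eq_square distrib_left mult.assoc)
  \<comment> \<open>Chosen so that \<open>s * \<bar>x \<bullet> y\<bar>\<close> stays strictly below
    \<open>y \<bullet> y\<close>.\<close>
  define s where "s = (y \<bullet> y) / (1 + \<bar>x \<bullet> y\<bar>)"
  have s: "s > 0" using y by (simp add: s_def)
  have "s * ((y \<bullet> y) + s * (x \<bullet> y)) \<le> 0"
    using *[of s] by (simp only: distrib_left power2_eq_square mult.assoc)
  then have "(y \<bullet> y) + s * (x \<bullet> y) \<le> 0" using s by (simp add: mult_le_0_iff)
  moreover have "- (s * \<bar>x \<bullet> y\<bar>) \<le> s * (x \<bullet> y)"
    using mult_left_mono[of "- \<bar>x \<bullet> y\<bar>" "x \<bullet> y" s] s by simp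
  ultimately have "(y \<bullet> y) \<le> s * \<bar>x \<bullet> y\<bar>" by linarith
  also have "\<dots> < s * (1 + \<bar>x \<bullet> y\<bar>)" using s by simp
  also have "\<dots> = y \<bullet> y" by (simp add: s_def)
  finally show False by simp
qed

section \<open>Minimal polynomial and Hermite interpolation\<close>

lemma matrix_poly_monom: "matrix_poly (monom c k) A = mat c ** matrix_power A k"
  by (subst matrix_poly_altdef[of _ k])
    (auto simp: degree_monom_le if_distrib[of mat] if_distrib[of "\<lambda>x. x ** _"]
      matrix_mult.zero_left cong: if_cong)

text \<open>More than \<open>N\<close> powers of \<open>A\<close> live in a real vector space of
  dimension \<open>N\<close>: either two coincide or they satisfy a real linear relation.\<close>

lemma annihilating_poly_exists: "\<exists>p. p \<noteq> 0 \<and> matrix_poly p A = 0"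
  for A :: "complex^'n^'n"
proof -
  define N where "N = DIM(complex^'n^'n)"
  show ?thesis
  proof (cases "inj_on (matrix_power A) {..N}")
    case False
    then obtain i j where ij: "i \<noteq> j" "matrix_power A i = matrix_power A j"
      by (auto simp: inj_on_def)
    have "matrix_poly (monom 1 i - monom 1 j) A = 0"
      using ij by (simp add: matrix_poly_diff matrix_poly_monom)
    moreover have "monom 1 i - monom (1::complex) j \<noteq> 0"
      using ij(1) by (metis coeff_monom eq_iff_diff_eq_0 zero_neq_one)
    ultimately show ?thesis by blast
  next
    case inj: True
    let ?S = "matrix_power A ` {..N}"
    have "dependent ?S"
      by (rule dependent_biggerset, unfold card_image[OF inj]) (simp add: N_def)
    then obtain u where u: "\<exists>v\<in>?S. u v \<noteq> 0" "(\<Sum>v\<in>?S. u v *\<^sub>R v) = 0"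
      by (auto simp: dependent_finite)
    define p where "p = (\<Sum>k\<le>N. monom (of_real (u (matrix_power A k)) :: complex) k)"
    have smat: "mat (of_real r) ** M = r *\<^sub>R M" for r and M :: "complex^'n^'n"
      by (simp add: vec_eq_iff scaleR_conv_of_real[where 'a=complex])
    have "matrix_poly p A = 0"
      using u(2) by (simp add: p_def matrix_poly_sum matrix_poly_monom smat sum.reindex[OF inj])
    moreover have "p \<noteq> 0"
    proof -
      obtain k where k: "k \<le> N" "u (matrix_power A k) \<noteq> 0" using u(1) by auto
      then have "coeff p k \<noteq> 0"
        by (simp add: p_def coeff_sum coeff_monom if_distrib cong: if_cong)
      then show ?thesis by auto
    qed
    ultimately show ?thesis by blast
  qed
qed

text \<open>This justifies the definite description in \<open>minpoly\<close>: two monic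
  annihilating polynomials of least degree have a difference of smaller degree, which is zero by
  minimality.\<close>

lemma
  shows lead_coeff_minpoly: "lead_coeff (minpoly A) = 1"
    and matrix_poly_minpoly: "matrix_poly (minpoly A) A = 0"
    and degree_minpoly_le: "q \<noteq> 0 \<Longrightarrow> matrix_poly q A = 0 \<Longrightarrow> degree (minpoly A) \<le> degree q"
proof -
  let ?P = "\<lambda>p. lead_coeff p = 1 \<and> matrix_poly p A = 0 \<and>
                       (\<forall>q. q \<noteq> 0 \<and> matrix_poly q A = 0 \<longrightarrow> degree p \<le> degree q)"
  obtain q where q: "q \<noteq> 0" "matrix_poly q A = 0"
      "\<And>r. r \<noteq> 0 \<and> matrix_poly r A = 0 \<Longrightarrow> degree q \<le> degree r"
    using annihilating_poly_exists[of A]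
      ex_has_least_nat[of "\<lambda>p. p \<noteq> 0 \<and> matrix_poly p A = 0" _ degree] by blast
  have "\<exists>!p. ?P p"
  proof (rule ex1I)
    show "?P (smult (inverse (lead_coeff q)) q)"
      using q by (simp add: matrix_poly_smult)
  next
    fix p assume p: "?P p"
    let ?q = "smult (inverse (lead_coeff q)) q"
    have "p \<noteq> 0" using p by auto
    then have deg: "degree p = degree q" using p q by (simp add: antisym)
    show "p = ?q"
    proof (rule ccontr)
      assume "p \<noteq> ?q"
      then have d: "p - ?q \<noteq> 0" by simp
      have "matrix_poly (p - ?q) A = 0"
        using p q by (simp add: matrix_poly_diff matrix_poly_smult)
      then have le: "degree q \<le> degree (p - ?q)" using q(3) d by blast
      have "degree (p - ?q) \<le> degree q" using deg by (intro degree_diff_le) auto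
      then have "degree (p - ?q) = degree q" using le by simp
      then have "lead_coeff (p - ?q) = 0" using p q(1) deg by simp
      then show False using d by (simp only: leading_coeff_0_iff)
    qed
  qed
  then have "?P (minpoly A)"
    unfolding minpoly_def by (rule theI')
  then show "lead_coeff (minpoly A) = 1" "matrix_poly (minpoly A) A = 0"
    "q \<noteq> 0 \<Longrightarrow> matrix_poly q A = 0 \<Longrightarrow> degree (minpoly A) \<le> degree q" for q
    by blast+
qed

lemma minpoly_nonzero [simp]: "minpoly A \<noteq> 0"
  using lead_coeff_minpoly[of A] by auto

lemma degree_minpoly_pos: "degree (minpoly A) > 0"
proof (rule ccontr)
  assume "\<not> ?thesis"
  then have "minpoly A = 1" using lead_coeff_minpoly[of A]
    by (metis degree_0_id gr0I one_pCons)
  then have "(mat 1 :: complex^'a^'a) = 0" using matrix_poly_minpoly[of A] by simp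
  then have "(mat 1 :: complex^'a^'a) $ undefined $ undefined = 0" by simp
  then show False by (simp add: mat_def)
qed

lemma matrix_poly_eq_0_if_minpoly_dvd: "minpoly A dvd p \<Longrightarrow> matrix_poly p A = 0"
  by (auto simp: dvd_def matrix_poly_mult matrix_poly_minpoly matrix_mult.zero_left)

text \<open>The cofactor \<open>q\<close> of a root has smaller degree, so
  \<open>q(A) \<noteq> 0\<close>, and every nonzero vector in its range is an eigenvector.\<close>

lemma minpoly_root_in_spectrum:
  assumes "poly (minpoly A) \<mu> = 0"
  shows "\<mu> \<in> spectrum A"
proof -
  obtain q where q: "minpoly A = [:-\<mu>, 1:] * q" using assms by (auto simp: poly_eq_0_iff_dvd)
  have "q \<noteq> 0" using q by (metis minpoly_nonzero mult_zero_right)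
  then have "degree q < degree (minpoly A)" unfolding q by (subst degree_mult_eq) auto
  then have "matrix_poly q A \<noteq> 0" using degree_minpoly_le[OF \<open>q \<noteq> 0\<close>] by force
  then obtain v where v: "matrix_poly q A *v v \<noteq> 0" by (auto simp: matrix_eq)
  have "matrix_poly [:-\<mu>, 1:] A *v (matrix_poly q A *v v) = 0"
    using matrix_poly_minpoly[of A] unfolding q matrix_poly_mult
    by (simp add: matrix_vector_mul_assoc)
  then have "A *v (matrix_poly q A *v v) = \<mu> *s (matrix_poly q A *v v)"
    by (simp add: matrix_vector_mult_add_rdistrib vector_smult_lneg)
  then show ?thesis using v by (auto simp: spectrum_def)
qed

lemma order_minpoly_le_1:
  assumes "\<And>x. (A - mat \<mu>) *v ((A - mat \<mu>) *v x) = 0 \<Longrightarrow> (A - mat \<mu>) *v x = 0"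
  shows "order \<mu> (minpoly A) \<le> 1"
proof (rule ccontr)
  assume "\<not> ?thesis"
  then have "[:-\<mu>, 1:] ^ 2 dvd minpoly A" by (simp add: order_divides)
  then obtain q where q: "minpoly A = [:-\<mu>, 1:] ^ 2 * q" by (auto simp: dvd_def)
  define r where "r = [:-\<mu>, 1:] * q"
  have qr: "minpoly A = [:-\<mu>, 1:] * r"
    unfolding q r_def by (simp only: power2_eq_square mult.assoc)
  have "r \<noteq> 0" using qr by (metis minpoly_nonzero mult_zero_right)
  then have "degree r < degree (minpoly A)" unfolding qr by (subst degree_mult_eq) auto
  then have "matrix_poly r A \<noteq> 0" using degree_minpoly_le[OF \<open>r \<noteq> 0\<close>] by force
  then obtain v where v: "matrix_poly r A *v v \<noteq> 0" by (auto simp: matrix_eq)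
  have B: "matrix_poly [:-\<mu>, 1:] A = A - mat \<mu>"
    by (simp add: mat_diff[of 0, simplified])
  have rv: "matrix_poly r A *v v = (A - mat \<mu>) *v (matrix_poly q A *v v)"
    unfolding r_def matrix_poly_mult B by (simp add: matrix_vector_mul_assoc)
  have "(A - mat \<mu>) *v (matrix_poly r A *v v) = 0"
    using matrix_poly_minpoly[of A] unfolding qr matrix_poly_mult B
    by (simp add: matrix_vector_mul_assoc)
  then show False using assms[of "matrix_poly q A *v v"] v unfolding rv by blast
qed

text \<open>A supporting half-plane turns a rotated shift of \<open>A\<close> into a dissipative matrix, which excludes nontrivial
  Jordan blocks for the eigenvalue.\<close>

lemma order_minpoly_boundary:
  assumes "\<mu> \<in> numerical_range A" "\<mu> \<notin> interior (numerical_range A)"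
  shows "order \<mu> (minpoly A) \<le> 1"
proof -
  let ?W = "numerical_range A"
  \<comment> \<open>\<open>a\<close> is an outer normal at \<open>\<mu>\<close>. A range without
    interior lies in a line, whose normal serves for every point.\<close>
  obtain a where a: "a \<noteq> 0" "\<And>w. w \<in> ?W \<Longrightarrow> a \<bullet> w \<le> a \<bullet> \<mu>"
  proof (cases "interior ?W = {}")
    case True
    obtain a b where "a \<noteq> 0" "?W \<subseteq> {x. a \<bullet> x = b}"
      using empty_interior_subset_hyperplane[OF convex_numerical_range True] .
    then have "a \<bullet> w = b" if "w \<in> ?W" for w using that by blast
    with \<open>a \<noteq> 0\<close> assms(1) show thesis by (intro that[of a]) auto
  next
    case False
    then have "\<mu> \<notin> rel_interior ?W" using assms by (simp add: rel_interior_nonempty_interior)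
    moreover have "\<mu> \<in> closure ?W" using assms(1) closure_subset by blast
    ultimately obtain a where "a \<noteq> 0" and "\<And>w. w \<in> closure ?W \<Longrightarrow> a \<bullet> \<mu> \<le> a \<bullet> w"
      by (metis supporting_hyperplane_relative_frontier[OF convex_numerical_range])
    then have "a \<noteq> 0 \<and> (\<forall>w\<in>?W. a \<bullet> \<mu> \<le> a \<bullet> w)" using closure_subset by blast
    then show thesis by (intro that[of "-a"]) auto
  qed
  \<comment> \<open>Multiplication by \<open>cnj a\<close> turns the supporting half-plane at
    \<open>\<mu>\<close> into the left half-plane, so the form of \<open>B\<close> has nonpositive
    real part.\<close>
  define B where "B = mat (cnj a) ** (A - mat \<mu>)"
  have Bv: "B *v x = cnj a *s ((A - mat \<mu>) *v x)" for x
    by (simp add: B_def flip: matrix_vector_mul_assoc)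
  have diss: "x \<bullet> (B *v x) \<le> 0" for x
  proof (cases "x = 0")
    case False
    then obtain w where w: "w \<in> ?W" "qform A x = of_real ((norm x)\<^sup>2) * w" using qform_eq by blast
    have "qform B x = of_real ((norm x)\<^sup>2) * (cnj a * (w - \<mu>))"
      by (simp add: B_def qform_mat_mult qform_diff qform_mat w(2) algebra_simps)
    then have "x \<bullet> (B *v x) = (norm x)\<^sup>2 * Re (cnj a * (w - \<mu>))"
      unfolding Re_qform[symmetric] by (simp only: Re_complex_of_real Im_complex_of_real times_complex.sel)
    moreover have "Re (cnj a * (w - \<mu>)) \<le> 0" using a(2)[OF w(1)]
      by (simp add: inner_complex_def algebra_simps)
    ultimately show ?thesis by (simp add: mult_nonneg_nonpos)
  qed simp
  show ?thesis
  proof (rule order_minpoly_le_1)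
    fix x assume "(A - mat \<mu>) *v ((A - mat \<mu>) *v x) = 0"
    then have "B *v (B *v x) = 0" by (simp add: Bv matrix_mult_smult)
    then have "B *v x = 0" using dissipative_kernel_square[OF diss] by blast
    then show "(A - mat \<mu>) *v x = 0" using a(1) by (simp add: Bv vector_mul_eq_0)
  qed
qed

text \<open>Hermite conditions become divisibility conditions. The induction differentiates once:
  the order of a zero then drops by exactly one.\<close>

lemma linear_power_dvd_iff:
  fixes h :: "complex poly"
  shows "[:-\<mu>, 1:] ^ m dvd h \<longleftrightarrow> (\<forall>k<m. poly ((pderiv ^^ k) h) \<mu> = 0)"
proof (induction m arbitrary: h)
  case (Suc m)
  have split: "(\<forall>k<Suc m. P k) \<longleftrightarrow> P 0 \<and> (\<forall>k<m. P (Suc k))" for P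
    by (simp add: All_less_Suc2)
  have "[:-\<mu>, 1:] ^ Suc m dvd h \<longleftrightarrow> poly h \<mu> = 0 \<and> [:-\<mu>, 1:] ^ m dvd pderiv h"
  proof
    assume "[:-\<mu>, 1:] ^ Suc m dvd h"
    then obtain q where q: "h = [:-\<mu>, 1:] ^ Suc m * q" by (auto simp: dvd_def)
    have "pderiv h = [:-\<mu>, 1:] ^ m * (of_nat (Suc m) * q + [:-\<mu>, 1:] * pderiv q)"
      unfolding q pderiv_mult pderiv_power_Suc by (simp add: pderiv_pCons algebra_simps of_nat_poly)
    moreover have "poly h \<mu> = 0" unfolding q by simp
    ultimately show "poly h \<mu> = 0 \<and> [:-\<mu>, 1:] ^ m dvd pderiv h" by simp
  next
    assume *: "poly h \<mu> = 0 \<and> [:-\<mu>, 1:] ^ m dvd pderiv h"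
    show "[:-\<mu>, 1:] ^ Suc m dvd h"
    proof (cases "pderiv h = 0")
      case True
      then obtain c where "h = [:c:]" using pderiv_iszero by blast
      then show ?thesis using * by simp
    next
      case False
      then have "h \<noteq> 0" by auto
      then have "order \<mu> h = Suc (order \<mu> (pderiv h))"
        using * by (intro order_pderiv) (auto simp: order_root)
      then show ?thesis using * False by (simp only: order_divides) auto
    qed
  qed
  also have "\<dots> \<longleftrightarrow> (\<forall>k<Suc m. poly ((pderiv ^^ k) h) \<mu> = 0)"
    unfolding split Suc.IH by (simp add: funpow_swap1)
  finally show ?case .
qed simp

text \<open>Induction on the total number of conditions. After the highest condition at some node
  \<open>\<nu>\<close> is dropped, \<open>p\<close> solves the rest; the product \<open>w\<close> of
  the remaining linear powers disturbs none of these conditions, and a multiple of it adjusts the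
  dropped one.\<close>

lemma hermite_interpolation_exists:
  fixes y :: "complex \<Rightarrow> nat \<Rightarrow> complex"
  assumes "finite S"
  shows "\<exists>p. \<forall>\<mu>\<in>S. \<forall>k<m \<mu>. poly ((pderiv ^^ k) p) \<mu> = y \<mu> k"
proof (induction "sum m S" arbitrary: m)
  case 0
  then show ?case using assms by auto
next
  case (Suc N)
  obtain \<nu> where \<nu>: "\<nu> \<in> S" "m \<nu> > 0"
    using Suc.hyps(2) by (metis gr0I nat.distinct(1) sum.neutral)
  define m' where "m' = m(\<nu> := m \<nu> - 1)"
  have "sum m' S = N"
  proof -
    have "sum m' (S - {\<nu>}) = sum m (S - {\<nu>})" by (rule sum.cong) (auto simp: m'_def)
    then show ?thesis
      using Suc.hyps(2) \<nu> sum.remove[OF assms \<nu>(1), of m] sum.remove[OF assms \<nu>(1), of m'] by (simp add: m'_def)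
  qed
  from Suc.hyps(1)[OF this[symmetric]] obtain p
    where p: "\<And>\<mu> k. \<mu> \<in> S \<Longrightarrow> k < m' \<mu> \<Longrightarrow> poly ((pderiv ^^ k) p) \<mu> = y \<mu> k" by blast
  define n where "n = m' \<nu>"
  have n: "m \<nu> = Suc n" using \<nu> by (simp add: n_def m'_def)
  define w where "w = (\<Prod>\<mu>\<in>S. [:-\<mu>, 1:] ^ m' \<mu>)"
  have w0: "poly ((pderiv ^^ k) w) \<mu> = 0" if "\<mu> \<in> S" "k < m' \<mu>" for \<mu> k
  proof -
    have "[:-\<mu>, 1:] ^ m' \<mu> dvd w" unfolding w_def using assms that(1) by (rule dvd_prodI)
    then show ?thesis using that(2) linear_power_dvd_iff by blast
  qed
  \<comment> \<open>Otherwise \<open>w\<close> would have one zero too many at \<open>\<nu>\<close>,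
    and \<open>\<nu>\<close> would be a root of a factor belonging to another node.\<close>
  have wn: "poly ((pderiv ^^ n) w) \<nu> \<noteq> 0"
  proof
    assume "poly ((pderiv ^^ n) w) \<nu> = 0"
    then have "[:-\<nu>, 1:] ^ Suc n dvd w"
      unfolding linear_power_dvd_iff using w0[OF \<nu>(1)] by (auto simp: less_Suc_eq n_def)
    also have "w = [:-\<nu>, 1:] ^ n * (\<Prod>\<mu>\<in>S - {\<nu>}. [:-\<mu>, 1:] ^ m' \<mu>)"
      unfolding w_def n_def using assms \<nu>(1) by (rule prod.remove)
    finally have "[:-\<nu>, 1:] dvd (\<Prod>\<mu>\<in>S - {\<nu>}. [:-\<mu>, 1:] ^ m' \<mu>)"
      unfolding power_Suc2 dvd_mult_cancel_left by simp
    then have "poly (\<Prod>\<mu>\<in>S - {\<nu>}. [:-\<mu>, 1:] ^ m' \<mu>) \<nu> = 0" by (simp add: poly_eq_0_iff_dvd)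
    then show False using assms by (auto simp: poly_prod poly_power)
  qed
  define c where "c = (y \<nu> n - poly ((pderiv ^^ n) p) \<nu>) / poly ((pderiv ^^ n) w) \<nu>"
  have "poly ((pderiv ^^ k) (p + smult c w)) \<mu> = y \<mu> k" if "\<mu> \<in> S" "k < m \<mu>" for \<mu> k
  proof (cases "k < m' \<mu>")
    case True
    then show ?thesis using p w0 that by (simp add: higher_pderiv_add higher_pderiv_smult)
  next
    case False
    then have \<mu>: "\<mu> = \<nu>" using that(2) by (metis fun_upd_other m'_def)
    then have "k = n" using False that(2) n by (simp add: n_def[symmetric])
    note \<mu> this
    then show ?thesis using wn by (simp add: higher_pderiv_add higher_pderiv_smult c_def)
  qed
  then show ?case by blast
qed

lemma finite_spectrum: "finite (spectrum A)"
proof -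
  have "spectrum A \<subseteq> {\<mu>. poly (minpoly A) \<mu> = 0}"
  proof
    fix \<mu> assume "\<mu> \<in> spectrum A"
    then obtain v where v: "v \<noteq> 0" "A *v v = \<mu> *s v" by (auto simp: spectrum_def)
    have "poly (minpoly A) \<mu> *s v = 0"
      using matrix_poly_eigenvector[OF v(2), of "minpoly A"] by (simp add: matrix_poly_minpoly)
    then show "\<mu> \<in> {\<mu>. poly (minpoly A) \<mu> = 0}" using v(1) by (simp add: vector_mul_eq_0)
  qed
  then show ?thesis by (rule finite_subset) (simp add: poly_roots_finite)
qed

text \<open>Both polynomials split into linear factors over the complex numbers, so it suffices to
  compare multiplicities of roots.\<close>

lemma minpoly_dvd_if_vanishing:
  assumes "\<And>\<mu> k. \<mu> \<in> spectrum A \<Longrightarrow> k < order \<mu> (minpoly A) \<Longrightarrow> poly ((pderiv ^^ k) h) \<mu> = 0"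
  shows "minpoly A dvd h"
proof (cases "h = 0")
  case False
  have "order \<mu> (minpoly A) \<le> order \<mu> h" for \<mu>
  proof (cases "\<mu> \<in> spectrum A")
    case True
    then have "[:-\<mu>, 1:] ^ order \<mu> (minpoly A) dvd h"
      using assms by (auto simp: linear_power_dvd_iff)
    then show ?thesis using False by (simp add: order_divides)
  next
    case False
    then have "poly (minpoly A) \<mu> \<noteq> 0" using minpoly_root_in_spectrum by blast
    then show ?thesis by (simp add: order_0I)
  qed
  then have "proots (minpoly A) \<subseteq># proots h"
    using False by (auto simp: subseteq_mset_def)
  then have "(\<Prod>x\<in>#proots (minpoly A). [:-x, 1:]) dvd (\<Prod>x\<in>#proots h. [:-x, 1:])"
    by (intro prod_mset_subset_imp_dvd image_mset_subseteq_mono)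
  then show ?thesis
    using complex_poly_decompose_multiset[of "minpoly A"] complex_poly_decompose_multiset[of h] lead_coeff_minpoly[of A]
    by (metis dvd_smult smult_1_left)
qed simp

lemma matrix_poly_eq_if_interpolates:
  assumes "\<And>\<mu> k. \<mu> \<in> spectrum A \<Longrightarrow> k < order \<mu> (minpoly A)
             \<Longrightarrow> poly ((pderiv ^^ k) p) \<mu> = poly ((pderiv ^^ k) q) \<mu>"
  shows "matrix_poly p A = matrix_poly q A"
proof -
  have "(pderiv ^^ k) (p - q) = (pderiv ^^ k) p - (pderiv ^^ k) q" for k
    using higher_pderiv_add[of k p "smult (-1) q"] higher_pderiv_smult[of k "-1" q] by simp
  then have "minpoly A dvd p - q"
    using assms by (intro minpoly_dvd_if_vanishing) simp
  then show ?thesis using matrix_poly_eq_0_if_minpoly_dvd[of A "p - q"] by (simp add: matrix_poly_diff)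
qed

text \<open>Reduction modulo the minimal polynomial changes neither \<open>p(A)\<close> nor the
  prescribed derivatives, and gives the only interpolant below the degree bound. Any Hermite
  interpolant may thus replace the one in the definition.\<close>

lemma matrix_fun_eq:
  assumes p: "hermite_interpolates p f A"
  shows "matrix_fun f A = matrix_poly p A"
proof -
  have dpd: "(pderiv ^^ k) (p - q) = (pderiv ^^ k) p - (pderiv ^^ k) q" for k and p q :: "complex poly"
    using higher_pderiv_add[of k p "smult (-1) q"] higher_pderiv_smult[of k "-1" q] by simp
  define r where "r = p mod minpoly A"
  have rp: "poly ((pderiv ^^ k) r) \<mu> = poly ((pderiv ^^ k) p) \<mu>" if "k < order \<mu> (minpoly A)" for k \<mu>
  proof -
    have "[:-\<mu>, 1:] ^ order \<mu> (minpoly A) dvd p - r"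
      using order_1[of \<mu> "minpoly A"] by (rule dvd_trans) (simp add: r_def minus_mod_eq_mult_div)
    then show ?thesis using that by (auto simp: linear_power_dvd_iff dpd)
  qed
  have r: "degree r < degree (minpoly A)" "hermite_interpolates r f A"
    using degree_mod_less[of "minpoly A" p] degree_minpoly_pos[of A] p rp
    by (auto simp: r_def hermite_interpolates_def)
  have "(THE p. degree p < degree (minpoly A) \<and> hermite_interpolates p f A) = r"
  proof (rule the_equality)
    fix s assume s: "degree s < degree (minpoly A) \<and> hermite_interpolates s f A"
    then have "minpoly A dvd s - r"
      using r by (intro minpoly_dvd_if_vanishing) (auto simp: dpd hermite_interpolates_def)
    moreover have "degree (s - r) < degree (minpoly A)" using s r(1) by (intro degree_diff_less) auto
    ultimately show "s = r" using dvd_imp_degree_le[of "minpoly A" "s - r"] by force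
  qed (use r in auto)
  then have "matrix_fun f A = matrix_poly r A" by (simp add: matrix_fun_def)
  also have "\<dots> = matrix_poly p A" by (rule matrix_poly_eq_if_interpolates) (rule rp)
  finally show ?thesis .
qed

text \<open>For interpolants, the value at \<open>A\<close> is a finite linear combination of fixed
  matrices with the Hermite data as coefficients, hence continuous in these data.\<close>

lemma matrix_fun_limit:
  assumes lim: "\<And>\<mu> k. \<mu> \<in> spectrum A \<Longrightarrow> k < order \<mu> (minpoly A)
      \<Longrightarrow> (\<lambda>t. poly ((pderiv ^^ k) (P t)) \<mu>) \<longlonglongrightarrow> (deriv ^^ k) f \<mu>"
  shows "(\<lambda>t. matrix_poly (P t) A) \<longlonglongrightarrow> matrix_fun f A"
proof -
  define m where "m \<mu> = order \<mu> (minpoly A)" for \<mu>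
  \<comment> \<open>Cardinal polynomials: for an eigenvalue \<open>\<nu>\<close> and an admissible
    order \<open>l\<close>, the \<open>l\<close>-th derivative of \<open>b \<nu> l\<close> at
    \<open>\<nu>\<close> is \<open>1\<close> and all other data are \<open>0\<close>.\<close>
  have "\<exists>b. \<forall>\<mu>\<in>spectrum A. \<forall>k<m \<mu>. poly ((pderiv ^^ k) b) \<mu> = (if \<mu> = \<nu> \<and> k = l then 1 else 0)" for \<nu> l
    by (rule hermite_interpolation_exists[OF finite_spectrum])
  then obtain b where b: "\<And>\<nu> l \<mu> k. \<mu> \<in> spectrum A \<Longrightarrow> k < m \<mu>
      \<Longrightarrow> poly ((pderiv ^^ k) (b \<nu> l)) \<mu> = (if \<mu> = \<nu> \<and> k = l then 1 else 0)"
    by metis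
  define I where "I y = (\<Sum>\<nu>\<in>spectrum A. \<Sum>l<m \<nu>. smult (y \<nu> l) (b \<nu> l))" for y
  have I: "poly ((pderiv ^^ k) (I y)) \<mu> = y \<mu> k" if "\<mu> \<in> spectrum A" "k < m \<mu>" for y \<mu> k
  proof -
    have "poly ((pderiv ^^ k) (I y)) \<mu>
        = (\<Sum>\<nu>\<in>spectrum A. \<Sum>l<m \<nu>. y \<nu> l * (if \<mu> = \<nu> \<and> k = l then 1 else 0))"
      using b that by (simp add: I_def higher_pderiv_sum higher_pderiv_smult poly_sum)
    also have "\<dots> = (\<Sum>\<nu>\<in>spectrum A. if \<mu> = \<nu> then y \<mu> k else 0)"
      using that(2) by (intro sum.cong) (auto simp: if_distrib cong: if_cong)
    finally show ?thesis using that(1) finite_spectrum[of A] by simp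
  qed
  have mI: "matrix_poly (I y) A = (\<Sum>\<nu>\<in>spectrum A. \<Sum>l<m \<nu>. mat (y \<nu> l) ** matrix_poly (b \<nu> l) A)" for y
    by (simp add: I_def matrix_poly_sum matrix_poly_smult)
  have f: "matrix_fun f A = matrix_poly (I (\<lambda>\<nu> l. (deriv ^^ l) f \<nu>)) A"
    by (rule matrix_fun_eq) (simp add: hermite_interpolates_def I flip: m_def)
  have P: "matrix_poly (P t) A = matrix_poly (I (\<lambda>\<nu> l. poly ((pderiv ^^ l) (P t)) \<nu>)) A" for t
    by (rule matrix_poly_eq_if_interpolates) (simp add: I flip: m_def)
  show ?thesis
    unfolding f P mI
    by (intro tendsto_sum matrix_mult.tendsto tendsto_const bounded_linear.tendsto[OF bounded_linear_mat] lim)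
      (auto simp: m_def)
qed

section \<open>Uniform limits of polynomials at a matrix\<close>

lemma higher_deriv_poly: "(deriv ^^ k) (poly p) = poly ((pderiv ^^ k) p)" for p :: "complex poly"
proof (induction k arbitrary: p)
  case (Suc k)
  have "deriv (poly p) = poly (pderiv p)" by (intro ext DERIV_imp_deriv poly_DERIV)
  then show ?case using Suc by (simp add: funpow_Suc_right del: funpow.simps)
qed simp

lemma matrix_fun_uniform_limit:
  assumes W: "numerical_range A \<subseteq> W" and unif: "uniform_limit W (\<lambda>t. poly (P t)) f sequentially"
  shows "(\<lambda>t. matrix_poly (P t) A) \<longlonglongrightarrow> matrix_fun f A"
proof (rule matrix_fun_limit)
  fix \<mu> k assume \<mu>: "\<mu> \<in> spectrum A" and k: "k < order \<mu> (minpoly A)"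
  have \<mu>W: "\<mu> \<in> numerical_range A" using \<mu> spectrum_subset_numerical_range by blast
  show "(\<lambda>t. poly ((pderiv ^^ k) (P t)) \<mu>) \<longlonglongrightarrow> (deriv ^^ k) f \<mu>"
  proof (cases "\<mu> \<in> interior (numerical_range A)")
    case False
    then have "k = 0" using order_minpoly_boundary[OF \<mu>W] k by simp
    then show ?thesis using tendsto_uniform_limitI[OF unif] \<mu>W W by auto
  next
    case True
    then obtain r where r: "r > 0" "cball \<mu> r \<subseteq> numerical_range A"
      by (auto simp: mem_interior_cball)
    have ul: "uniform_limit (cball \<mu> r) (\<lambda>t. poly (P t)) f sequentially"
      using unif by (rule uniform_limit_on_subset) (use r W in auto)
    have hP: "continuous_on S (poly p)" "poly p holomorphic_on S" for S and p :: "complex poly"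
      by (auto intro!: continuous_intros holomorphic_intros)
    obtain hf: "continuous_on (cball \<mu> r) f" "f holomorphic_on ball \<mu> r"
      using holomorphic_uniform_limit[OF _ ul] hP by auto
    show ?thesis
    proof (rule tendstoI)
      fix e :: real assume "e > 0"
      \<comment> \<open>The value for which Cauchy's estimate \<open>fact k * B / r ^ k\<close>
        equals \<open>e / 2\<close>.\<close>
      define B where "B = e * r ^ k / (2 * fact k)"
      have "B > 0" using \<open>e > 0\<close> r(1) by (simp add: B_def)
      from uniform_limitD[OF ul this]
      show "\<forall>\<^sub>F t in sequentially. dist (poly ((pderiv ^^ k) (P t)) \<mu>) ((deriv ^^ k) f \<mu>) < e"
      proof eventually_elim
        fix t assume t: "\<forall>x\<in>cball \<mu> r. dist (poly (P t) x) (f x) < B"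
        have "cmod ((deriv ^^ k) (\<lambda>x. poly (P t) x - f x) \<mu>) \<le> fact k * B / r ^ k"
        proof (rule Cauchy_inequality)
          show "cmod (poly (P t) x - f x) \<le> B" if "cmod (\<mu> - x) = r" for x
            using t that by (auto simp: dist_norm intro!: less_imp_le)
        qed (auto intro!: holomorphic_on_diff continuous_on_diff hP hf r)
        also have "\<dots> < e" using r(1) \<open>e > 0\<close> by (simp add: B_def)
        also have "(deriv ^^ k) (\<lambda>x. poly (P t) x - f x) \<mu> = (deriv ^^ k) (poly (P t)) \<mu> - (deriv ^^ k) f \<mu>"
          by (rule higher_deriv_diff[where S = "ball \<mu> r"]) (use hP hf r in auto)
        finally show "dist (poly ((pderiv ^^ k) (P t)) \<mu>) ((deriv ^^ k) f \<mu>) < e"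
          by (simp add: dist_norm higher_deriv_poly)
      qed
    qed
  qed
qed

section \<open>Smooth convex curves around a compact convex set\<close>

text \<open>\<open>left_\<gamma>\<close> places \<Omega> strictly to the left of every tangent: the
  curve is positively oriented, and this imaginary part is the source of all positivity below.
  Winding number one is recorded about \<open>0\<close> only; Cauchy's formula at other points comes
  from shrinking them to \<open>0\<close>. Periodicity over the reals allows integration to start at
  any boundary point.\<close>

locale convex_loop =
  fixes \<gamma> \<gamma>' :: "real \<Rightarrow> complex" and \<Omega> :: "complex set"
  assumes open_\<Omega>: "open \<Omega>" and convex_\<Omega>: "convex \<Omega>" and bounded_\<Omega>: "bounded \<Omega>" and zero_in_\<Omega>: "0 \<in> \<Omega>"
    and deriv_\<gamma>: "\<And>t. (\<gamma> has_vector_derivative \<gamma>' t) (at t)"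
    and continuous_\<gamma>': "continuous_on UNIV \<gamma>'"
    and periodic_\<gamma>: "\<And>t. \<gamma> (t + 2 * pi) = \<gamma> t" and periodic_\<gamma>': "\<And>t. \<gamma>' (t + 2 * pi) = \<gamma>' t"
    and simple_\<gamma>: "\<And>s t. s < t \<Longrightarrow> t < s + 2 * pi \<Longrightarrow> \<gamma> s \<noteq> \<gamma> t"
    and left_\<gamma>: "\<And>z t. z \<in> \<Omega> \<Longrightarrow> 0 < Im (cnj (\<gamma>' t) * (z - \<gamma> t))"
    and closure_\<gamma>: "\<And>t. \<gamma> t \<in> closure \<Omega>"
    and frontier_\<gamma>: "\<And>z. z \<in> frontier \<Omega> \<Longrightarrow> \<exists>t. \<gamma> t = z"
    and winding_\<gamma>: "((\<lambda>t. \<gamma>' t / \<gamma> t) has_integral 2 * pi * \<i>) {0..2 * pi}"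

text \<open>Each frontier point of a bounded neighbourhood \<open>V\<close> is cut off from
  \<open>S\<close> by a half-plane, and by compactness finitely many suffice. The resulting polygon
  is connected, contains \<open>0\<close> and misses the frontier, so it stays in \<open>V\<close>.
  The last conclusion expresses that it contains no ray from \<open>0\<close>.\<close>

lemma polyhedral_neighbourhood:
  fixes S U :: "complex set"
  assumes S: "compact S" "convex S" "0 \<in> S" and U: "open U" "S \<subseteq> U"
  obtains N :: "complex set" where "finite N" "\<forall>a\<in>N. \<forall>x\<in>S. a \<bullet> x < 1"
    "{u. \<forall>a\<in>N. a \<bullet> u \<le> 1} \<subseteq> U" "bounded {u. \<forall>a\<in>N. a \<bullet> u \<le> 1}"
    "\<forall>u. u \<noteq> 0 \<longrightarrow> (\<exists>a\<in>N. a \<bullet> u > 0)"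
proof -
  obtain r where r: "S \<subseteq> ball 0 r" using compact_imp_bounded[OF S(1)] bounded_subset_ballD by blast
  define V where "V = U \<inter> ball 0 r"
  have V: "open V" "S \<subseteq> V" "bounded V" using U r by (auto simp: V_def intro: bounded_Int)
  have cf: "compact (frontier V)" using V(3) by (rule compact_frontier_bounded)
  have "\<exists>a. a \<bullet> b > 1 \<and> (\<forall>x\<in>S. a \<bullet> x < 1)" if b: "b \<in> frontier V" for b
  proof -
    have "b \<notin> S" using b V by (auto simp: frontier_def interior_open)
    then obtain a \<beta> where a: "a \<bullet> b < \<beta>" "\<And>x. x \<in> S \<Longrightarrow> a \<bullet> x > \<beta>"
      using separating_hyperplane_closed_point[OF S(2) compact_imp_closed[OF S(1)]] by blast
    \<comment> \<open>Since \<open>0 \<in> S\<close>, the threshold is negative; dividing by it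
      reverses the inequalities and normalises it to \<open>1\<close>.\<close>
    have "\<beta> < 0" using a(2)[OF S(3)] by simp
    then have "((1 / \<beta>) *\<^sub>R a) \<bullet> b > 1" "\<And>x. x \<in> S \<Longrightarrow> ((1 / \<beta>) *\<^sub>R a) \<bullet> x < 1"
      using a by (auto simp: field_simps)
    then show ?thesis by blast
  qed
  then obtain a where a: "\<And>b. b \<in> frontier V \<Longrightarrow> a b \<bullet> b > 1"
    "\<And>b x. b \<in> frontier V \<Longrightarrow> x \<in> S \<Longrightarrow> a b \<bullet> x < 1" by metis
  have "\<exists>D\<subseteq>frontier V. finite D \<and> frontier V \<subseteq> (\<Union>b\<in>D. {u. a b \<bullet> u > 1})"
  proof (rule compactE_image[OF cf])
    show "open {u. a b \<bullet> u > 1}" for b by (rule open_halfspace_gt)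
    show "frontier V \<subseteq> (\<Union>b\<in>frontier V. {u. a b \<bullet> u > 1})" using a(1) by auto
  qed blast
  then obtain D where D: "D \<subseteq> frontier V" "finite D" "frontier V \<subseteq> (\<Union>b\<in>D. {u. a b \<bullet> u > 1})" by blast
  define P where "P = {u. \<forall>c\<in>a ` D. c \<bullet> u \<le> 1}"
  have cP: "convex P"
  proof -
    have "P = (\<Inter>c\<in>a ` D. {u. c \<bullet> u \<le> 1})" by (auto simp: P_def)
    then show ?thesis by (auto intro!: convex_INT convex_halfspace_le)
  qed
  have "P \<inter> frontier V = {}" using D(3) by (fastforce simp: P_def)
  moreover have "0 \<in> P \<inter> V" using V S(3) by (auto simp: P_def)
  ultimately have PV: "P \<subseteq> V"
    using connected_Int_frontier[OF convex_connected[OF cP], of V] by blast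
  have "\<exists>c\<in>a ` D. c \<bullet> u > 0" if u: "u \<noteq> 0" for u
  proof (rule ccontr)
    assume *: "\<not> ?thesis"
    have "s *\<^sub>R u \<in> P" if "s \<ge> 0" for s
      using * that mult_nonneg_nonpos[of s] by (fastforce simp: P_def not_less intro: order_trans)
    moreover obtain B where B: "\<And>x. x \<in> V \<Longrightarrow> norm x \<le> B" using V(3) by (auto simp: bounded_iff)
    ultimately have "norm (((\<bar>B\<bar> + 1) / norm u) *\<^sub>R u) \<le> B" using PV by (meson abs_ge_zero add_nonneg_nonneg
          divide_nonneg_nonneg norm_ge_zero subsetD zero_le_one)
    then show False using u by simp
  qed
  then show thesis
    using D a PV V by (intro that[of "a ` D"]) (auto simp: V_def P_def intro: bounded_subset)
qed

text \<open>Convex functions lie above their tangents. Exponents start at two because the positive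
  part itself has a kink at \<open>0\<close>.\<close>

lemma pos_part_power_tangent:
  fixes x y :: real
  shows "max 0 y ^ Suc (Suc k) \<ge> max 0 x ^ Suc (Suc k) + Suc (Suc k) * max 0 x ^ Suc k * (y - x)"
proof -
  have conv: "b ^ Suc m \<ge> a ^ Suc m + Suc m * a ^ m * (b - a)" if "a \<ge> 0" "b \<ge> 0" for a b :: real and m
  proof (induction m)
    case (Suc m)
    have "0 \<le> Suc m * a ^ m * (b - a)\<^sup>2" using that by simp
    moreover have "b * (a ^ Suc m + Suc m * a ^ m * (b - a)) \<le> b * b ^ Suc m"
      using Suc that by (intro mult_left_mono)
    ultimately show ?case by (simp add: algebra_simps power2_eq_square)
  qed simp
  show ?thesis
  proof (cases "x \<le> 0")
    case False
    have "max 0 x ^ Suc (Suc k) + Suc (Suc k) * max 0 x ^ Suc k * (y - x)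
        \<le> max 0 x ^ Suc (Suc k) + Suc (Suc k) * max 0 x ^ Suc k * (max 0 y - max 0 x)"
      using False by (intro add_left_mono mult_left_mono) auto
    also have "\<dots> \<le> max 0 y ^ Suc (Suc k)" by (rule conv) auto
    finally show ?thesis .
  qed simp
qed

lemma pos_part_power_deriv:
  fixes x :: real
  shows "((\<lambda>x. max 0 x ^ Suc (Suc k)) has_real_derivative Suc (Suc k) * max 0 x ^ Suc k) (at x)"
proof (cases x "0::real" rule: linorder_cases)
  case less
  have "((\<lambda>x. 0) has_real_derivative 0) (at x)" by simp
  then show ?thesis
    using less by (subst DERIV_cong_ev[of x x _ "\<lambda>_. 0"])
      (auto simp: eventually_nhds_in_open intro!: eventually_mono[OF eventually_nhds_in_open[of "{..<0}"]])
next
  case greater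
  have "((\<lambda>x. x ^ Suc (Suc k)) has_real_derivative Suc (Suc k) * x ^ Suc k) (at x)"
    using DERIV_pow[of "Suc (Suc k)" x] by simp
  then show ?thesis
    using greater by (subst DERIV_cong_ev[of x x _ "\<lambda>x. x ^ Suc (Suc k)"])
      (auto intro!: eventually_mono[OF eventually_nhds_in_open[of "{0<..}"]])
next
  case equal
  have "((\<lambda>h::real. max 0 h ^ Suc (Suc k) / h) \<longlongrightarrow> 0) (at 0)"
  proof (rule Lim_null_comparison)
    have "\<forall>\<^sub>F h::real in at 0. h \<in> {-1<..<1}"
      by (rule eventually_at_in_open') auto
    then show "\<forall>\<^sub>F h::real in at 0. norm (max 0 h ^ Suc (Suc k) / h) \<le> \<bar>h\<bar>"
    proof eventually_elim
      fix h :: real assume h: "h \<in> {-1<..<1}"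
      show "norm (max 0 h ^ Suc (Suc k) / h) \<le> \<bar>h\<bar>"
      proof (cases "h > 0")
        case True
        then have "h * h ^ k \<le> h * 1" using h by (intro mult_left_mono power_le_one) auto
        then show ?thesis using True by (simp add: max_def abs_mult)
      qed simp
    qed
  qed (auto intro!: tendsto_eq_intros)
  then show ?thesis using equal by (simp add: has_field_derivative_iff)
qed

text \<open>The curve is a level set of a smoothed Minkowski functional of a polyhedral neighbourhood.\<close>

lemma convex_loop_exists:
  fixes S U :: "complex set"
  assumes S: "compact S" "convex S" "0 \<in> S" and U: "open U" "S \<subseteq> U"
  obtains \<gamma> \<gamma>' \<Omega> where "convex_loop \<gamma> \<gamma>' \<Omega>" "S \<subseteq> \<Omega>" "closure \<Omega> \<subseteq> U"
proof -
  obtain N where N: "finite N" "\<forall>a\<in>N. \<forall>x\<in>S. a \<bullet> x < 1"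
    "{u. \<forall>a\<in>N. a \<bullet> u \<le> 1} \<subseteq> U" "bounded {u. \<forall>a\<in>N. a \<bullet> u \<le> 1}"
    and Npos: "\<forall>u. u \<noteq> 0 \<longrightarrow> (\<exists>a\<in>N. a \<bullet> u > 0)"
    using polyhedral_neighbourhood[OF S U] .
  have "\<exists>\<kappa><1. \<forall>x\<in>S. a \<bullet> x \<le> \<kappa>" if "a \<in> N" for a
  proof -
    have "continuous_on S (\<lambda>x. a \<bullet> x)" by (intro continuous_intros)
    then obtain x where "x \<in> S" "\<forall>y\<in>S. a \<bullet> y \<le> a \<bullet> x"
      using continuous_attains_sup[OF S(1)] S(3) by blast
    then show ?thesis using N(2) that by blast
  qed
  then obtain k where k: "\<And>a. a \<in> N \<Longrightarrow> k a < 1" "\<And>a x. a \<in> N \<Longrightarrow> x \<in> S \<Longrightarrow> a \<bullet> x \<le> k a" by metis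
  define \<kappa> where "\<kappa> = Max (insert 0 (k ` N))"
  have \<kappa>: "0 \<le> \<kappa>" "\<kappa> < 1" "\<And>a x. a \<in> N \<Longrightarrow> x \<in> S \<Longrightarrow> a \<bullet> x \<le> \<kappa>"
    using N(1) k by (auto simp: \<kappa>_def intro: order_trans[OF k(2)])
  \<comment> \<open>On \<open>S\<close> every functional is at most \<open>\<kappa> < 1\<close>, so
    for a large exponent the sum of the powers is below \<open>1\<close>; this puts \<open>S\<close>
    inside the level set.\<close>
  have "(\<lambda>n. real (card N) * \<kappa> ^ n) \<longlonglongrightarrow> real (card N) * 0"
    using \<kappa> by (intro tendsto_intros LIMSEQ_realpow_zero)
  then have "\<forall>\<^sub>F n in sequentially. real (card N) * \<kappa> ^ n < 1"
    by (rule order_tendstoD) simp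
  then obtain n where n: "\<And>m. m \<ge> n \<Longrightarrow> real (card N) * \<kappa> ^ m < 1" by (auto simp: eventually_sequentially)
  define p where "p = Suc (Suc n)"
  have p: "real p > 0" by (simp add: p_def)
  \<comment> \<open>A continuously differentiable substitute for the maximum of the functionals:
    convex, homogeneous of degree \<open>p\<close>, with gradient \<open>D\<close>. The set
    \<open>G \<le> 1\<close> lies in the polygon because no summand exceeds \<open>1\<close>
    there.\<close>
  define G where "G u = (\<Sum>a\<in>N. max 0 (a \<bullet> u) ^ p)" for u
  define D where "D u = (\<Sum>a\<in>N. (p * max 0 (a \<bullet> u) ^ Suc n) *\<^sub>R a)" for u
  have tangent: "G y \<ge> G x + D x \<bullet> (y - x)" for x y
  proof -
    have "G x + D x \<bullet> (y - x) = (\<Sum>a\<in>N. max 0 (a \<bullet> x) ^ p + p * max 0 (a \<bullet> x) ^ Suc n * (a \<bullet> y - a \<bullet> x))"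
      by (simp add: G_def D_def inner_sum_left sum.distrib inner_diff_right right_diff_distrib sum_subtractf)
    also have "\<dots> \<le> G y" unfolding G_def p_def by (intro sum_mono pos_part_power_tangent)
    finally show ?thesis .
  qed
  have max_scale: "max 0 (r * x) = r * max 0 x" if "r \<ge> 0" for r x :: real
    using that by (auto simp: max_def mult_le_0_iff zero_le_mult_iff)
  have homG: "G (r *\<^sub>R u) = r ^ p * G u" if "r \<ge> 0" for r u
    using that by (simp add: G_def max_scale power_mult_distrib sum_distrib_left)
  have homD: "D (r *\<^sub>R u) = r ^ Suc n *\<^sub>R D u" if "r \<ge> 0" for r u
    using that by (simp add: D_def max_scale power_mult_distrib scaleR_sum_right mult_ac)
  \<comment> \<open>Euler's identity for homogeneous functions.\<close>
  have euler: "D u \<bullet> u = p * G u" for u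
    unfolding D_def G_def inner_sum_left sum_distrib_left
    by (intro sum.cong refl) (auto simp: p_def max_def)
  have Gpos: "G u > 0" if "u \<noteq> 0" for u
  proof -
    obtain a where a: "a \<in> N" "a \<bullet> u > 0" using Npos \<open>u \<noteq> 0\<close> by blast
    have "0 < max 0 (a \<bullet> u) ^ p" using a by simp
    also have "\<dots> \<le> G u" unfolding G_def using a N(1) by (intro member_le_sum) auto
    finally show ?thesis .
  qed
  have contG: "continuous_on UNIV G" unfolding G_def by (intro continuous_intros)
  have contD: "continuous_on UNIV D" unfolding D_def by (intro continuous_intros)
  define \<Omega> where "\<Omega> = {u. G u < 1}"
  have opn: "open \<Omega>" unfolding \<Omega>_def using contG by (intro open_Collect_less) auto
  have GleP: "{u. G u \<le> 1} \<subseteq> {u. \<forall>a\<in>N. a \<bullet> u \<le> 1}"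
  proof safe
    fix u a assume u: "G u \<le> 1" "a \<in> N"
    have "max 0 (a \<bullet> u) ^ p \<le> G u" unfolding G_def using u(2) N(1) by (intro member_le_sum) auto
    then have "max 0 (a \<bullet> u) ^ p \<le> 1 ^ p" using u(1) by simp
    then have "max 0 (a \<bullet> u) \<le> 1" using power_le_imp_le_base[of "max 0 (a \<bullet> u)" "Suc n" 1] by (simp add: p_def)
    then show "a \<bullet> u \<le> 1" by simp
  qed
  have "closed {u. G u \<le> 1}" using contG by (intro closed_Collect_le) auto
  then have clG: "closure \<Omega> \<subseteq> {u. G u \<le> 1}"
    unfolding \<Omega>_def by (intro closure_minimal) auto
  have conv: "convex \<Omega>"
  proof (rule convexI)
    fix x y :: complex and u v :: real
    assume xy: "x \<in> \<Omega>" "y \<in> \<Omega>" and uv: "0 \<le> u" "0 \<le> v" "u + v = 1"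
    define w where "w = u *\<^sub>R x + v *\<^sub>R y"
    have "u * (G w + D w \<bullet> (x - w)) + v * (G w + D w \<bullet> (y - w)) \<le> u * G x + v * G y"
      using uv by (intro add_mono mult_left_mono tangent)
    moreover have "u * (G w + D w \<bullet> (x - w)) + v * (G w + D w \<bullet> (y - w))
        = (u + v) * G w + D w \<bullet> (u *\<^sub>R x + v *\<^sub>R y - (u + v) *\<^sub>R w)"
      by (simp add: algebra_simps inner_add_right inner_diff_right)
    ultimately have "G w \<le> u * G x + v * G y" by (simp add: uv(3) w_def)
    also have "\<dots> < 1" using xy uv convex_bound_lt[of "G x" 1 "G y" u v] by (simp add: \<Omega>_def)
    finally show "u *\<^sub>R x + v *\<^sub>R y \<in> \<Omega>" by (simp add: \<Omega>_def w_def)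
  qed
  define E where "E t = G (cis t)" for t
  define E' where "E' t = D (cis t) \<bullet> (\<i> * cis t)" for t
  have Epos: "E t > 0" for t unfolding E_def by (rule Gpos) simp
  have dcis: "(cis has_vector_derivative \<i> * cis t) (at t)" for t
    unfolding has_vector_derivative_complex_iff by (auto intro!: derivative_eq_intros)
  have dE: "(E has_real_derivative E' t) (at t)" for t
  proof -
    have "((\<lambda>t. a \<bullet> cis t) has_real_derivative a \<bullet> (\<i> * cis t)) (at t)" for a
      unfolding has_real_derivative_iff_has_vector_derivative
      by (rule bounded_linear.has_vector_derivative[OF bounded_linear_inner_right dcis])
    from DERIV_chain2[OF pos_part_power_deriv[of n] this]
    have *: "((\<lambda>t. max 0 (a \<bullet> cis t) ^ p) has_real_derivative
        (p * max 0 (a \<bullet> cis t) ^ Suc n) * (a \<bullet> (\<i> * cis t))) (at t)" for a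
      by (simp add: p_def)
    show ?thesis unfolding E_def G_def
      by (rule DERIV_cong, rule DERIV_sum, rule *) (simp add: E'_def D_def inner_sum_left)
  qed
  \<comment> \<open>Homogeneity gives \<open>G (\<rho> t *\<^sub>R cis t) = 1\<close>: this is the
    level curve in polar coordinates.\<close>
  define \<rho> where "\<rho> t = E t powr (- 1 / p)" for t
  define \<rho>' where "\<rho>' t = (- 1 / p) * E t powr (- 1 / p - 1) * E' t" for t
  have \<rho>pos: "\<rho> t > 0" for t using Epos[of t] by (simp add: \<rho>_def)
  have d\<rho>: "(\<rho> has_real_derivative \<rho>' t) (at t)" for t
    unfolding \<rho>_def \<rho>'_def by (rule DERIV_cong, rule DERIV_fun_powr[OF dE Epos]) simp
  define \<gamma> where "\<gamma> t = \<rho> t *\<^sub>R cis t" for t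
  define \<gamma>' where "\<gamma>' t = \<rho> t *\<^sub>R (\<i> * cis t) + \<rho>' t *\<^sub>R cis t" for t
  have d\<gamma>: "(\<gamma> has_vector_derivative \<gamma>' t) (at t)" for t
    unfolding \<gamma>_def \<gamma>'_def by (rule has_vector_derivative_scaleR[OF d\<rho> dcis])
  have G\<gamma>: "G (\<gamma> t) = 1" for t
  proof -
    have "\<rho> t ^ p = E t powr (-1)"
      using Epos[of t] p by (simp add: \<rho>_def powr_powr flip: powr_realpow)
    then show ?thesis using \<rho>pos[of t] Epos[of t] by (simp add: \<gamma>_def homG powr_minus flip: E_def)
  qed
  \<comment> \<open>The tangent is a positive multiple of the gradient turned by a right angle: the
    radial and angular parts of \<open>D (cis t)\<close> are \<open>p * E t\<close>, by Euler's
    identity, and \<open>E' t\<close>.\<close>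
  have \<gamma>'_eq: "\<gamma>' t = (\<rho> t / (p * E t)) *\<^sub>R (\<i> * D (cis t))" for t
  proof -
    have "D (cis t) * cnj (cis t) = p * E t + \<i> * E' t"
      using euler[of "cis t"] by (simp add: complex_eq_iff E_def E'_def inner_complex_def algebra_simps)
    then have "D (cis t) * cnj (cis t) * cis t = (p * E t + \<i> * E' t) * cis t" by simp
    then have Dc: "D (cis t) = (p * E t + \<i> * E' t) * cis t"
      by (simp add: mult.assoc cis_cnj cis_mult)
    have \<rho>'_eq: "\<rho>' t = - \<rho> t * E' t / (p * E t)"
      using Epos[of t] by (simp add: \<rho>'_def \<rho>_def powr_diff)
    show ?thesis unfolding \<gamma>'_def Dc \<rho>'_eq using p Epos[of t]
      by (simp add: scaleR_conv_of_real field_simps)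
  qed
  have contE: "continuous_on UNIV E" unfolding E_def
    by (rule continuous_on_compose2[OF contG]) (auto intro!: continuous_intros)
  have contDc: "continuous_on UNIV (\<lambda>t. D (cis t))"
    by (rule continuous_on_compose2[OF contD]) (auto intro!: continuous_intros)
  have cont\<gamma>': "continuous_on UNIV \<gamma>'"
    unfolding \<gamma>'_eq[abs_def] \<rho>_def using contE contDc Epos p
    by (intro continuous_intros) (auto simp: less_imp_neq[THEN not_sym])
  have cis2: "cis (t + 2 * pi) = cis t" for t by (simp add: cis.code)
  have loop: "convex_loop \<gamma> \<gamma>' \<Omega>"
  proof
    show "open \<Omega>" "convex \<Omega>" by fact+
    show "bounded \<Omega>" using N(4) by (rule bounded_subset) (rule subset_trans[OF _ GleP], auto simp: \<Omega>_def)
    show "0 \<in> \<Omega>" by (simp add: \<Omega>_def G_def p_def)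
    show "(\<gamma> has_vector_derivative \<gamma>' t) (at t)" for t by fact
    show "continuous_on UNIV \<gamma>'" by fact
    show "\<gamma> (t + 2 * pi) = \<gamma> t" "\<gamma>' (t + 2 * pi) = \<gamma>' t" for t
      by (simp_all add: \<gamma>_def \<gamma>'_eq \<rho>_def E_def cis2)
    show "\<gamma> s \<noteq> \<gamma> t" if "s < t" "t < s + 2 * pi" for s t
    proof
      assume eq: "\<gamma> s = \<gamma> t"
      then have "norm (\<gamma> s) = norm (\<gamma> t)" by simp
      then have "\<rho> s = \<rho> t" using \<rho>pos[of s] \<rho>pos[of t] by (simp add: \<gamma>_def)
      then have "cis s = cis t" using eq \<rho>pos[of t] by (simp add: \<gamma>_def)
      then have "sin t = sin s \<and> cos t = cos s" by (simp add: cis.ctr)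
      then obtain j :: int where j: "t = s + 2 * pi * j" unfolding sin_cos_eq_iff by blast
      then have "0 < pi * j" "pi * j < pi * 1" using that by auto
      then have "0 < j" "real_of_int j < 1" by (simp_all only: zero_less_mult_iff mult_less_cancel_left_pos pi_gt_zero) auto
      then show False by simp
    qed
    show "0 < Im (cnj (\<gamma>' t) * (z - \<gamma> t))" if "z \<in> \<Omega>" for z t
    proof -
      \<comment> \<open>The gradient inequality between \<open>G (\<gamma> t) = 1\<close> and
        \<open>G z < 1\<close>.\<close>
      have "D (\<gamma> t) \<bullet> (z - \<gamma> t) < 0" using tangent[of "\<gamma> t" z] G\<gamma>[of t] that by (simp add: \<Omega>_def)
      then have "\<rho> t ^ Suc n * (D (cis t) \<bullet> (z - \<gamma> t)) < 0"
        using homD[of "\<rho> t" "cis t"] \<rho>pos[of t] by (simp add: \<gamma>_def)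
      then have neg: "D (cis t) \<bullet> (z - \<gamma> t) < 0"
        using \<rho>pos[of t] by (simp add: mult_less_0_iff zero_less_power not_less_iff_gr_or_eq)
      have "Im (cnj (\<gamma>' t) * (z - \<gamma> t)) = - ((\<rho> t / (p * E t)) * (D (cis t) \<bullet> (z - \<gamma> t)))"
        unfolding \<gamma>'_eq by (simp add: inner_complex_def algebra_simps)
      moreover have "\<rho> t / (p * E t) > 0" using \<rho>pos Epos p by simp
      ultimately show ?thesis using mult_pos_neg[OF _ neg] by (metis neg_0_less_iff_less)
    qed
    show "\<gamma> t \<in> closure \<Omega>" for t
    proof -
      have "(\<lambda>n. (1 - 1 / real (Suc n)) *\<^sub>R \<gamma> t) \<longlonglongrightarrow> (1 - 0) *\<^sub>R \<gamma> t"
        by (intro tendsto_intros LIMSEQ_Suc[OF lim_1_over_n])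
      moreover have "(1 - 1 / real (Suc n)) *\<^sub>R \<gamma> t \<in> \<Omega>" for n
      proof -
        have "(1 - 1 / real (Suc n)) ^ p \<le> (1 - 1 / real (Suc n)) ^ 1"
          by (rule power_decreasing) (auto simp: p_def)
        then have "(1 - 1 / real (Suc n)) ^ p < 1" by (rule le_less_trans) simp
        then show ?thesis by (simp add: \<Omega>_def homG G\<gamma>)
      qed
      ultimately show ?thesis unfolding closure_sequential by (intro exI) auto
    qed
    show "\<exists>t. \<gamma> t = z" if "z \<in> frontier \<Omega>" for z
    proof -
      have "G z = 1" using that clG opn by (force simp: frontier_def interior_open \<Omega>_def)
      then have z: "z \<noteq> 0" by (auto simp: G_def p_def)
      define t where "t = Arg z"
      have zt: "z = norm z *\<^sub>R cis t" using z by (simp add: t_def cis_Arg sgn_div_norm)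
      have "norm z ^ p * E t = 1" using \<open>G z = 1\<close> homG[of "norm z" "cis t"] by (simp add: E_def flip: zt)
      moreover have "\<rho> t ^ p * E t = 1" using G\<gamma>[of t] \<rho>pos[of t] by (simp add: \<gamma>_def homG E_def)
      ultimately have "norm z ^ p = \<rho> t ^ p" using Epos[of t] by (metis less_irrefl mult_right_cancel)
      then have "norm z = \<rho> t" using \<rho>pos[of t] p by (simp add: power_eq_iff_eq_base less_imp_le)
      then have "\<gamma> t = z" unfolding \<gamma>_def using zt by simp
      then show ?thesis ..
    qed
    show "((\<lambda>t. \<gamma>' t / \<gamma> t) has_integral 2 * pi * \<i>) {0..2 * pi}"
    proof -
      \<comment> \<open>A continuous logarithm of \<open>\<gamma>\<close>: its real part is periodic
        and its imaginary part grows by \<open>2 * pi\<close>.\<close>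
      have "((\<lambda>t. of_real (ln (\<rho> t)) + \<i> * of_real t) has_vector_derivative \<gamma>' t / \<gamma> t) (at t within {0..2*pi})" for t
      proof -
        have "((\<lambda>t. ln (\<rho> t)) has_real_derivative \<rho>' t / \<rho> t) (at t within {0..2*pi})"
          by (rule DERIV_cong, rule DERIV_chain2[OF DERIV_ln]) (use \<rho>pos d\<rho> in \<open>auto simp: field_simps intro: has_field_derivative_at_within\<close>)
        then have "((\<lambda>t. complex_of_real (ln (\<rho> t))) has_vector_derivative of_real (\<rho>' t / \<rho> t)) (at t within {0..2*pi})"
          unfolding has_real_derivative_iff_has_vector_derivative
          by (rule bounded_linear.has_vector_derivative[OF bounded_linear_of_real])
        moreover have "((\<lambda>t. \<i> * complex_of_real t) has_vector_derivative \<i> * 1) (at t within {0..2*pi})"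
          by (intro derivative_intros has_vector_derivative_mult_right) (auto intro!: derivative_eq_intros)
        ultimately have "((\<lambda>t. of_real (ln (\<rho> t)) + \<i> * of_real t) has_vector_derivative of_real (\<rho>' t / \<rho> t) + \<i> * 1) (at t within {0..2*pi})"
          by (rule has_vector_derivative_add)
        also have "of_real (\<rho>' t / \<rho> t) + \<i> * 1 = \<gamma>' t / \<gamma> t"
          using \<rho>pos[of t] by (simp add: \<gamma>_def \<gamma>'_def scaleR_conv_of_real field_simps)
        finally show ?thesis .
      qed
      from fundamental_theorem_of_calculus[OF _ this]
      have "((\<lambda>t. \<gamma>' t / \<gamma> t) has_integral (of_real (ln (\<rho> (2 * pi))) + \<i> * of_real (2 * pi))
              - (of_real (ln (\<rho> 0)) + \<i> * of_real 0)) {0..2 * pi}" by simp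
      also have "\<rho> (2 * pi) = \<rho> 0" using cis2[of 0] by (simp add: \<rho>_def E_def)
      finally show ?thesis by (simp add: mult_ac)
    qed
  qed
  moreover have "S \<subseteq> \<Omega>"
  proof
    fix x assume x: "x \<in> S"
    have "G x \<le> (\<Sum>a\<in>N. \<kappa> ^ p)" unfolding G_def using \<kappa> x by (intro sum_mono power_mono) auto
    also have "\<dots> < 1" using n[of p] by (simp add: p_def)
    finally show "x \<in> \<Omega>" by (simp add: \<Omega>_def)
  qed
  moreover have "closure \<Omega> \<subseteq> U" using clG GleP N(3) by blast
  ultimately show thesis by (rule that)
qed

section \<open>Resolvents along the curve\<close>

text \<open>By the identity \<open>N y - N x = N y (M x - M y) N x\<close>, a uniform bound on the
  inverses gives continuity.\<close>

lemma inverse_family_continuous: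
  fixes M N :: "'a::metric_space \<Rightarrow> complex^'n^'n"
  assumes M: "continuous_on T M"
    and inv: "\<And>x. x \<in> T \<Longrightarrow> M x ** N x = mat 1" "\<And>x. x \<in> T \<Longrightarrow> N x ** M x = mat 1"
    and bound: "\<And>x. x \<in> T \<Longrightarrow> norm (N x) \<le> \<kappa>"
  shows "continuous_on T N"
proof (clarsimp simp: continuous_on_def)
  fix x assume x: "x \<in> T"
  obtain K where K: "K > 0"
      "\<And>(a :: complex^'n^'n) (b :: complex^'n^'n). norm (a ** b) \<le> norm a * norm b * K"
    using bounded_bilinear.pos_bounded[OF bounded_bilinear_matrix_mult[where 'n = 'n]] by blast
  have diff: "N y - N x = N y ** ((M x - M y) ** N x)" if "y \<in> T" for y
  proof -
    have "N y ** ((M x - M y) ** N x) = N y ** (M x ** N x) - (N y ** M y) ** N x"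
      by (simp add: matrix_mult.diff_left matrix_mult.diff_right matrix_mul_assoc)
    then show ?thesis using x that by (simp add: inv)
  qed
  have "((\<lambda>y. norm ((M x - M y) ** N x) * (\<bar>\<kappa>\<bar> * K)) \<longlongrightarrow> norm ((M x - M x) ** N x) * (\<bar>\<kappa>\<bar> * K)) (at x within T)"
    by (intro tendsto_intros matrix_mult.tendsto) (use M x in \<open>auto simp: continuous_on_def\<close>)
  then have lim: "((\<lambda>y. norm ((M x - M y) ** N x) * (\<bar>\<kappa>\<bar> * K)) \<longlongrightarrow> 0) (at x within T)"
    by (simp add: matrix_mult.zero_left)
  have "((\<lambda>y. N y - N x) \<longlongrightarrow> 0) (at x within T)"
  proof (rule Lim_null_comparison[OF _ lim])
    have "norm (N y - N x) \<le> norm ((M x - M y) ** N x) * (\<bar>\<kappa>\<bar> * K)" if y: "y \<in> T" for y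
    proof -
      have "norm (N y - N x) \<le> norm (N y) * norm ((M x - M y) ** N x) * K"
        unfolding diff[OF y] by (rule K(2))
      also have "\<dots> \<le> \<bar>\<kappa>\<bar> * norm ((M x - M y) ** N x) * K"
        using bound[OF y] K(1) by (intro mult_right_mono) auto
      finally show ?thesis by (simp add: mult_ac)
    qed
    then show "\<forall>\<^sub>F y in at x within T. norm (N y - N x) \<le> norm ((M x - M y) ** N x) * (\<bar>\<kappa>\<bar> * K)"
      by (simp add: eventually_at_filter)
  qed
  then show "(N \<longlongrightarrow> N x) (at x within T)" by (simp add: LIM_zero_iff)
qed

lemma inverse_family_vector_derivative:
  fixes M N :: "real \<Rightarrow> complex^'n^'n"
  assumes M: "(M has_vector_derivative M') (at x within T)"
    and inv: "\<And>x. x \<in> T \<Longrightarrow> M x ** N x = mat 1" "\<And>x. x \<in> T \<Longrightarrow> N x ** M x = mat 1"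
    and cont: "continuous_on T N" and x: "x \<in> T"
  shows "(N has_vector_derivative - (N x ** M' ** N x)) (at x within T)"
proof -
  have diff: "N y - N x = N y ** ((M x - M y) ** N x)" if "y \<in> T" for y
  proof -
    have "N y ** ((M x - M y) ** N x) = N y ** (M x ** N x) - (N y ** M y) ** N x"
      by (simp add: matrix_mult.diff_left matrix_mult.diff_right matrix_mul_assoc)
    then show ?thesis using x that by (simp add: inv)
  qed
  define E where "E y = (1 / norm (y - x)) *\<^sub>R (M y - (M x + (y - x) *\<^sub>R M'))" for y
  have E: "(E \<longlongrightarrow> 0) (at x within T)"
    using M unfolding has_vector_derivative_def has_derivative_within E_def by blast
  have lN: "(N \<longlongrightarrow> N x) (at x within T)" using cont x by (auto simp: continuous_on_def)
  \<comment> \<open>The error of the difference quotient of \<open>N\<close>, expressed by the error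
    \<open>E\<close> of \<open>M\<close> and by \<open>N y - N x\<close>, both of which vanish in
    the limit.\<close>
  define F where "F y = - (N y ** (E y ** N x)) - sgn (y - x) *\<^sub>R ((N y - N x) ** (M' ** N x))" for y
  have "((\<lambda>y. (N y - N x) ** (M' ** N x)) \<longlongrightarrow> 0) (at x within T)"
    using matrix_mult.tendsto[OF tendsto_diff[OF lN tendsto_const[of "N x"]] tendsto_const[of "M' ** N x"]]
    by (simp add: matrix_mult.zero_left)
  then have 1: "((\<lambda>y. sgn (y - x) *\<^sub>R ((N y - N x) ** (M' ** N x))) \<longlongrightarrow> 0) (at x within T)"
    by (rule Lim_null_comparison[rotated, OF tendsto_norm_zero]) (auto simp: sgn_real_def)
  have 2: "((\<lambda>y. - (N y ** (E y ** N x))) \<longlongrightarrow> 0) (at x within T)"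
    using tendsto_minus[OF matrix_mult.tendsto[OF lN matrix_mult.tendsto[OF E tendsto_const[of "N x"]]]]
    by (simp add: matrix_mult.zero_left matrix_mult.zero_right)
  have F: "(F \<longlongrightarrow> 0) (at x within T)"
    unfolding F_def using tendsto_diff[OF 2 1] by simp
  have "(1 / norm (y - x)) *\<^sub>R (N y - (N x + (y - x) *\<^sub>R - (N x ** M' ** N x))) = F y"
    if y: "y \<in> T" "y \<noteq> x" for y
  proof -
    have MM: "M x - M y = - (norm (y - x) *\<^sub>R E y) - (y - x) *\<^sub>R M'"
      using y(2) by (simp add: E_def)
    have "N y - N x = - (norm (y - x) *\<^sub>R (N y ** (E y ** N x))) - (y - x) *\<^sub>R (N y ** (M' ** N x))"
      unfolding diff[OF y(1)] MM
      by (simp add: matrix_mult.diff_left matrix_mult.diff_right matrix_mult.minus_left matrix_mult.minus_right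
          matrix_mult.scaleR_left matrix_mult.scaleR_right)
    then have "N y - (N x + (y - x) *\<^sub>R - (N x ** M' ** N x))
        = - (norm (y - x) *\<^sub>R (N y ** (E y ** N x))) - (y - x) *\<^sub>R ((N y - N x) ** (M' ** N x))"
      by (simp add: matrix_mult.diff_left matrix_mul_assoc algebra_simps)
    then show ?thesis
      using y(2) by (simp add: F_def scaleR_right_diff_distrib sgn_div_norm divide_inverse mult.commute)
  qed
  then have "((\<lambda>y. (1 / norm (y - x)) *\<^sub>R (N y - (N x + (y - x) *\<^sub>R - (N x ** M' ** N x)))) \<longlongrightarrow> 0) (at x within T)"
    using F by (subst tendsto_cong[where g = F]) (auto simp: eventually_at_filter)
  then show ?thesis
    unfolding has_vector_derivative_def has_derivative_within
    by (intro conjI bounded_linear_scaleR_left)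
qed

text \<open>Applied to the \<open>n\<close> unit vectors, the operator bound controls every column;
  here the factor \<open>sqrt n\<close> enters.\<close>

lemma norm_matrix_le:
  fixes M :: "complex^'n^'n"
  assumes "\<And>x. norm (M *v x) \<le> c * norm x" "c \<ge> 0"
  shows "norm M \<le> sqrt (real CARD('n)) * c"
proof -
  have "(norm M)\<^sup>2 \<le> (\<Sum>j\<in>(UNIV::'n set). c\<^sup>2)"
    unfolding norm_matrix_columns
  proof (intro sum_mono power_mono norm_ge_zero)
    fix j show "norm (M *v axis j 1) \<le> c" using assms(1)[of "axis j 1"] by simp
  qed
  also have "\<dots> = (sqrt (real CARD('n)) * c)\<^sup>2" by (simp add: power_mult_distrib)
  finally show ?thesis by (rule power2_le_imp_le) (use assms(2) in simp)
qed

text \<open>Bounded below means injective, hence invertible in finite dimension, with inverse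
  bounded by \<open>1 / c\<close>.\<close>

lemma matrix_inv_lower_bound:
  fixes M :: "complex^'n^'n"
  assumes "\<And>x. c * norm x \<le> norm (M *v x)" "c > 0"
  shows "M ** matrix_inv M = mat 1" "matrix_inv M ** M = mat 1"
    "norm (matrix_inv M *v x) \<le> norm x / c"
proof -
  have "inj ((*v) M)"
  proof (rule injI)
    fix x y assume "M *v x = M *v y"
    then have "c * norm (x - y) \<le> 0"
      using assms(1)[of "x - y"] by (simp add: matrix_vector_mult_diff_distrib)
    then show "x = y" using assms(2) by (simp add: mult_le_0_iff)
  qed
  then have "invertible M" by (simp add: invertible_left_inverse matrix_left_invertible_injective)
  then have *: "M ** matrix_inv M = mat 1 \<and> matrix_inv M ** M = mat 1"
    unfolding matrix_inv_def invertible_def by (rule someI_ex)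
  then show "M ** matrix_inv M = mat 1" "matrix_inv M ** M = mat 1" by blast+
  have "c * norm (matrix_inv M *v x) \<le> norm x"
    using assms(1)[of "matrix_inv M *v x"] * by (simp add: matrix_vector_mul_assoc)
  then show "norm (matrix_inv M *v x) \<le> norm x / c" using assms(2) by (simp add: field_simps)
qed

context convex_loop
begin

lemma continuous_\<gamma>: "continuous_on S \<gamma>"
  by (meson continuous_at_imp_continuous_on deriv_\<gamma> has_vector_derivative_continuous)

lemma continuous_\<gamma>'_on: "continuous_on S \<gamma>'"
  using continuous_\<gamma>' by (rule continuous_on_subset) simp

lemma \<gamma>'_bounded: obtains L where "L > 0" "\<And>t. t \<in> {0..2*pi} \<Longrightarrow> norm (\<gamma>' t) \<le> L"
proof -
  have "bounded (\<gamma>' ` {0..2*pi})"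
    by (intro compact_imp_bounded compact_continuous_image continuous_\<gamma>'_on) auto
  then show thesis using that by (auto simp: bounded_pos)
qed

lemma scaled_in_\<Omega>:
  assumes "w \<in> \<Omega>" "s \<in> {0..1}" shows "complex_of_real s * w \<in> \<Omega>"
proof -
  have "(1 - s) *\<^sub>R 0 + s *\<^sub>R w \<in> \<Omega>"
    by (rule convexD[OF convex_\<Omega>]) (use assms zero_in_\<Omega> in auto)
  then show ?thesis by (simp add: scaleR_conv_of_real)
qed

text \<open>The quantity is the distance from the tangent up to the factor
  \<open>cmod (\<gamma>' t)\<close>; it is positive and continuous on a compact set of parameters
  and points.\<close>

lemma gap:
  assumes "compact K" "K \<subseteq> \<Omega>"
  obtains \<delta> where "\<delta> > 0"
    "\<And>t w. t \<in> {0..2*pi} \<Longrightarrow> w \<in> K \<Longrightarrow> \<delta> \<le> Im (cnj (\<gamma>' t) * (w - \<gamma> t))"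
proof (cases "K = {}")
  case True
  then show thesis using that[of 1] by simp
next
  case False
  define h where "h = (\<lambda>p. Im (cnj (\<gamma>' (fst p)) * (snd p - \<gamma> (fst p))))"
  have "continuous_on ({0..2*pi} \<times> K) h"
    unfolding h_def
    by (intro continuous_intros continuous_on_compose2[OF continuous_\<gamma>] continuous_on_compose2[OF continuous_\<gamma>']) auto
  moreover have "compact ({0..2*pi} \<times> K)" using assms(1) by (intro compact_Times) auto
  moreover have "{0..2*pi} \<times> K \<noteq> {}" using False by auto
  ultimately obtain p where p: "p \<in> {0..2*pi} \<times> K" "\<And>q. q \<in> {0..2*pi} \<times> K \<Longrightarrow> h p \<le> h q"
    using continuous_attains_inf[of "{0..2*pi} \<times> K" h] by blast
  have "h p > 0" using p(1) assms(2) left_\<gamma> by (auto simp: h_def)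
  then show thesis using p(2)[of "(_, _)"] by (intro that[of "h p"]) (auto simp: h_def)
qed

lemma poly_integral_0: "((\<lambda>t. poly p (\<gamma> t) * \<gamma>' t) has_integral 0) {0..2*pi}"
proof -
  have "poly p holomorphic_on UNIV" by (auto intro!: holomorphic_intros)
  then obtain F where F: "\<And>z. (F has_field_derivative poly p z) (at z)"
    using holomorphic_convex_primitive'[of UNIV "poly p"] by auto
  have "((\<lambda>t. F (\<gamma> t)) has_vector_derivative \<gamma>' t * poly p (\<gamma> t)) (at t within {0..2*pi})" for t
    using field_vector_diff_chain_at[OF deriv_\<gamma> F, of t]
    by (auto simp: o_def intro: has_vector_derivative_at_within)
  from fundamental_theorem_of_calculus[OF _ this]
  have "((\<lambda>t. \<gamma>' t * poly p (\<gamma> t)) has_integral F (\<gamma> (2*pi)) - F (\<gamma> 0)) {0..2*pi}" by simp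
  then show ?thesis using periodic_\<gamma>[of 0] by (simp add: mult.commute)
qed

end

locale convex_loop_matrix = convex_loop +
  fixes A :: "complex^'n^'n"
  assumes numerical_range_\<Omega>: "numerical_range A \<subseteq> \<Omega>"
begin

text \<open>The parameter \<open>s\<close> shrinks the matrix: down to \<open>0\<close> for Cauchy's
  formula, and below \<open>1\<close> for polynomial approximation.\<close>

definition pencil :: "real \<Rightarrow> real \<Rightarrow> complex^'n^'n" where
  "pencil s t = mat (\<gamma> t) - mat (of_real s) ** A"

definition resolvent :: "real \<Rightarrow> real \<Rightarrow> complex^'n^'n" where
  "resolvent s t = matrix_inv (pencil s t)"

text \<open>The factor \<open>\<i> * cnj (\<gamma>' t)\<close> makes the position of the scaled
  numerical range relative to the tangent appear as the real part of the form. The point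
  \<open>w\<close> depends on \<open>x\<close>.\<close>

lemma pencil_form:
  obtains w where "w \<in> numerical_range A"
    "x \<bullet> ((\<i> * cnj (\<gamma>' t)) *s (pencil s t *v x)) = Im (cnj (\<gamma>' t) * (of_real s * w - \<gamma> t)) * (norm x)\<^sup>2"
proof (cases "x = 0")
  case True
  then show thesis using that numerical_range_nonempty[of A] by fastforce
next
  case False
  then obtain w where w: "w \<in> numerical_range A" "qform A x = of_real ((norm x)\<^sup>2) * w" using qform_eq by blast
  have "x \<bullet> ((\<i> * cnj (\<gamma>' t)) *s (pencil s t *v x)) = Re (qform (mat (\<i> * cnj (\<gamma>' t)) ** pencil s t) x)"
    unfolding Re_qform by (simp flip: matrix_vector_mul_assoc)
  also have "\<dots> = Im (cnj (\<gamma>' t) * (of_real s * w - \<gamma> t)) * (norm x)\<^sup>2"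
    unfolding qform_mat_mult pencil_def qform_diff qform_mat w(2)
    by (simp add: algebra_simps flip: of_real_power)
  finally show thesis using w(1) that by blast
qed

text \<open>The form is at least \<open>\<delta> |x|^2\<close> by the gap, and at most
  \<open>L |x|\<close> times the norm of the image by Cauchy--Schwarz, with \<open>L\<close> a bound
  for \<open>\<gamma>'\<close>.\<close>

lemma pencil_lower_bound:
  obtains c where "c > 0"
    "\<And>s t x. s \<in> {0..1} \<Longrightarrow> t \<in> {0..2*pi} \<Longrightarrow> c * norm x \<le> norm (pencil s t *v x)"
proof -
  define K where "K = (\<lambda>p. complex_of_real (fst p) * snd p) ` ({0..1} \<times> numerical_range A)"
  have "compact K" unfolding K_def
    by (intro compact_continuous_image continuous_intros compact_Times compact_numerical_range) auto
  moreover have "K \<subseteq> \<Omega>" using scaled_in_\<Omega> numerical_range_\<Omega> by (auto simp: K_def)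
  ultimately obtain \<delta> where \<delta>: "\<delta> > 0"
    "\<And>t w. t \<in> {0..2*pi} \<Longrightarrow> w \<in> K \<Longrightarrow> \<delta> \<le> Im (cnj (\<gamma>' t) * (w - \<gamma> t))" by (rule gap) blast
  obtain L where L: "L > 0" "\<And>t. t \<in> {0..2*pi} \<Longrightarrow> norm (\<gamma>' t) \<le> L" by (rule \<gamma>'_bounded) blast
  have "\<delta> / L * norm x \<le> norm (pencil s t *v x)" if s: "s \<in> {0..1}" and t: "t \<in> {0..2*pi}" for s t x
  proof (cases "x = 0")
    case False
    define c where "c = \<i> * cnj (\<gamma>' t)"
    obtain w where w: "w \<in> numerical_range A"
      "x \<bullet> (c *s (pencil s t *v x)) = Im (cnj (\<gamma>' t) * (of_real s * w - \<gamma> t)) * (norm x)\<^sup>2"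
      unfolding c_def by (rule pencil_form)
    have sw: "of_real s * w \<in> K" using s w(1) by (force simp: K_def)
    have "\<delta> * (norm x)\<^sup>2 \<le> Im (cnj (\<gamma>' t) * (of_real s * w - \<gamma> t)) * (norm x)\<^sup>2"
      using \<delta>(2)[OF t sw] by (intro mult_right_mono) auto
    also have "\<dots> = x \<bullet> (c *s (pencil s t *v x))" using w(2) by simp
    also have "\<dots> \<le> norm x * norm (c *s (pencil s t *v x))" by (rule norm_cauchy_schwarz)
    also have "\<dots> \<le> norm x * (L * norm (pencil s t *v x))"
      using L(2)[OF t] by (intro mult_left_mono) (auto simp: c_def norm_mult intro: mult_right_mono)
    finally have "norm x * (\<delta> * norm x) \<le> norm x * (L * norm (pencil s t *v x))"
      by (simp add: power2_eq_square mult_ac)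
    then have "\<delta> * norm x \<le> L * norm (pencil s t *v x)" using False by simp
    then show ?thesis using L(1) by (simp add: field_simps)
  qed simp
  then show thesis using that[of "\<delta> / L"] \<delta>(1) L(1) by simp
qed

lemma
  assumes "s \<in> {0..1}" "t \<in> {0..2*pi}"
  shows pencil_resolvent: "pencil s t ** resolvent s t = mat 1" and resolvent_pencil: "resolvent s t ** pencil s t = mat 1"
proof -
  obtain c where "c > 0"
    "\<And>s t x. s \<in> {0..1} \<Longrightarrow> t \<in> {0..2*pi} \<Longrightarrow> c * norm x \<le> norm (pencil s t *v x)"
    by (rule pencil_lower_bound) blast
  then show "pencil s t ** resolvent s t = mat 1" "resolvent s t ** pencil s t = mat 1"
    using matrix_inv_lower_bound(1,2)[of c "pencil s t"] assms by (auto simp: resolvent_def)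
qed

lemma resolvent_bounded:
  obtains \<kappa> where "\<kappa> > 0" "\<And>s t. s \<in> {0..1} \<Longrightarrow> t \<in> {0..2*pi} \<Longrightarrow> norm (resolvent s t) \<le> \<kappa>"
proof -
  obtain c where c: "c > 0"
    "\<And>s t x. s \<in> {0..1} \<Longrightarrow> t \<in> {0..2*pi} \<Longrightarrow> c * norm x \<le> norm (pencil s t *v x)"
    by (rule pencil_lower_bound) blast
  have "norm (resolvent s t) \<le> sqrt (real CARD('n)) * (1 / c)" if "s \<in> {0..1}" "t \<in> {0..2*pi}" for s t
    unfolding resolvent_def using matrix_inv_lower_bound(3)[of c "pencil s t"] c that
    by (intro norm_matrix_le) auto
  then show thesis using c(1) by (intro that[of "sqrt (real CARD('n)) * (1 / c)"]) auto
qed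

lemma continuous_pencil:
  assumes "continuous_on T u" "continuous_on T v"
  shows "continuous_on T (\<lambda>x. pencil (u x) (v x))"
  unfolding pencil_def
  by (intro continuous_intros matrix_mult.continuous_on bounded_linear.continuous_on[OF bounded_linear_mat]
      continuous_on_compose2[OF continuous_\<gamma>[of UNIV]] assms) auto

lemma continuous_resolvent:
  fixes T :: "'b::metric_space set"
  assumes "continuous_on T u" "continuous_on T v"
    and "\<And>x. x \<in> T \<Longrightarrow> u x \<in> {0..1}" "\<And>x. x \<in> T \<Longrightarrow> v x \<in> {0..2*pi}"
  shows "continuous_on T (\<lambda>x. resolvent (u x) (v x))"
proof -
  obtain \<kappa> where \<kappa>: "\<kappa> > 0" "\<And>s t. s \<in> {0..1} \<Longrightarrow> t \<in> {0..2*pi} \<Longrightarrow> norm (resolvent s t) \<le> \<kappa>" by (rule resolvent_bounded) blast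
  show ?thesis
    by (rule inverse_family_continuous[OF continuous_pencil[OF assms(1,2)], where \<kappa> = \<kappa>])
      (auto intro!: pencil_resolvent resolvent_pencil \<kappa> simp: assms(3,4)[simplified])
qed

lemma A_pencil: "A ** pencil s t = pencil s t ** A"
  by (simp add: pencil_def matrix_mult.diff_left matrix_mult.diff_right mat_mult_commute mat_mult_left_commute
      flip: matrix_mul_assoc)

lemma A_resolvent: "A ** resolvent s t = resolvent s t ** A" if "s \<in> {0..1}" "t \<in> {0..2*pi}"
proof -
  have "A ** resolvent s t = (resolvent s t ** pencil s t) ** (A ** resolvent s t)" using resolvent_pencil[OF that] by simp
  also have "\<dots> = resolvent s t ** (A ** pencil s t) ** resolvent s t" by (simp only: A_pencil matrix_mul_assoc)
  also have "\<dots> = (resolvent s t ** A) ** (pencil s t ** resolvent s t)" by (simp only: matrix_mul_assoc)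
  finally show ?thesis using pencil_resolvent[OF that] by simp
qed

lemma resolvent_deriv_t:
  assumes s: "s \<in> {0..1}" and t: "t \<in> {0..2*pi}"
  shows "(resolvent s has_vector_derivative - (mat (\<gamma>' t) ** (resolvent s t ** resolvent s t))) (at t within {0..2*pi})"
proof -
  have "(pencil s has_vector_derivative mat (\<gamma>' t) - 0) (at t within {0..2*pi})"
    unfolding pencil_def
    by (intro derivative_intros bounded_linear.has_vector_derivative[OF bounded_linear_mat]
        has_vector_derivative_at_within[OF deriv_\<gamma>])
  then have "(resolvent s has_vector_derivative - (resolvent s t ** (mat (\<gamma>' t) - 0) ** resolvent s t)) (at t within {0..2*pi})"
    by (rule inverse_family_vector_derivative)
      (use s t in \<open>auto intro!: pencil_resolvent resolvent_pencil continuous_resolvent continuous_intros\<close>)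
  then show ?thesis by (simp add: mat_mult_commute flip: matrix_mul_assoc)
qed

lemma resolvent_deriv_s:
  assumes s: "s \<in> {0..1}" and t: "t \<in> {0..2*pi}"
  shows "((\<lambda>s. resolvent s t) has_vector_derivative A ** (resolvent s t ** resolvent s t)) (at s within {0..1})"
proof -
  have "((\<lambda>s. mat (of_real s :: complex)) has_vector_derivative mat (of_real 1)) (at s within {0..1})"
    by (intro derivative_intros bounded_linear.has_vector_derivative[OF bounded_linear_mat]
        bounded_linear.has_vector_derivative[OF bounded_linear_of_real])
  then have "((\<lambda>s. pencil s t) has_vector_derivative 0 - mat (of_real 1) ** A) (at s within {0..1})"
    unfolding pencil_def
    by (intro derivative_intros bounded_linear.has_vector_derivative[OF matrix_mult.bounded_linear_left])
  then have "((\<lambda>s. resolvent s t) has_vector_derivative - (resolvent s t ** (0 - mat (of_real 1) ** A) ** resolvent s t)) (at s within {0..1})"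
    by (rule inverse_family_vector_derivative)
      (use s t in \<open>auto intro!: pencil_resolvent resolvent_pencil continuous_resolvent continuous_intros\<close>)
  then show ?thesis using A_resolvent[OF s t]
    by (simp add: matrix_mult.minus_left matrix_mult.minus_right matrix_mul_assoc)
qed

text \<open>Shrinking the matrix to zero does not change the integral of the resolvent.\<close>

lemma resolvent_integral: "((\<lambda>t. mat (\<gamma>' t) ** resolvent 1 t) has_integral mat (2 * pi * \<i>)) {0..2*pi}"
proof -
  define I where "I s = integral {0..2*pi} (\<lambda>t. mat (\<gamma>' t) ** resolvent s t)" for s
  \<comment> \<open>The \<open>s\<close>-derivative of the integrand. It equals \<open>- A\<close>
    times the \<open>t\<close>-derivative of the resolvent, so its integral over a period
    vanishes.\<close>
  define J where "J s t = mat (\<gamma>' t) ** (A ** (resolvent s t ** resolvent s t))" for s t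
  have int: "(\<lambda>t. mat (\<gamma>' t) ** resolvent s t) integrable_on {0..2*pi}" if "s \<in> {0..1}" for s
    by (intro integrable_continuous_real matrix_mult.continuous_on bounded_linear.continuous_on[OF bounded_linear_mat]
        continuous_\<gamma>'_on continuous_resolvent continuous_intros) (use that in auto)
  have J0: "integral {0..2*pi} (J s) = 0" if s: "s \<in> {0..1}" for s
  proof -
    have "((\<lambda>t. - (mat (\<gamma>' t) ** (resolvent s t ** resolvent s t))) has_integral resolvent s (2*pi) - resolvent s 0) {0..2*pi}"
      by (rule fundamental_theorem_of_calculus) (auto intro: resolvent_deriv_t s)
    moreover have "resolvent s (2*pi) = resolvent s 0" using periodic_\<gamma>[of 0] by (simp add: resolvent_def pencil_def)
    ultimately have "((\<lambda>t. - (mat (\<gamma>' t) ** (resolvent s t ** resolvent s t))) has_integral 0) {0..2*pi}" by simp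
    from has_integral_linear[OF this matrix_mult.bounded_linear_right[of "- A"]]
    have "(J s has_integral 0) {0..2*pi}"
      by (simp add: o_def J_def[abs_def] matrix_mult.minus_left matrix_mult.minus_right matrix_mult.zero_right mat_mult_left_commute)
    then show ?thesis by (rule integral_unique)
  qed
  have "(I has_vector_derivative 0) (at s within {0..1})" if s: "s \<in> {0..1}" for s
  proof -
    have "((\<lambda>s. integral (cbox 0 (2*pi)) (\<lambda>t. mat (\<gamma>' t) ** resolvent s t)) has_vector_derivative
        integral (cbox 0 (2*pi)) (J s)) (at s within {0..1})"
    proof (rule leibniz_rule_vector_derivative)
      show "((\<lambda>s. mat (\<gamma>' t) ** resolvent s t) has_vector_derivative J s t) (at s within {0..1})"
        if "s \<in> {0..1}" "t \<in> cbox 0 (2*pi)" for s t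
        unfolding J_def using that
        by (intro bounded_linear.has_vector_derivative[OF matrix_mult.bounded_linear_right] resolvent_deriv_s) auto
      show "continuous_on ({0..1} \<times> cbox 0 (2*pi)) (\<lambda>(s, t). J s t)"
        unfolding J_def split_beta
        by (intro matrix_mult.continuous_on bounded_linear.continuous_on[OF bounded_linear_mat]
            continuous_on_compose2[OF continuous_\<gamma>'] continuous_resolvent continuous_intros) auto
    qed (use s int in auto)
    then show ?thesis using J0[OF s] by (simp add: I_def[abs_def])
  qed
  then have "((\<lambda>s. 0) has_integral I 1 - I 0) {0..1::real}"
    by (intro fundamental_theorem_of_calculus) auto
  from has_integral_unique[OF this has_integral_0] have "I 1 = I 0" by simp
  also have "I 0 = mat (2 * pi * \<i>)"
  proof -
    have "mat (\<gamma>' t) ** resolvent 0 t = mat (\<gamma>' t / \<gamma> t)" if t: "t \<in> {0..2*pi}" for t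
    proof -
      have "\<gamma> t \<noteq> 0" using left_\<gamma>[OF zero_in_\<Omega>, of t] by auto
      then have "mat (\<gamma>' t) ** resolvent 0 t = (mat (\<gamma>' t / \<gamma> t) ** mat (\<gamma> t)) ** resolvent 0 t"
        unfolding mat_mult_mat by simp
      also have "\<dots> = mat (\<gamma>' t / \<gamma> t) ** (pencil 0 t ** resolvent 0 t)"
        by (simp add: pencil_def matrix_mult.zero_left flip: matrix_mul_assoc)
      finally show ?thesis using pencil_resolvent[of 0 t] t by simp
    qed
    moreover have "((\<lambda>t. mat (\<gamma>' t / \<gamma> t) :: complex^'n^'n) has_integral mat (2 * pi * \<i>)) {0..2*pi}"
      using has_integral_linear[OF winding_\<gamma> bounded_linear_mat] by (simp add: o_def)
    ultimately have "((\<lambda>t. mat (\<gamma>' t) ** resolvent 0 t) has_integral mat (2 * pi * \<i>)) {0..2*pi}"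
      by (metis (no_types, lifting) has_integral_eq)
    then show ?thesis unfolding I_def by (rule integral_unique)
  qed
  finally have "integral {0..2*pi} (\<lambda>t. mat (\<gamma>' t) ** resolvent 1 t) = mat (2 * pi * \<i>)" unfolding I_def .
  then show ?thesis using integrable_integral[OF int[of 1]] by simp
qed

text \<open>Induction on the coefficients with \<open>\<gamma> R = 1 + A R\<close>: the term without
  resolvent is an exact derivative and integrates to \<open>0\<close> over the closed curve.\<close>

lemma cauchy_formula:
  "((\<lambda>t. mat (poly f (\<gamma> t) * \<gamma>' t) ** resolvent 1 t) has_integral mat (2 * pi * \<i>) ** matrix_poly f A) {0..2*pi}"
proof (induction f)
  case 0
  show ?case by (simp add: matrix_mult.zero_left matrix_mult.zero_right)
next
  case (pCons a p)
  have 1: "((\<lambda>t. mat a ** (mat (\<gamma>' t) ** resolvent 1 t)) has_integral mat a ** mat (2 * pi * \<i>)) {0..2*pi}"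
    using has_integral_linear[OF resolvent_integral matrix_mult.bounded_linear_right[of "mat a"]] by (simp add: o_def)
  have 2: "((\<lambda>t. mat (poly p (\<gamma> t) * \<gamma>' t) :: complex^'n^'n) has_integral mat 0) {0..2*pi}"
    using has_integral_linear[OF poly_integral_0[of p] bounded_linear_mat] by (simp add: o_def)
  have 3: "((\<lambda>t. A ** (mat (poly p (\<gamma> t) * \<gamma>' t) ** resolvent 1 t)) has_integral
      A ** (mat (2 * pi * \<i>) ** matrix_poly p A)) {0..2*pi}"
    using has_integral_linear[OF pCons.IH matrix_mult.bounded_linear_right[of A]] by (simp add: o_def)
  have "((\<lambda>t. mat (poly (pCons a p) (\<gamma> t) * \<gamma>' t) ** resolvent 1 t) has_integral
      mat a ** mat (2 * pi * \<i>) + mat 0 + A ** (mat (2 * pi * \<i>) ** matrix_poly p A)) {0..2*pi}"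
  proof (rule has_integral_eq[OF _ has_integral_add[OF has_integral_add[OF 1 2] 3]])
    fix t assume t: "t \<in> {0..2*pi}"
    have \<gamma>R: "mat (\<gamma> t) ** resolvent 1 t = mat 1 + A ** resolvent 1 t"
      using pencil_resolvent[of 1 t] t by (simp add: pencil_def matrix_mult.diff_left algebra_simps)
    have "(mat (poly (pCons a p) (\<gamma> t) * \<gamma>' t) :: complex^'n^'n)
        = mat a ** mat (\<gamma>' t) + mat (poly p (\<gamma> t) * \<gamma>' t) ** mat (\<gamma> t)"
      unfolding mat_mult_mat mat_add[symmetric] by (simp add: algebra_simps)
    then have "mat (poly (pCons a p) (\<gamma> t) * \<gamma>' t) ** resolvent 1 t
        = mat a ** (mat (\<gamma>' t) ** resolvent 1 t) + mat (poly p (\<gamma> t) * \<gamma>' t) ** (mat (\<gamma> t) ** resolvent 1 t)"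
      by (simp only: matrix_mult.add_left matrix_mul_assoc)
    also have "\<dots> = mat a ** (mat (\<gamma>' t) ** resolvent 1 t) + mat (poly p (\<gamma> t) * \<gamma>' t)
        + A ** (mat (poly p (\<gamma> t) * \<gamma>' t) ** resolvent 1 t)"
      unfolding \<gamma>R by (simp add: matrix_add_ldistrib mat_mult_left_commute[of A])
    finally show "mat a ** (mat (\<gamma>' t) ** resolvent 1 t) + mat (poly p (\<gamma> t) * \<gamma>' t)
        + A ** (mat (poly p (\<gamma> t) * \<gamma>' t) ** resolvent 1 t) = mat (poly (pCons a p) (\<gamma> t) * \<gamma>' t) ** resolvent 1 t" ..
  qed
  moreover have "mat a ** mat (2 * pi * \<i>) + mat 0 + A ** (mat (2 * pi * \<i>) ** matrix_poly p A)
      = mat (2 * pi * \<i>) ** matrix_poly (pCons a p) A"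
    by (simp add: matrix_add_ldistrib mat_mult_left_commute[of A] mat_mult_commute[of "mat a"])
  ultimately show ?case by simp
qed

end

text \<open>Only a limsup bound is assumed at the frontier, because the Cauchy transform comes
  without boundary values. For \<open>M < c < |g z|\<close> the set \<open>|g| \<ge> c\<close> keeps
  away from the frontier, so it is compact and \<open>|g|\<close> attains its maximum
  inside.\<close>

lemma max_modulus_boundary:
  assumes hol: "g holomorphic_on S" and S: "open S" "connected S" "bounded S"
    and bdry: "\<And>b e. b \<in> frontier S \<Longrightarrow> e > 0 \<Longrightarrow> \<exists>r>0. \<forall>z\<in>S. dist z b < r \<longrightarrow> cmod (g z) \<le> M + e"
    and z: "z \<in> S"
  shows "cmod (g z) \<le> M"
proof (rule ccontr)
  assume neg: "\<not> ?thesis"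
  define c where "c = (M + cmod (g z)) / 2"
  have c: "M < c" "c < cmod (g z)" using neg by (auto simp: c_def)
  define K where "K = {w \<in> S. c \<le> cmod (g w)}"
  have contg: "continuous_on S g" using hol by (rule holomorphic_on_imp_continuous_on)
  have "closed K"
    unfolding closed_sequential_limits
  proof (intro allI impI, elim conjE)
    fix x l assume x: "\<forall>n. x n \<in> K" and lim: "x \<longlonglongrightarrow> l"
    have "l \<in> closure S" using x lim unfolding closure_sequential K_def by blast
    show "l \<in> K"
    proof (cases "l \<in> S")
      case True
      have "(\<lambda>n. g (x n)) \<longlonglongrightarrow> g l"
        using contg True lim x by (auto simp: continuous_on_sequentially K_def o_def)
      then have "(\<lambda>n. cmod (g (x n))) \<longlonglongrightarrow> cmod (g l)" by (rule tendsto_norm)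
      then have "c \<le> cmod (g l)" by (rule LIMSEQ_le_const) (use x in \<open>auto simp: K_def\<close>)
      then show ?thesis using True by (simp add: K_def)
    next
      case False
      then have "l \<in> frontier S" using \<open>l \<in> closure S\<close> S(1) by (simp add: frontier_def interior_open)
      then obtain r where r: "r > 0" "\<forall>z\<in>S. dist z l < r \<longrightarrow> cmod (g z) \<le> M + (c - M) / 2"
        using bdry[of l "(c - M) / 2"] c by auto
      obtain n where "dist (x n) l < r"
        using lim r(1) unfolding lim_sequentially by blast
      then have "cmod (g (x n)) \<le> M + (c - M) / 2" "c \<le> cmod (g (x n))" using r x by (auto simp: K_def)
      then show ?thesis using c by (simp add: field_simps)
    qed
  qed
  moreover have "bounded K" using S(3) by (rule bounded_subset) (auto simp: K_def)
  ultimately have "compact K" by (simp add: compact_eq_bounded_closed)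
  moreover have "z \<in> K" using z c by (auto simp: K_def)
  moreover have "continuous_on K (\<lambda>w. cmod (g w))"
    by (intro continuous_intros continuous_on_subset[OF contg]) (auto simp: K_def)
  ultimately obtain \<xi> where \<xi>: "\<xi> \<in> K" "\<And>w. w \<in> K \<Longrightarrow> cmod (g w) \<le> cmod (g \<xi>)"
    using continuous_attains_sup[of K "\<lambda>w. cmod (g w)"] by blast
  have "cmod (g w) \<le> cmod (g \<xi>)" if "w \<in> S" for w
    using \<xi>(2)[of w] \<xi>(1) that by (cases "w \<in> K") (auto simp: K_def)
  then have "g constant_on S"
    using maximum_modulus_principle[OF hol S(1,2) S(1) order_refl, of \<xi>] \<xi>(1) by (auto simp: K_def)
  \<comment> \<open>A constant \<open>g\<close> makes the superlevel set all of \<open>S\<close>, so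
    \<open>S\<close> is open and closed, hence the whole plane, against boundedness.\<close>
  then have "K = S" using z c unfolding constant_on_def K_def by fastforce
  then have "closed S" using \<open>closed K\<close> by simp
  then have "S = UNIV" using S(1) z clopen[of S] by blast
  then show False using S(3) not_bounded_UNIV by blast
qed

text \<open>The increment of an antiderivative over one period has derivative zero. This allows
  integrals to be centred at the parameter of a given boundary point.\<close>

lemma integral_periodic:
  fixes h :: "real \<Rightarrow> complex"
  assumes cont: "continuous_on UNIV h" and per: "\<And>t. h (t + 2 * pi) = h t"
  shows "integral {a..a + 2 * pi} h = integral {0..2 * pi} h"
proof -
  define m where "m = \<bar>a\<bar> + 4 * pi"
  obtain H where H: "\<And>x. x \<in> {-m..m} \<Longrightarrow> (H has_vector_derivative h x) (at x within {-m..m})"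
    using antiderivative_continuous[OF continuous_on_subset[OF cont subset_UNIV], of "-m" m] by blast
  have int: "integral {x..x + 2 * pi} h = H (x + 2 * pi) - H x" if "- \<bar>a\<bar> \<le> x" "x \<le> \<bar>a\<bar>" for x
  proof (rule integral_unique, rule fundamental_theorem_of_calculus)
    fix y assume "y \<in> {x..x + 2 * pi}"
    then show "(H has_vector_derivative h y) (at y within {x..x + 2 * pi})"
      using that pi_gt_zero by (intro has_vector_derivative_within_subset[OF H]) (auto simp: m_def)
  qed simp
  have "((\<lambda>x. H (x + 2 * pi) - H x) has_vector_derivative 0) (at x within {-\<bar>a\<bar>..\<bar>a\<bar>})"
    if x: "x \<in> {-\<bar>a\<bar>..\<bar>a\<bar>}" for x
  proof -
    have 1: "(H has_vector_derivative h x) (at x within {-\<bar>a\<bar>..\<bar>a\<bar>})"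
      using x pi_ge_two by (intro has_vector_derivative_within_subset[OF H]) (auto simp: m_def)
    have "((\<lambda>x. x + 2 * pi) has_vector_derivative 1) (at x within {-\<bar>a\<bar>..\<bar>a\<bar>})"
      by (auto intro!: derivative_eq_intros)
    moreover have "(H has_vector_derivative h (x + 2 * pi)) (at (x + 2 * pi) within (\<lambda>x. x + 2 * pi) ` {-\<bar>a\<bar>..\<bar>a\<bar>})"
      using x pi_ge_two by (intro has_vector_derivative_within_subset[OF H]) (auto simp: m_def)
    ultimately have "(H \<circ> (\<lambda>x. x + 2 * pi) has_vector_derivative 1 *\<^sub>R h (x + 2 * pi)) (at x within {-\<bar>a\<bar>..\<bar>a\<bar>})"
      by (rule vector_diff_chain_within)
    from has_vector_derivative_diff[OF this 1] show ?thesis by (simp add: o_def per)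
  qed
  then have "((\<lambda>x. H (x + 2 * pi) - H x) has_derivative (\<lambda>_. 0)) (at x within {-\<bar>a\<bar>..\<bar>a\<bar>})"
    if "x \<in> {-\<bar>a\<bar>..\<bar>a\<bar>}" for x using that by (auto simp: has_vector_derivative_def)
  then have "H (0 + 2 * pi) - H 0 = H (a + 2 * pi) - H a" if "a \<in> {-\<bar>a\<bar>..\<bar>a\<bar>}"
    using has_derivative_zero_unique[OF convex_real_interval(5), of "-\<bar>a\<bar>" "\<bar>a\<bar>" "\<lambda>x. H (x + 2 * pi) - H x" 0 a] that
    by auto
  moreover have "a \<in> {-\<bar>a\<bar>..\<bar>a\<bar>}" by auto
  ultimately show ?thesis using int[of a] int[of 0] by simp
qed

lemma matrix_poly_mat: "matrix_poly f (mat z :: complex^'n^'n) = mat (poly f z)"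
  by (induction f) (simp_all add: mat_add mat_mult_mat)

section \<open>Scalar Cauchy transforms on the convex domain\<close>

context convex_loop
begin

lemma \<gamma>_neq: "z \<in> \<Omega> \<Longrightarrow> \<gamma> t \<noteq> z"
  using left_\<gamma>[of z t] by auto

text \<open>The matrix formula for matrices of size one.\<close>

lemma scalar_cauchy:
  assumes z: "z \<in> \<Omega>"
  shows "((\<lambda>t. poly f (\<gamma> t) * (\<gamma>' t / (\<gamma> t - z))) has_integral 2 * pi * \<i> * poly f z) {0..2*pi}"
proof -
  have "numerical_range (mat z :: complex^1^1) \<subseteq> \<Omega>"
    using z by (auto simp: numerical_range_altdef qform_mat)
  then interpret M: convex_loop_matrix \<gamma> \<gamma>' \<Omega> "mat z :: complex^1^1"
    by unfold_locales
  have bl: "bounded_linear (\<lambda>M :: complex^1^1. M $ 1 $ 1)"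
    by (intro linear_conv_bounded_linear[THEN iffD1] linearI) auto
  have "((\<lambda>t. (mat (poly f (\<gamma> t) * \<gamma>' t) ** M.resolvent 1 t) $ 1 $ 1) has_integral
      (mat (2 * pi * \<i>) ** matrix_poly f (mat z :: complex^1^1)) $ 1 $ 1) {0..2*pi}"
    using has_integral_linear[OF M.cauchy_formula[of f] bl] by (simp add: o_def)
  moreover have "(mat (2 * pi * \<i>) ** matrix_poly f (mat z :: complex^1^1)) $ 1 $ 1 = 2 * pi * \<i> * poly f z"
    unfolding mat_mult_component matrix_poly_mat by (simp add: mat_def)
  moreover have "(mat (poly f (\<gamma> t) * \<gamma>' t) ** M.resolvent 1 t) $ 1 $ 1 = poly f (\<gamma> t) * (\<gamma>' t / (\<gamma> t - z))"
    if t: "t \<in> {0..2*pi}" for t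
  proof -
    have "M.pencil 1 t = mat (\<gamma> t - z)" by (simp add: M.pencil_def mat_diff)
    then have "(mat (\<gamma> t - z) ** M.resolvent 1 t) $ 1 $ 1 = (mat 1 :: complex^1^1) $ 1 $ 1"
      using M.pencil_resolvent[of 1 t] t by simp
    then have "(\<gamma> t - z) * M.resolvent 1 t $ 1 $ 1 = (mat 1 :: complex^1^1) $ 1 $ 1" by (simp only: mat_mult_component)
    also have "(mat 1 :: complex^1^1) $ 1 $ 1 = 1" by (simp add: mat_def)
    finally have "(\<gamma> t - z) * M.resolvent 1 t $ 1 $ 1 = 1" .
    then have "M.resolvent 1 t $ 1 $ 1 = 1 / (\<gamma> t - z)" using \<gamma>_neq[OF z, of t] by (simp add: field_simps)
    then show ?thesis by simp
  qed
  ultimately show ?thesis by (metis (no_types, lifting) has_integral_eq)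
qed

text \<open>\<open>kern z\<close> is the derivative of the angle under which the curve is seen from \<open>z\<close>.\<close>

definition kern :: "complex \<Rightarrow> real \<Rightarrow> real" where
  "kern z t = Im (\<gamma>' t / (\<gamma> t - z))"

text \<open>The function \<open>g\<close> of the overview; it is holomorphic inside although the
  conjugate of \<open>f\<close> need not be.\<close>

definition conj_cauchy :: "complex poly \<Rightarrow> complex \<Rightarrow> complex" where
  "conj_cauchy f z = integral {0..2*pi} (\<lambda>t. cnj (poly f (\<gamma> t)) * (\<gamma>' t / (\<gamma> t - z))) / (2 * pi * \<i>)"

lemma kern_eq: "kern z t = Im (cnj (\<gamma>' t) * (z - \<gamma> t)) / (cmod (\<gamma> t - z))\<^sup>2"
  by (simp add: kern_def Im_divide cmod_power2 algebra_simps)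

lemma kern_pos: "z \<in> \<Omega> \<Longrightarrow> kern z t > 0"
  unfolding kern_eq using left_\<gamma> \<gamma>_neq by (intro divide_pos_pos) auto

lemma left_closure: "z \<in> closure \<Omega> \<Longrightarrow> 0 \<le> Im (cnj (\<gamma>' t) * (z - \<gamma> t))"
proof -
  assume z: "z \<in> closure \<Omega>"
  have "closed {z. 0 \<le> Im (cnj (\<gamma>' t) * (z - \<gamma> t))}"
    by (intro closed_Collect_le continuous_intros)
  moreover have "\<Omega> \<subseteq> {z. 0 \<le> Im (cnj (\<gamma>' t) * (z - \<gamma> t))}"
    using left_\<gamma> by (auto simp: less_imp_le simp del: times_complex.sel)
  ultimately show ?thesis using closure_minimal z by blast
qed

lemma continuous_kern: "(\<And>t. t \<in> T \<Longrightarrow> \<gamma> t \<noteq> z) \<Longrightarrow> continuous_on T (kern z)"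
  unfolding kern_def[abs_def] by (intro continuous_intros continuous_\<gamma> continuous_\<gamma>'_on) auto

lemma continuous_poly_\<gamma>: "continuous_on T (\<lambda>t. poly f (\<gamma> t))"
  by (intro continuous_intros continuous_\<gamma>)

text \<open>\<open>kern z\<close> is the imaginary part of the Cauchy kernel, and
  \<open>w - cnj w = 2 \<i> Im w\<close>. The kernel itself reproduces \<open>f\<close>; its
  conjugate yields the conjugate of the Cauchy transform with the opposite sign.\<close>

lemma kern_integral:
  assumes z: "z \<in> \<Omega>"
  shows "integral {0..2*pi} (kern z) = 2 * pi"
    and "integral {0..2*pi} (\<lambda>t. poly f (\<gamma> t) * of_real (kern z t)) = pi * (poly f z + cnj (conj_cauchy f z))"
proof -
  have "((\<lambda>t. Im (\<gamma>' t / (\<gamma> t - z))) has_integral Im (2 * pi * \<i>)) {0..2*pi}"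
    using has_integral_linear[OF scalar_cauchy[OF z, of 1] bounded_linear_Im] by (simp add: o_def)
  then show "integral {0..2*pi} (kern z) = 2 * pi" by (auto simp: kern_def[abs_def] intro: integral_unique)
  let ?c = "\<lambda>t. cnj (poly f (\<gamma> t)) * (\<gamma>' t / (\<gamma> t - z))"
  have "?c integrable_on {0..2*pi}"
    by (intro integrable_continuous_real continuous_intros continuous_\<gamma> continuous_\<gamma>'_on) (use \<gamma>_neq[OF z] in auto)
  then have "(?c has_integral 2 * pi * \<i> * conj_cauchy f z) {0..2*pi}"
    by (auto simp: conj_cauchy_def dest: integrable_integral)
  from has_integral_linear[OF this bounded_linear_cnj]
  have "((\<lambda>t. poly f (\<gamma> t) * cnj (\<gamma>' t / (\<gamma> t - z))) has_integral - (2 * pi * \<i> * cnj (conj_cauchy f z))) {0..2*pi}"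
    by (simp add: o_def)
  from has_integral_diff[OF scalar_cauchy[OF z, of f] this]
  have "((\<lambda>t. poly f (\<gamma> t) * (\<gamma>' t / (\<gamma> t - z)) - poly f (\<gamma> t) * cnj (\<gamma>' t / (\<gamma> t - z))) has_integral
      2 * \<i> * (pi * (poly f z + cnj (conj_cauchy f z)))) {0..2*pi}"
    by (simp add: algebra_simps)
  also have "(\<lambda>t. poly f (\<gamma> t) * (\<gamma>' t / (\<gamma> t - z)) - poly f (\<gamma> t) * cnj (\<gamma>' t / (\<gamma> t - z)))
      = (\<lambda>t. 2 * \<i> * (poly f (\<gamma> t) * of_real (kern z t)))"
  proof
    fix t
    have "w - cnj w = 2 * \<i> * of_real (Im w)" for w by (simp add: complex_eq_iff)
    then show "poly f (\<gamma> t) * (\<gamma>' t / (\<gamma> t - z)) - poly f (\<gamma> t) * cnj (\<gamma>' t / (\<gamma> t - z))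
      = 2 * \<i> * (poly f (\<gamma> t) * of_real (kern z t))"
      unfolding right_diff_distrib[symmetric] kern_def by (simp only: mult_ac)
  qed
  finally have "((\<lambda>t. 2 * \<i> * (poly f (\<gamma> t) * of_real (kern z t))) has_integral
      2 * \<i> * (pi * (poly f z + cnj (conj_cauchy f z)))) {0..2*pi}" .
  from has_integral_mult_right[OF this, of "1 / (2 * \<i>)"]
  show "integral {0..2*pi} (\<lambda>t. poly f (\<gamma> t) * of_real (kern z t)) = pi * (poly f z + cnj (conj_cauchy f z))"
    unfolding mult.assoc[symmetric] by (intro integral_unique) (simp add: mult.assoc)
qed

text \<open>The angle is measured by a branch of the logarithm on the supporting half-plane at the boundary point.\<close>

lemma kern_boundary_angle:
  assumes \<tau>: "0 < \<tau>" "\<tau> < pi"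
  shows "integral {t0 + \<tau>..t0 + 2 * pi - \<tau>} (kern (\<gamma> t0)) \<le> pi"
proof -
  let ?T = "{t0 + \<tau>..t0 + 2 * pi - \<tau>}"
  \<comment> \<open>The inward normal at \<open>\<gamma> t0\<close>. Division by it puts the curve
    into the closed right half-plane, where off \<open>0\<close> the imaginary part of
    \<open>Ln\<close> lies between \<open>- pi / 2\<close> and \<open>pi / 2\<close>.\<close>
  define v where "v = \<i> * \<gamma>' t0"
  have v: "v \<noteq> 0" using left_\<gamma>[OF zero_in_\<Omega>, of t0] by (auto simp: v_def)
  define w where "w t = (\<gamma> t - \<gamma> t0) / v" for t
  have w0: "w t \<noteq> 0" if "t \<in> ?T" for t
    using simple_\<gamma>[of t0 t] that \<tau> v by (auto simp: w_def)
  have Re_w: "Re (w t) \<ge> 0" for t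
  proof -
    have "Re (w t) = Im (cnj (\<gamma>' t0) * (\<gamma> t - \<gamma> t0)) / (cmod v)\<^sup>2"
      by (simp add: w_def v_def Re_divide cmod_power2 algebra_simps)
    then show ?thesis using left_closure[OF closure_\<gamma>] by simp
  qed
  have "((\<lambda>t. Ln (w t)) has_vector_derivative \<gamma>' t / (\<gamma> t - \<gamma> t0)) (at t within ?T)" if t: "t \<in> ?T" for t
  proof -
    have "(w has_vector_derivative \<gamma>' t / v) (at t within ?T)"
      unfolding w_def divide_inverse
      by (intro has_vector_derivative_mult_left) (auto intro!: derivative_eq_intros has_vector_derivative_at_within[OF deriv_\<gamma>])
    moreover have "(Ln has_field_derivative inverse (w t)) (at (w t))"
      by (rule has_field_derivative_Ln) (use w0[OF t] Re_w[of t] in \<open>auto simp: complex_nonpos_Reals_iff complex_eq_iff\<close>)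
    ultimately have "(Ln \<circ> w has_vector_derivative (\<gamma>' t / v) * inverse (w t)) (at t within ?T)"
      by (intro field_vector_diff_chain_within) (auto intro: has_field_derivative_at_within)
    then show ?thesis using v w0[OF t] by (simp add: o_def w_def field_simps)
  qed
  then have "((\<lambda>t. \<gamma>' t / (\<gamma> t - \<gamma> t0)) has_integral Ln (w (t0 + 2 * pi - \<tau>)) - Ln (w (t0 + \<tau>))) ?T"
    using \<tau> by (intro fundamental_theorem_of_calculus) auto
  from has_integral_linear[OF this bounded_linear_Im]
  have "integral ?T (kern (\<gamma> t0)) = Im (Ln (w (t0 + 2 * pi - \<tau>))) - Im (Ln (w (t0 + \<tau>)))"
    by (auto simp: o_def kern_def[abs_def] intro: integral_unique)
  moreover have "\<bar>Im (Ln (w t))\<bar> \<le> pi / 2" if "t \<in> ?T" for t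
    using Re_Ln_pos_le[OF w0[OF that]] Re_w by simp
  from this[of "t0 + \<tau>"] this[of "t0 + 2 * pi - \<tau>"] \<tau>
  have "\<bar>Im (Ln (w (t0 + \<tau>)))\<bar> \<le> pi / 2" "\<bar>Im (Ln (w (t0 + 2 * pi - \<tau>)))\<bar> \<le> pi / 2" by auto
  ultimately show ?thesis by linarith
qed

text \<open>By \<open>kern_integral\<close>, \<open>pi * cnj (g z)\<close> is the integral of
  \<open>f\<close> against \<open>kern z\<close> minus \<open>pi * f z\<close>. Near the boundary
  point \<open>f\<close> is almost \<open>f z\<close>, so there only the deviation of the near mass
  \<open>m1\<close> from \<open>pi\<close> counts. The far mass \<open>m2\<close> is at most
  \<open>pi + \<epsilon>\<close>, and since the total is \<open>2 * pi\<close>, the sum of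
  \<open>m2\<close> and \<open>\<bar>m1 - pi\<bar>\<close> is at most
  \<open>pi + 2 * \<epsilon>\<close>, which leaves the bound \<open>M\<close> in the limit.\<close>

lemma conj_cauchy_boundary:
  assumes M: "\<And>z. z \<in> closure \<Omega> \<Longrightarrow> cmod (poly f z) \<le> M" and e: "e > 0"
  shows "\<exists>r>0. \<forall>z\<in>\<Omega>. dist z (\<gamma> t0) < r \<longrightarrow> cmod (conj_cauchy f z) \<le> M + e"
proof -
  define b where "b = \<gamma> t0"
  have M0: "M \<ge> 0" using M[OF closure_\<gamma>[of t0]] norm_ge_zero order_trans by blast
  \<comment> \<open>After division by \<open>pi\<close> the errors add up to at most
    \<open>(M + 4) * \<epsilon>\<close>: from the masses
    \<open>2 * M * \<epsilon> / pi \<le> M * \<epsilon>\<close>, and \<open>4 * \<epsilon>\<close>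
    from the oscillation of \<open>f\<close>.\<close>
  define \<epsilon> where "\<epsilon> = e / (M + 4)"
  have \<epsilon>: "\<epsilon> > 0" "(M + 4) * \<epsilon> = e" using e M0 by (auto simp: \<epsilon>_def)
  have "isCont (\<lambda>t. poly f (\<gamma> t)) t0"
    using continuous_poly_\<gamma>[of UNIV f] by (simp add: continuous_on_eq_continuous_at)
  then obtain d where d: "d > 0" "\<And>t. dist t t0 < d \<Longrightarrow> dist (poly f (\<gamma> t)) (poly f b) < \<epsilon>"
    using \<epsilon>(1) unfolding continuous_at_eps_delta b_def by (metis dist_commute)
  define \<tau> where "\<tau> = min (d / 2) (pi / 2)"
  have \<tau>: "0 < \<tau>" "\<tau> < pi" "\<tau> < d"
    using d(1) pi_ge_two by (auto simp: \<tau>_def min_less_iff_disj)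
  have "isCont (poly f) b" by simp
  then obtain r1 where r1: "r1 > 0" "\<And>z. dist z b < r1 \<Longrightarrow> dist (poly f z) (poly f b) < \<epsilon>"
    using \<epsilon>(1) unfolding continuous_at_eps_delta by (metis dist_commute)
  let ?F = "{t0 + \<tau>..t0 + 2 * pi - \<tau>}" and ?N = "{t0 - \<tau>..t0 + \<tau>}"
  have F0: "\<gamma> t \<noteq> b" if "t \<in> ?F" for t
    using simple_\<gamma>[of t0 t] that \<tau> by (auto simp: b_def)
  have "compact (\<gamma> ` ?F)" by (intro compact_continuous_image continuous_\<gamma>) auto
  moreover have "b \<notin> \<gamma> ` ?F" using F0 by (metis imageE)
  ultimately obtain \<rho> where \<rho>: "\<rho> > 0" "\<And>t. t \<in> ?F \<Longrightarrow> \<rho> \<le> dist b (\<gamma> t)"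
    using separate_point_closed[OF compact_imp_closed] by (metis imageI)
  have "bounded (\<gamma>' ` ?F)"
    by (intro compact_imp_bounded compact_continuous_image continuous_\<gamma>'_on) auto
  then obtain L where L: "L > 0" "\<And>t. t \<in> ?F \<Longrightarrow> cmod (\<gamma>' t) \<le> L" by (auto simp: bounded_pos)
  \<comment> \<open>The first bound keeps \<open>cmod (\<gamma> t - z)\<close> above
    \<open>\<rho> / 2\<close> on the far arc; with the second, \<open>kern z\<close> exceeds
    \<open>kern b\<close> there by at most \<open>\<epsilon> / (2 * pi)\<close>, hence by at most
    \<open>\<epsilon>\<close> after integration.\<close>
  define r2 where "r2 = min (\<rho> / 2) (\<epsilon> * \<rho>\<^sup>2 / (4 * pi * L))"
  have r2: "r2 > 0" using \<rho> \<epsilon> L pi_gt_zero by (auto simp: r2_def)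
  have main: "cmod (conj_cauchy f z) \<le> M + e" if z: "z \<in> \<Omega>" and zb: "dist z b < min r1 r2" for z
  proof -
    have kz: "continuous_on T (kern z)" for T using \<gamma>_neq[OF z] by (intro continuous_kern) auto
    have kb: "continuous_on ?F (kern b)" using F0 by (intro continuous_kern) auto
    have close: "kern z t \<le> kern b t + \<epsilon> / (2 * pi)" if t: "t \<in> ?F" for t
    proof -
      have 1: "\<rho> \<le> cmod (\<gamma> t - b)" using \<rho>(2)[OF t] by (simp add: dist_norm norm_minus_commute)
      have "cmod (\<gamma> t - b) \<le> cmod (\<gamma> t - z) + cmod (z - b)"
        using norm_triangle_ineq[of "\<gamma> t - z" "z - b"] by simp
      then have 2: "\<rho> / 2 \<le> cmod (\<gamma> t - z)" using 1 zb by (simp add: r2_def dist_norm)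
      have nz: "\<gamma> t - z \<noteq> 0" "\<gamma> t - b \<noteq> 0" using 1 2 \<rho>(1) by auto
      have "kern z t - kern b t = Im (\<gamma>' t * (z - b) / ((\<gamma> t - z) * (\<gamma> t - b)))"
        using nz by (simp add: kern_def field_simps flip: minus_complex.sel(2))
      also have "\<dots> \<le> cmod (\<gamma>' t * (z - b) / ((\<gamma> t - z) * (\<gamma> t - b)))"
        using abs_Im_le_cmod abs_le_D1 by blast
      also have "\<dots> = cmod (\<gamma>' t) * cmod (z - b) / (cmod (\<gamma> t - z) * cmod (\<gamma> t - b))"
        by (simp add: norm_mult norm_divide)
      also have "\<dots> \<le> L * (\<epsilon> * \<rho>\<^sup>2 / (4 * pi * L)) / ((\<rho> / 2) * \<rho>)"
        using 1 2 L(2)[OF t] zb \<rho>(1) L(1) \<epsilon>(1)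
        by (intro frac_le mult_mono) (auto simp: r2_def dist_norm less_imp_le)
      also have "\<dots> = \<epsilon> / (2 * pi)" using L(1) \<rho>(1) by (simp add: field_simps power2_eq_square)
      finally show ?thesis by simp
    qed
    define m1 where "m1 = integral ?N (kern z)"
    define m2 where "m2 = integral ?F (kern z)"
    have "m2 \<le> integral ?F (\<lambda>t. kern b t + \<epsilon> / (2 * pi))"
      unfolding m2_def using close kz kb
      by (intro integral_le integrable_continuous_real continuous_intros) auto
    also have "\<dots> = integral ?F (kern b) + (2 * pi - 2 * \<tau>) * (\<epsilon> / (2 * pi))"
      using kb \<tau> by (subst integral_add) (auto intro: integrable_continuous_real)
    also have "\<dots> \<le> pi + 2 * pi * (\<epsilon> / (2 * pi))"
      using kern_boundary_angle[OF \<tau>(1,2), of t0] \<tau> \<epsilon>(1) unfolding b_def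
      by (intro add_mono mult_right_mono) auto
    finally have m2: "m2 \<le> pi + \<epsilon>" by simp
    have m2_0: "m2 \<ge> 0" and m1_0: "m1 \<ge> 0"
      unfolding m1_def m2_def using kern_pos[OF z]
      by (intro integral_nonneg integrable_continuous_real kz; simp add: less_imp_le)+
    have split: "integral {0..2*pi} h = integral ?N h + integral ?F h"
      if "continuous_on UNIV h" "\<And>t. h (t + 2 * pi) = h t" for h :: "real \<Rightarrow> complex"
    proof -
      have "integral ?N h + integral ?F h = integral {t0 - \<tau>..t0 + 2 * pi - \<tau>} h"
        by (rule Henstock_Kurzweil_Integration.integral_combine) (use \<tau> that(1) in \<open>auto intro!: integrable_continuous_real intro: continuous_on_subset\<close>)
      also have "\<dots> = integral {0..2*pi} h" using integral_periodic[OF that, of "t0 - \<tau>"] by (simp add: algebra_simps)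
      finally show ?thesis ..
    qed
    have perk: "kern z (t + 2 * pi) = kern z t" for t
      by (simp add: kern_def periodic_\<gamma> periodic_\<gamma>')
    have cr: "integral {l..u} (\<lambda>t. complex_of_real (kern z t)) = of_real (integral {l..u} (kern z))" for l u
      using integral_linear[OF integrable_continuous_real[OF kz] bounded_linear_of_real] by (simp add: o_def)
    have "complex_of_real (m1 + m2) = integral {0..2*pi} (\<lambda>t. complex_of_real (kern z t))"
      using split[of "\<lambda>t. complex_of_real (kern z t)"] kz perk
      by (simp add: cr m1_def m2_def continuous_intros)
    also have "\<dots> = of_real (2 * pi)" using kern_integral(1)[OF z] by (simp add: cr)
    finally have m12: "m1 + m2 = 2 * pi" using of_real_eq_iff by blast
    let ?h = "\<lambda>t. poly f (\<gamma> t) * complex_of_real (kern z t)"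
    have ch: "continuous_on T ?h" for T by (intro continuous_intros continuous_poly_\<gamma> kz)
    have "pi * cnj (conj_cauchy f z) = integral ?N ?h + integral ?F ?h - pi * poly f z"
      using split[OF ch] kern_integral(2)[OF z, of f] perk periodic_\<gamma> by (simp add: algebra_simps)
    also have "integral ?N ?h = integral ?N (\<lambda>t. (poly f (\<gamma> t) - poly f z) * of_real (kern z t)) + poly f z * m1"
    proof -
      have "integral ?N ?h = integral ?N (\<lambda>t. (poly f (\<gamma> t) - poly f z) * of_real (kern z t) + poly f z * of_real (kern z t))"
        by (simp add: algebra_simps)
      also have "\<dots> = integral ?N (\<lambda>t. (poly f (\<gamma> t) - poly f z) * of_real (kern z t)) + integral ?N (\<lambda>t. poly f z * of_real (kern z t))"
        by (intro integral_add integrable_continuous_real continuous_intros continuous_poly_\<gamma> kz)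
      finally show ?thesis by (simp add: cr m1_def)
    qed
    finally have eq: "pi * cnj (conj_cauchy f z) = integral ?F ?h
        + integral ?N (\<lambda>t. (poly f (\<gamma> t) - poly f z) * of_real (kern z t)) + poly f z * of_real (m1 - pi)"
      by (simp add: algebra_simps)
    have A1: "cmod (integral ?F ?h) \<le> M * m2"
    proof -
      have "cmod (integral ?F ?h) \<le> integral ?F (\<lambda>t. M * kern z t)"
        using M[OF closure_\<gamma>] kern_pos[OF z]
        by (intro integral_norm_bound_integral integrable_continuous_real ch continuous_intros kz)
          (auto simp: norm_mult less_imp_le intro!: mult_right_mono)
      then show ?thesis by (simp add: m2_def)
    qed
    have A2: "cmod (integral ?N (\<lambda>t. (poly f (\<gamma> t) - poly f z) * of_real (kern z t))) \<le> 2 * \<epsilon> * m1"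
    proof -
      have "cmod (poly f (\<gamma> t) - poly f z) \<le> 2 * \<epsilon>" if t: "t \<in> ?N" for t
      proof -
        have "dist t t0 < d" using t \<tau>(3) by (auto simp: dist_real_def)
        from d(2)[OF this] r1(2)[of z] zb have "dist (poly f (\<gamma> t)) (poly f b) < \<epsilon>" "dist (poly f z) (poly f b) < \<epsilon>" by auto
        then have "dist (poly f (\<gamma> t)) (poly f z) < \<epsilon> + \<epsilon>" by (metis add_strict_mono dist_commute dist_triangle le_less_trans)
        then show ?thesis by (simp add: dist_norm)
      qed
      then have "cmod (integral ?N (\<lambda>t. (poly f (\<gamma> t) - poly f z) * of_real (kern z t))) \<le> integral ?N (\<lambda>t. 2 * \<epsilon> * kern z t)"
        using kern_pos[OF z]
        by (intro integral_norm_bound_integral integrable_continuous_real continuous_intros continuous_poly_\<gamma> kz)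
          (auto simp: norm_mult less_imp_le intro!: mult_right_mono)
      then show ?thesis by (simp add: m1_def)
    qed
    have A3: "cmod (poly f z * of_real (m1 - pi)) \<le> M * \<bar>m1 - pi\<bar>"
      using M[of z] z closure_subset by (auto simp: norm_mult simp del: of_real_diff intro!: mult_right_mono)
    have "pi * cmod (conj_cauchy f z) = cmod (pi * cnj (conj_cauchy f z))" by (simp add: norm_mult)
    also have "\<dots> \<le> M * m2 + 2 * \<epsilon> * m1 + M * \<bar>m1 - pi\<bar>"
      unfolding eq using A1 A2 A3 by (meson add_mono norm_triangle_le)
    also have "\<dots> = M * (m2 + \<bar>m1 - pi\<bar>) + 2 * \<epsilon> * m1" by (simp add: algebra_simps)
    also have "\<dots> \<le> M * (pi + 2 * \<epsilon>) + 2 * \<epsilon> * (2 * pi)"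
    proof -
      have "m2 + \<bar>m1 - pi\<bar> \<le> pi + 2 * \<epsilon>" using m2 m12 \<epsilon>(1) by linarith
      moreover have "m1 \<le> 2 * pi" using m12 m2_0 by linarith
      ultimately show ?thesis
        using add_mono[OF mult_left_mono[OF _ M0] mult_left_mono[of m1 "2 * pi" "2 * \<epsilon>"]] \<epsilon>(1) by auto
    qed
    also have "\<dots> = pi * M + 2 * (M * \<epsilon>) + pi * (4 * \<epsilon>)" by (simp add: algebra_simps)
    also have "\<dots> \<le> pi * M + pi * (M * \<epsilon>) + pi * (4 * \<epsilon>)"
      using pi_ge_two M0 \<epsilon>(1) by (intro add_mono mult_right_mono order_refl) auto
    also have "\<dots> = pi * (M + (M + 4) * \<epsilon>)" by (simp add: algebra_simps)
    finally show ?thesis using \<epsilon>(2) pi_gt_zero by simp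
  qed
  show ?thesis using r1(1) r2 main unfolding b_def by (intro exI[of _ "min r1 r2"]) auto
qed

lemma conj_cauchy_holomorphic: "conj_cauchy f holomorphic_on \<Omega>"
proof -
  let ?h = "\<lambda>z t. cnj (poly f (\<gamma> t)) * (\<gamma>' t / (\<gamma> t - z))"
  let ?h' = "\<lambda>z t. cnj (poly f (\<gamma> t)) * (\<gamma>' t / (\<gamma> t - z)\<^sup>2)"
  have "(\<lambda>z. integral (cbox 0 (2*pi)) (?h z)) holomorphic_on \<Omega>"
  proof (rule leibniz_rule_holomorphic)
    show "((\<lambda>z. ?h z t) has_field_derivative ?h' z t) (at z within \<Omega>)" if "z \<in> \<Omega>" for z t
      using \<gamma>_neq[OF that, of t] by (auto intro!: derivative_eq_intros simp: power2_eq_square)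
    show "?h z integrable_on cbox 0 (2*pi)" if "z \<in> \<Omega>" for z
      by (intro integrable_continuous continuous_intros continuous_\<gamma> continuous_\<gamma>'_on) (use \<gamma>_neq[OF that] in auto)
    show "continuous_on (\<Omega> \<times> cbox 0 (2*pi)) (\<lambda>(z, t). ?h' z t)"
      unfolding split_beta
      by (intro continuous_intros continuous_on_compose2[OF continuous_\<gamma>[of UNIV]] continuous_on_compose2[OF continuous_\<gamma>'])
        (use \<gamma>_neq in auto)
  qed (rule convex_\<Omega>)
  then show ?thesis unfolding conj_cauchy_def[abs_def] by (auto intro!: holomorphic_intros)
qed

lemma conj_cauchy_bound:
  assumes M: "\<And>z. z \<in> closure \<Omega> \<Longrightarrow> cmod (poly f z) \<le> M" and z: "z \<in> \<Omega>"
  shows "cmod (conj_cauchy f z) \<le> M"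
proof (rule max_modulus_boundary[OF conj_cauchy_holomorphic open_\<Omega> convex_connected[OF convex_\<Omega>] bounded_\<Omega> _ z])
  fix b and e :: real assume "b \<in> frontier \<Omega>" "e > 0"
  then show "\<exists>r>0. \<forall>z\<in>\<Omega>. dist z b < r \<longrightarrow> cmod (conj_cauchy f z) \<le> M + e"
    using frontier_\<gamma> conj_cauchy_boundary[OF M] by blast
qed

end

section \<open>The Crouzeix--Palencia bound\<close>

lemma norm_mat_mult: "norm (mat c ** M) = cmod c * norm M" for M :: "complex^'n^'n"
proof -
  have "(mat c ** M) $ i = c *s M $ i" for i by (simp add: vec_eq_iff)
  then show ?thesis by (simp add: norm_vec_def[of "mat c ** M"] norm_vec_def[of M] L2_set_right_distrib)
qed

text \<open>With \<open>y\<close> the image of \<open>x\<close> under the adjoint,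
  \<open>|y|^2 = x \<bullet> M y\<close>; Cauchy--Schwarz and one cancellation do the rest.\<close>

lemma conj_transpose_bound:
  fixes M :: "complex^'n^'n"
  assumes "\<And>x. norm (M *v x) \<le> c * norm x"
  shows "norm (conj_transpose M *v x) \<le> c * norm x"
proof (cases "conj_transpose M *v x = 0")
  case True
  have "0 \<le> c * norm x" using assms[of x] norm_ge_zero order_trans by blast
  then show ?thesis using True by simp
next
  case False
  let ?y = "conj_transpose M *v x"
  have "norm ?y * norm ?y = ?y \<bullet> ?y" by (simp add: dot_square_norm power2_eq_square)
  also have "\<dots> = x \<bullet> (M *v ?y)" by (simp add: inner_conj_transpose)
  also have "\<dots> \<le> norm x * norm (M *v ?y)" by (rule norm_cauchy_schwarz)
  also have "\<dots> \<le> norm x * (c * norm ?y)" by (intro mult_left_mono assms) auto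
  finally show ?thesis using False by (simp add: mult_ac)
qed

text \<open>The test vector \<open>y\<close> points along \<open>T x\<close> and has the length of
  \<open>x\<close>, so the two squares are equal; hence the factor \<open>2\<close>.\<close>

lemma bilinear_form_bound:
  fixes T :: "complex^'n^'n"
  assumes "\<And>x y. y \<bullet> (T *v x) \<le> M * ((norm x)\<^sup>2 + (norm y)\<^sup>2)"
  shows "norm (T *v x) \<le> 2 * M * norm x"
proof (cases "T *v x = 0 \<or> x = 0")
  case True
  have "0 \<le> M * (norm x)\<^sup>2" using assms[of 0 x] by simp
  then have "0 \<le> M * norm x" by (cases "x = 0") (auto simp: zero_le_mult_iff)
  then show ?thesis using True by auto
next
  case False
  define y where "y = (norm x / norm (T *v x)) *\<^sub>R (T *v x)"
  have "norm y = norm x" using False by (simp add: y_def)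
  moreover have "y \<bullet> (T *v x) = norm x * norm (T *v x)"
    using False by (simp add: y_def dot_square_norm power2_eq_square)
  ultimately have "norm x * norm (T *v x) \<le> norm x * (2 * M * norm x)"
    using assms[of y x] by (simp add: power2_eq_square mult_ac)
  then show ?thesis using False by simp
qed

context convex_loop
begin

lemma scaled_closure:
  assumes "z \<in> closure \<Omega>" "0 \<le> r" "r < 1"
  shows "complex_of_real r * z \<in> \<Omega>"
proof -
  have "z - (1 - r) *\<^sub>R (z - 0) \<in> interior \<Omega>"
    using assms zero_in_\<Omega> open_\<Omega> by (intro mem_interior_closure_convex_shrink convex_\<Omega>) (auto simp: interior_open)
  also have "z - (1 - r) *\<^sub>R (z - 0) = of_real r * z"
    by (simp add: scaleR_conv_of_real algebra_simps)
  finally show ?thesis using open_\<Omega> by (simp add: interior_open)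
qed

end

section \<open>The operator-valued double layer potential\<close>

context convex_loop_matrix
begin

text \<open>The Cauchy transform \<open>g\<close> at the matrix \<open>s A\<close>, with the
  resolvent in place of the scalar kernel.\<close>

definition conj_cauchy_matrix :: "real \<Rightarrow> complex poly \<Rightarrow> complex^'n^'n" where
  "conj_cauchy_matrix s f = integral {0..2*pi} (\<lambda>t. mat (cnj (poly f (\<gamma> t)) * \<gamma>' t / (2 * pi * \<i>)) ** resolvent s t)"

lemma continuous_conj_cauchy_integrand:
  fixes T :: "'b::metric_space set"
  assumes "continuous_on T u" "continuous_on T v"
    and "\<And>x. x \<in> T \<Longrightarrow> u x \<in> {0..1}" "\<And>x. x \<in> T \<Longrightarrow> v x \<in> {0..2*pi}"
  shows "continuous_on T (\<lambda>x. mat (cnj (poly f (\<gamma> (v x))) * \<gamma>' (v x) / (2 * pi * \<i>)) ** resolvent (u x) (v x))"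
  by (intro matrix_mult.continuous_on bounded_linear.continuous_on[OF bounded_linear_mat] continuous_intros
      continuous_on_compose2[OF continuous_\<gamma>[of UNIV]] continuous_on_compose2[OF continuous_\<gamma>'] continuous_resolvent assms) auto

lemma conj_cauchy_matrix_has_integral:
  assumes "s \<in> {0..1}"
  shows "((\<lambda>t. mat (cnj (poly f (\<gamma> t)) * \<gamma>' t / (2 * pi * \<i>)) ** resolvent s t) has_integral conj_cauchy_matrix s f) {0..2*pi}"
  unfolding conj_cauchy_matrix_def
  by (intro integrable_integral integrable_continuous_real continuous_conj_cauchy_integrand) (use assms in auto)

lemma continuous_conj_cauchy_matrix: "continuous_on {0..1} (\<lambda>s. conj_cauchy_matrix s f)"
proof -
  have "continuous_on ({0..1} \<times> cbox 0 (2*pi))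
      (\<lambda>(s, t). mat (cnj (poly f (\<gamma> t)) * \<gamma>' t / (2 * pi * \<i>)) ** resolvent s t)"
    unfolding split_beta by (intro continuous_conj_cauchy_integrand continuous_intros) auto
  from integral_continuous_on_param[OF this] show ?thesis by (simp add: conj_cauchy_matrix_def)
qed

lemma pencil_accretive:
  assumes "s \<in> {0..1}"
  shows "0 \<le> x \<bullet> ((\<i> * cnj (\<gamma>' t)) *s (pencil s t *v x))"
proof -
  obtain w where w: "w \<in> numerical_range A"
    "x \<bullet> ((\<i> * cnj (\<gamma>' t)) *s (pencil s t *v x)) = Im (cnj (\<gamma>' t) * (of_real s * w - \<gamma> t)) * (norm x)\<^sup>2"
    by (rule pencil_form)
  show ?thesis unfolding w(2)
    using left_\<gamma>[OF scaled_in_\<Omega>[OF _ assms], of w t] w(1) numerical_range_\<Omega> by (intro mult_nonneg_nonneg) auto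
qed

text \<open>Its Hermitian part is the operator analogue of \<open>kern\<close>. In the form at a
  single vector the real inner product sees only this part, so the adjoint is never added
  explicitly.\<close>

definition double_layer :: "real \<Rightarrow> complex^'n^'n" where
  "double_layer t = mat (- \<i> * \<gamma>' t) ** resolvent 1 t"

text \<open>Writing \<open>x = pencil 1 t *v y\<close> removes the resolvent and leaves the form of
  the pencil at \<open>y\<close>.\<close>

lemma double_layer_accretive:
  assumes "t \<in> {0..2*pi}"
  shows "0 \<le> x \<bullet> (double_layer t *v x)"
proof -
  define y where "y = resolvent 1 t *v x"
  have x: "pencil 1 t *v y = x" using pencil_resolvent[of 1 t] assms by (simp add: y_def matrix_vector_mul_assoc)
  have "double_layer t *v x = (- \<i> * \<gamma>' t) *s y"
    by (simp add: double_layer_def y_def flip: matrix_vector_mul_assoc)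
  then have "x \<bullet> (double_layer t *v x) = ((- \<i> * \<gamma>' t) *s y) \<bullet> (pencil 1 t *v y)"
    by (simp only: x inner_commute)
  also have "\<dots> = y \<bullet> ((\<i> * cnj (\<gamma>' t)) *s (pencil 1 t *v y))" by (simp add: inner_smult_left)
  finally show ?thesis using pencil_accretive[of 1 y t] by simp
qed

text \<open>Cauchy--Schwarz for a positive form in disguise: its nonnegative value at
  \<open>u x - y\<close> is expanded, where \<open>u = c / M\<close> has modulus at most
  \<open>1\<close>.\<close>

lemma double_layer_form_bound:
  assumes t: "t \<in> {0..2*pi}" and c: "cmod c \<le> M" and M: "M > 0"
  shows "y \<bullet> (c *s (double_layer t *v x)) + x \<bullet> (cnj c *s (double_layer t *v y)) \<le> M * (x \<bullet> (double_layer t *v x) + y \<bullet> (double_layer t *v y))"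
proof -
  define u where "u = c / of_real M"
  have u: "cmod u \<le> 1" "c = of_real M * u" using c M by (auto simp: u_def norm_divide)
  let ?a = "u *s x"
  have "0 \<le> (?a - y) \<bullet> (double_layer t *v (?a - y))" by (rule double_layer_accretive[OF t])
  then have *: "y \<bullet> (double_layer t *v ?a) + ?a \<bullet> (double_layer t *v y) \<le> ?a \<bullet> (double_layer t *v ?a) + y \<bullet> (double_layer t *v y)"
    by (simp add: matrix_vector_mult_diff_distrib inner_diff_left inner_diff_right)
  have "?a \<bullet> (double_layer t *v ?a) = (cmod u)\<^sup>2 * (x \<bullet> (double_layer t *v x))"
    unfolding Re_qform[symmetric] qform_smult by (simp flip: of_real_power)
  also have "\<dots> \<le> 1 * (x \<bullet> (double_layer t *v x))"
    using u(1) double_layer_accretive[OF t, of x] by (intro mult_right_mono) (auto simp: power_le_one)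
  finally have "M * (y \<bullet> (double_layer t *v ?a) + ?a \<bullet> (double_layer t *v y)) \<le> M * (x \<bullet> (double_layer t *v x) + y \<bullet> (double_layer t *v y))"
    using * M by (intro mult_left_mono) auto
  moreover have "y \<bullet> (c *s (double_layer t *v x)) = M * (y \<bullet> (double_layer t *v ?a))"
  proof -
    have "c *s (double_layer t *v x) = M *\<^sub>R (double_layer t *v ?a)"
      by (simp add: u(2) matrix_mult_smult vec_eq_iff scaleR_conv_of_real[where 'a = complex])
    then show ?thesis by simp
  qed
  moreover have "x \<bullet> (cnj c *s (double_layer t *v y)) = M * (?a \<bullet> (double_layer t *v y))"
  proof -
    have "cnj c *s (double_layer t *v y) = M *\<^sub>R (cnj u *s (double_layer t *v y))"
      by (simp add: u(2) vec_eq_iff scaleR_conv_of_real[where 'a = complex])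
    then show ?thesis by (simp add: inner_smult_left)
  qed
  ultimately show ?thesis by (simp add: distrib_left)
qed

text \<open>The operator-valued double layer potential is a positive measure of total mass \<open>2\<close>.\<close>

lemma plus_conj_transpose_bound:
  assumes M: "M > 0" and f: "\<And>z. z \<in> closure \<Omega> \<Longrightarrow> cmod (poly f z) \<le> M"
  shows "norm ((matrix_poly f A + conj_transpose (conj_cauchy_matrix 1 f)) *v x) \<le> 2 * M * norm x"
proof (rule bilinear_form_bound)
  fix x y :: "complex^'n"
  let ?I = "{0..2*pi}"
  have bl: "bounded_linear (\<lambda>M. y \<bullet> (M *v x))" for x y :: "complex^'n"
    by (rule bounded_linear_compose[OF bounded_linear_inner_right matrix_vector.bounded_linear_left])
  have S: "((\<lambda>t. x \<bullet> (double_layer t *v x)) has_integral 2 * pi * (norm x)\<^sup>2) ?I" for x :: "complex^'n"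
  proof -
    have "((\<lambda>t. x \<bullet> ((mat (- \<i>) ** (mat (\<gamma>' t) ** resolvent 1 t)) *v x)) has_integral x \<bullet> ((mat (- \<i>) ** mat (2 * pi * \<i>)) *v x)) ?I"
      using has_integral_linear[OF has_integral_linear[OF resolvent_integral matrix_mult.bounded_linear_right[of "mat (- \<i>)"]] bl]
      by (simp add: o_def)
    moreover have "mat (- \<i>) ** (mat (\<gamma>' t) ** resolvent 1 t) = double_layer t" for t
      by (simp add: double_layer_def matrix_mul_assoc mat_mult_mat)
    moreover have "(mat (- \<i>) ** mat (2 * pi * \<i>)) *v x = (2 * pi) *\<^sub>R x"
    proof -
      have "- \<i> * (2 * pi * \<i>) = complex_of_real (2 * pi)" by simp
      then show ?thesis by (simp only: mat_mult_mat smult_of_real mat_vector_mult)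
    qed
    ultimately show ?thesis by (simp add: dot_square_norm)
  qed
  have F: "((\<lambda>t. y \<bullet> (poly f (\<gamma> t) *s (double_layer t *v x))) has_integral 2 * pi * (y \<bullet> (matrix_poly f A *v x))) ?I"
  proof -
    have "((\<lambda>t. y \<bullet> ((mat (- \<i>) ** (mat (poly f (\<gamma> t) * \<gamma>' t) ** resolvent 1 t)) *v x)) has_integral
        y \<bullet> ((mat (- \<i>) ** (mat (2 * pi * \<i>) ** matrix_poly f A)) *v x)) ?I"
      using has_integral_linear[OF has_integral_linear[OF cauchy_formula[of f] matrix_mult.bounded_linear_right[of "mat (- \<i>)"]] bl]
      by (simp add: o_def)
    moreover have "(mat (- \<i>) ** (mat (poly f (\<gamma> t) * \<gamma>' t) ** resolvent 1 t)) *v x = poly f (\<gamma> t) *s (double_layer t *v x)" for t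
      by (simp add: double_layer_def vector_smult_assoc mult_ac flip: matrix_vector_mul_assoc)
    moreover have "(mat (- \<i>) ** (mat (2 * pi * \<i>) ** matrix_poly f A)) *v x = (2 * pi) *\<^sub>R (matrix_poly f A *v x)"
    proof -
      have "- \<i> * (2 * pi * \<i>) = complex_of_real (2 * pi)" by simp
      then show ?thesis
        by (simp only: matrix_mul_assoc mat_mult_mat smult_of_real mat_vector_mult flip: matrix_vector_mul_assoc)
    qed
    ultimately show ?thesis by simp
  qed
  have G: "((\<lambda>t. x \<bullet> (cnj (poly f (\<gamma> t)) *s (double_layer t *v y))) has_integral 2 * pi * (x \<bullet> (conj_cauchy_matrix 1 f *v y))) ?I"
  proof -
    have "((\<lambda>t. x \<bullet> ((mat (complex_of_real (2 * pi)) ** (mat (cnj (poly f (\<gamma> t)) * \<gamma>' t / (2 * pi * \<i>)) ** resolvent 1 t)) *v y)) has_integral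
        x \<bullet> ((mat (complex_of_real (2 * pi)) ** conj_cauchy_matrix 1 f) *v y)) ?I"
      using has_integral_linear[OF has_integral_linear[OF conj_cauchy_matrix_has_integral[of 1 f] matrix_mult.bounded_linear_right[of "mat (complex_of_real (2 * pi))"]] bl]
      by (simp add: o_def)
    moreover have "(mat (complex_of_real (2 * pi)) ** (mat (cnj (poly f (\<gamma> t)) * \<gamma>' t / (2 * pi * \<i>)) ** resolvent 1 t)) *v y
        = cnj (poly f (\<gamma> t)) *s (double_layer t *v y)" for t
      by (simp add: double_layer_def vector_smult_assoc field_simps flip: matrix_vector_mul_assoc)
    moreover have "(mat (complex_of_real (2 * pi)) ** conj_cauchy_matrix 1 f) *v y = (2 * pi) *\<^sub>R (conj_cauchy_matrix 1 f *v y)"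
      by (simp only: smult_of_real mat_vector_mult flip: matrix_vector_mul_assoc)
    ultimately show ?thesis by simp
  qed
  \<comment> \<open>The pointwise bound with \<open>c = poly f (\<gamma> t)\<close> is integrated;
    by \<open>S\<close> the right-hand side becomes a multiple of the squared norms.\<close>
  have "2 * pi * (y \<bullet> (matrix_poly f A *v x)) + 2 * pi * (x \<bullet> (conj_cauchy_matrix 1 f *v y))
      \<le> M * (2 * pi * (norm x)\<^sup>2 + 2 * pi * (norm y)\<^sup>2)"
    by (rule has_integral_le[OF has_integral_add[OF F G] has_integral_mult_right[OF has_integral_add[OF S S]]])
      (rule double_layer_form_bound[OF _ f[OF closure_\<gamma>] M])
  then have "2 * pi * (y \<bullet> (matrix_poly f A *v x) + x \<bullet> (conj_cauchy_matrix 1 f *v y)) \<le> 2 * pi * (M * ((norm x)\<^sup>2 + (norm y)\<^sup>2))"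
    by (simp add: algebra_simps)
  then have "y \<bullet> (matrix_poly f A *v x) + x \<bullet> (conj_cauchy_matrix 1 f *v y) \<le> M * ((norm x)\<^sup>2 + (norm y)\<^sup>2)"
    by (subst (asm) mult_le_cancel_left_pos) auto
  also have "x \<bullet> (conj_cauchy_matrix 1 f *v y) = y \<bullet> (conj_transpose (conj_cauchy_matrix 1 f) *v x)"
    using inner_conj_transpose[of y "conj_transpose (conj_cauchy_matrix 1 f)" x] by (simp add: inner_commute)
  finally show "y \<bullet> ((matrix_poly f A + conj_transpose (conj_cauchy_matrix 1 f)) *v x) \<le> M * ((norm x)\<^sup>2 + (norm y)\<^sup>2)"
    by (simp add: matrix_vector_mult_add_rdistrib inner_add_right)
qed

end

section \<open>Polynomial approximation of the Cauchy transform\<close>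

lemma matrix_poly_integral:
  fixes W :: "real \<Rightarrow> complex" and P :: "real \<Rightarrow> complex poly" and B :: "complex^'n^'n"
  assumes W: "continuous_on {a..b} W" and P: "\<And>k. continuous_on {a..b} (\<lambda>t. coeff (P t) k)"
    and deg: "\<And>t. degree (P t) \<le> N"
  shows "((\<lambda>t. mat (W t) ** matrix_poly (P t) B) has_integral
     matrix_poly (\<Sum>k\<le>N. monom (integral {a..b} (\<lambda>t. W t * coeff (P t) k)) k) B) {a..b}"
proof -
  have "((\<lambda>t. mat (W t * coeff (P t) k) ** matrix_power B k) has_integral
      mat (integral {a..b} (\<lambda>t. W t * coeff (P t) k)) ** matrix_power B k) {a..b}" for k
  proof -
    have "((\<lambda>t. W t * coeff (P t) k) has_integral integral {a..b} (\<lambda>t. W t * coeff (P t) k)) {a..b}"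
      by (intro integrable_integral integrable_continuous_real continuous_intros W P)
    from has_integral_linear[OF this bounded_linear_compose[OF matrix_mult.bounded_linear_left bounded_linear_mat]]
    show ?thesis by (simp add: o_def)
  qed
  then have "((\<lambda>t. \<Sum>k\<le>N. mat (W t * coeff (P t) k) ** matrix_power B k) has_integral
      (\<Sum>k\<le>N. mat (integral {a..b} (\<lambda>t. W t * coeff (P t) k)) ** matrix_power B k)) {a..b}"
    by (intro has_integral_sum) auto
  moreover have "(\<Sum>k\<le>N. mat (W t * coeff (P t) k) ** matrix_power B k) = mat (W t) ** matrix_poly (P t) B" for t
    by (simp add: matrix_poly_altdef[OF deg] matrix_mult.sum_right matrix_mul_assoc mat_mult_mat)
  ultimately show ?thesis by (simp add: matrix_poly_sum matrix_poly_monom)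
qed

text \<open>The coefficientwise integral is the same as for a matrix, so the scalar values and the
  matrix value belong to one polynomial.\<close>

lemma poly_integral:
  fixes W :: "real \<Rightarrow> complex" and P :: "real \<Rightarrow> complex poly"
  assumes "continuous_on {a..b} W" "\<And>k. continuous_on {a..b} (\<lambda>t. coeff (P t) k)" "\<And>t. degree (P t) \<le> N"
  shows "((\<lambda>t. W t * poly (P t) z) has_integral
     poly (\<Sum>k\<le>N. monom (integral {a..b} (\<lambda>t. W t * coeff (P t) k)) k) z) {a..b}"
proof -
  have bl: "bounded_linear (\<lambda>M :: complex^1^1. M $ 1 $ 1)"
    by (intro linear_conv_bounded_linear[THEN iffD1] linearI) auto
  have "(mat (W t) ** matrix_poly (P t) (mat z :: complex^1^1)) $ 1 $ 1 = W t * poly (P t) z" for t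
    unfolding mat_mult_component matrix_poly_mat by (simp add: mat_def)
  moreover have "matrix_poly p (mat z :: complex^1^1) $ 1 $ 1 = poly p z" for p
    unfolding matrix_poly_mat by (simp add: mat_def)
  ultimately show ?thesis
    using has_integral_linear[OF matrix_poly_integral[OF assms, of "mat z :: complex^1^1"] bl] by (simp add: o_def)
qed

lemma continuous_coeff_linear_power:
  fixes a b :: "real \<Rightarrow> complex"
  assumes "continuous_on T a" "continuous_on T b"
  shows "continuous_on T (\<lambda>t. coeff ([:a t, b t:] ^ j) k)"
proof (induction j arbitrary: k)
  case 0
  show ?case by simp
next
  case (Suc j)
  have "coeff ([:a t, b t:] ^ Suc j) k
      = a t * coeff ([:a t, b t:] ^ j) k + (case k of 0 \<Rightarrow> 0 | Suc i \<Rightarrow> b t * coeff ([:a t, b t:] ^ j) i)" for t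
    by (cases k) auto
  moreover have "continuous_on T (\<lambda>t. case k of 0 \<Rightarrow> 0 | Suc i \<Rightarrow> b t * coeff ([:a t, b t:] ^ j) i)"
    by (cases k) (auto intro!: continuous_intros assms Suc)
  ultimately show ?case by (simp only:) (intro continuous_intros assms Suc)
qed

context convex_loop_matrix
begin

text \<open>Around the centre \<open>\<gamma> t - \<sigma> * u\<close>, with \<open>u = - \<i> * \<gamma>' t\<close> the outer normal and \<open>\<sigma>\<close> large, the shrunken
  domain and the shrunken matrix both lie in a disc that does not contain \<open>\<gamma> t\<close>. The geometric series therefore
  approximates the resolvent uniformly, by one polynomial for the scalars and the matrix.\<close>

lemma resolvent_approximation:
  assumes r: "0 \<le> r" "r < 1" and e: "e > 0"
  obtains P N where "\<forall>t. degree (P t) \<le> N" "\<forall>k. continuous_on {0..2*pi} (\<lambda>t. coeff (P t) k)"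
    "\<forall>t\<in>{0..2*pi}. \<forall>z\<in>closure \<Omega>. cmod (poly (P t) z - 1 / (\<gamma> t - of_real r * z)) \<le> e"
    "\<forall>t\<in>{0..2*pi}. norm (matrix_poly (P t) A - resolvent r t) \<le> e"
proof -
  have r01: "r \<in> {0..1}" using r by simp
  \<comment> \<open>With \<open>r < 1\<close> even the closed domain shrinks into \<Omega>, so one
    gap serves the scalars and the matrix.\<close>
  define K where "K = (\<lambda>z. of_real r * z) ` (closure \<Omega>) \<union> (\<lambda>z. of_real r * z) ` numerical_range A"
  have cl: "compact (closure \<Omega>)" using bounded_\<Omega> by simp
  have compK: "compact K" unfolding K_def
    by (intro compact_Un compact_continuous_image continuous_intros cl compact_numerical_range)
  have K\<Omega>: "K \<subseteq> \<Omega>"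
    using scaled_closure[OF _ r] numerical_range_\<Omega> closure_subset by (auto simp: K_def)
  obtain \<delta> where \<delta>: "\<delta> > 0"
    "\<And>t w. t \<in> {0..2*pi} \<Longrightarrow> w \<in> K \<Longrightarrow> \<delta> \<le> Im (cnj (\<gamma>' t) * (w - \<gamma> t))" using gap[OF compK K\<Omega>] by blast
  obtain L where L: "L > 0" "\<And>t. t \<in> {0..2*pi} \<Longrightarrow> norm (\<gamma>' t) \<le> L" by (rule \<gamma>'_bounded) blast
  have "bounded ((\<lambda>p. \<gamma> (fst p) - snd p) ` ({0..2*pi} \<times> K))"
    by (intro compact_imp_bounded compact_continuous_image compact_Times compK continuous_intros
        continuous_on_compose2[OF continuous_\<gamma>[of UNIV]]) auto
  then obtain B1 where B1: "B1 > 0" "\<And>t w. t \<in> {0..2*pi} \<Longrightarrow> w \<in> K \<Longrightarrow> cmod (\<gamma> t - w) \<le> B1"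
    by (auto simp: bounded_pos)
  have "bounded ((\<lambda>t. pencil r t) ` {0..2*pi})"
    by (intro compact_imp_bounded compact_continuous_image continuous_pencil continuous_intros) auto
  then obtain B2 where B2: "B2 > 0" "\<And>t. t \<in> {0..2*pi} \<Longrightarrow> norm (pencil r t) \<le> B2" by (auto simp: bounded_pos)
  obtain \<kappa> where \<kappa>: "\<kappa> > 0" "\<And>s t. s \<in> {0..1} \<Longrightarrow> t \<in> {0..2*pi} \<Longrightarrow> norm (resolvent s t) \<le> \<kappa>" by (rule resolvent_bounded) blast
  define B where "B = B1\<^sup>2 + B2\<^sup>2"
  \<comment> \<open>In \<open>|u - p|^2 = |u|^2 - 2 Re (cnj u * p) + |p|^2\<close> at least
    \<open>2 * \<sigma> * \<delta>\<close> is subtracted and at most \<open>B\<close> is added; the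
    choice \<open>\<sigma> * \<delta> = B\<close> leaves the gain
    \<open>\<sigma> * \<delta>\<close>.\<close>
  define \<sigma> where "\<sigma> = B / \<delta>"
  have \<sigma>: "\<sigma> > 0" "\<sigma> * \<delta> = B" using B1(1) B2(1) \<delta>(1) by (simp_all add: \<sigma>_def B_def add_pos_pos)
  \<comment> \<open>The gain relative to \<open>|u|^2\<close>, which is at most
    \<open>\<sigma>^2 * L^2\<close>, yields a contraction factor independent of \<open>t\<close>;
    \<open>max\<close> guards the radicand.\<close>
  define \<theta> where "\<theta> = sqrt (max 0 (1 - \<delta> / (\<sigma> * L\<^sup>2)))"
  have \<theta>: "0 \<le> \<theta>" "\<theta> < 1" using \<delta>(1) \<sigma>(1) L(1) by (auto simp: \<theta>_def)
  have \<theta>2: "\<sigma>\<^sup>2 * (cmod (\<gamma>' t))\<^sup>2 - \<sigma> * \<delta> \<le> (\<theta> * (\<sigma> * cmod (\<gamma>' t)))\<^sup>2" if t: "t \<in> {0..2*pi}" for t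
  proof -
    have "(cmod (\<gamma>' t))\<^sup>2 \<le> L\<^sup>2" using L(2)[OF t] by (intro power_mono) auto
    then have "\<delta> / (\<sigma> * L\<^sup>2) * (\<sigma>\<^sup>2 * (cmod (\<gamma>' t))\<^sup>2) \<le> \<delta> / (\<sigma> * L\<^sup>2) * (\<sigma>\<^sup>2 * L\<^sup>2)"
      using \<delta>(1) \<sigma>(1) by (intro mult_left_mono) auto
    also have "\<dots> = \<sigma> * \<delta>" using \<sigma>(1) L(1) by (simp add: field_simps power2_eq_square)
    finally have "\<sigma>\<^sup>2 * (cmod (\<gamma>' t))\<^sup>2 - \<sigma> * \<delta> \<le> (1 - \<delta> / (\<sigma> * L\<^sup>2)) * (\<sigma>\<^sup>2 * (cmod (\<gamma>' t))\<^sup>2)"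
      by (simp add: left_diff_distrib)
    also have "\<dots> \<le> \<theta>\<^sup>2 * (\<sigma>\<^sup>2 * (cmod (\<gamma>' t))\<^sup>2)"
      by (intro mult_right_mono) (auto simp: \<theta>_def)
    finally show ?thesis by (simp add: power_mult_distrib)
  qed
  define u where "u t = of_real \<sigma> * (- \<i> * \<gamma>' t)" for t
  have u0: "u t \<noteq> 0" for t using left_\<gamma>[OF zero_in_\<Omega>, of t] \<sigma>(1) by (auto simp: u_def)
  have nu: "cmod (u t) = \<sigma> * cmod (\<gamma>' t)" for t using \<sigma>(1) by (simp add: u_def norm_mult)
  \<comment> \<open>As a polynomial, \<open>lin t = 1 - (\<gamma> t - r X) / u t\<close>, the ratio
    of the geometric series.\<close>
  define lin where "lin t = [:(u t - \<gamma> t) / u t, of_real r / u t:]" for t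
  have lin_scalar: "cmod (poly (lin t) z) \<le> \<theta>" if t: "t \<in> {0..2*pi}" and z: "z \<in> closure \<Omega>" for t z
  proof -
    define w where "w = of_real r * z"
    have w: "w \<in> K" using z by (auto simp: K_def w_def)
    define p where "p = \<gamma> t - w"
    have "(cmod (u t - p))\<^sup>2 = (cmod (u t))\<^sup>2 - 2 * (\<sigma> * Im (cnj (\<gamma>' t) * (w - \<gamma> t))) + (cmod p)\<^sup>2"
      unfolding cmod_power2 by (simp add: u_def p_def power2_eq_square algebra_simps)
    also have "\<dots> \<le> (\<sigma> * cmod (\<gamma>' t))\<^sup>2 - 2 * (\<sigma> * \<delta>) + B"
    proof -
      have "\<sigma> * \<delta> \<le> \<sigma> * Im (cnj (\<gamma>' t) * (w - \<gamma> t))" using \<delta>(2)[OF t w] \<sigma>(1) by (intro mult_left_mono) auto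
      moreover have "(cmod p)\<^sup>2 \<le> B1\<^sup>2" unfolding p_def using B1(2)[OF t w] by (intro power_mono) auto
      ultimately show ?thesis unfolding nu B_def using zero_le_power2[of B2] by linarith
    qed
    also have "\<dots> \<le> (\<theta> * (\<sigma> * cmod (\<gamma>' t)))\<^sup>2" using \<theta>2[OF t] \<sigma>(2) by (simp add: power_mult_distrib)
    finally have "cmod (u t - p) \<le> \<theta> * cmod (u t)" unfolding nu
      by (rule power2_le_imp_le) (use \<theta>(1) \<sigma>(1) in auto)
    moreover have "poly (lin t) z = (u t - p) / u t" by (simp add: lin_def p_def w_def add_divide_distrib diff_divide_distrib)
    ultimately show ?thesis using u0[of t] by (simp add: norm_divide divide_le_eq)
  qed
  have lin_matrix: "norm (matrix_poly (lin t) A *v x) \<le> \<theta> * norm x" if t: "t \<in> {0..2*pi}" for t x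
  proof -
    let ?p = "pencil r t *v x"
    obtain w where w: "w \<in> numerical_range A"
      "x \<bullet> ((\<i> * cnj (\<gamma>' t)) *s ?p) = Im (cnj (\<gamma>' t) * (of_real r * w - \<gamma> t)) * (norm x)\<^sup>2"
      by (rule pencil_form)
    have "of_real r * w \<in> K" using w(1) by (auto simp: K_def)
    from \<delta>(2)[OF t this] have "\<delta> * (norm x)\<^sup>2 \<le> x \<bullet> ((\<i> * cnj (\<gamma>' t)) *s ?p)"
      unfolding w(2) by (intro mult_right_mono) auto
    also have "x \<bullet> ((\<i> * cnj (\<gamma>' t)) *s ?p) = (1 / \<sigma>) * ((u t *s x) \<bullet> ?p)"
    proof -
      have "u t *s x = \<sigma> *\<^sub>R ((- \<i> * \<gamma>' t) *s x)"
        by (simp add: u_def vec_eq_iff scaleR_conv_of_real[where 'a = complex])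
      then show ?thesis using \<sigma>(1) by (simp add: inner_smult_left)
    qed
    finally have 1: "\<sigma> * \<delta> * (norm x)\<^sup>2 \<le> (u t *s x) \<bullet> ?p" using \<sigma>(1) by (simp add: field_simps)
    have "(norm ?p)\<^sup>2 \<le> (B2 * norm x)\<^sup>2"
      by (intro power_mono order_trans[OF norm_matrix_vector_mult_le] mult_right_mono B2(2) t) auto
    then have 2: "(norm ?p)\<^sup>2 \<le> B * (norm x)\<^sup>2"
      unfolding B_def by (simp add: power_mult_distrib distrib_right add_increasing)
    have "(norm (u t *s x - ?p))\<^sup>2 = (norm (u t *s x))\<^sup>2 - 2 * ((u t *s x) \<bullet> ?p) + (norm ?p)\<^sup>2"
      unfolding power2_norm_eq_inner by (simp add: inner_diff_left inner_diff_right inner_commute)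
    also have "\<dots> \<le> (norm (u t *s x))\<^sup>2 - 2 * (\<sigma> * \<delta> * (norm x)\<^sup>2) + B * (norm x)\<^sup>2" using 1 2 by linarith
    also have "\<dots> = (\<sigma>\<^sup>2 * (cmod (\<gamma>' t))\<^sup>2 - \<sigma> * \<delta>) * (norm x)\<^sup>2"
      using \<sigma>(2) by (simp add: nu power_mult_distrib algebra_simps)
    also have "\<dots> \<le> (\<theta> * (\<sigma> * cmod (\<gamma>' t)))\<^sup>2 * (norm x)\<^sup>2" by (intro mult_right_mono \<theta>2[OF t]) auto
    also have "\<dots> = (\<theta> * norm x * cmod (u t))\<^sup>2" by (simp add: nu power_mult_distrib)
    finally have "norm (u t *s x - ?p) \<le> \<theta> * norm x * cmod (u t)" by (rule power2_le_imp_le) (use \<theta>(1) in auto)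
    moreover have lin_eq: "matrix_poly (lin t) A *v x = (1 / u t) *s (u t *s x - ?p)"
    proof -
      have "matrix_poly (lin t) A = mat (1 / u t) ** (mat (u t) - pencil r t)"
        using u0[of t]
        by (simp add: lin_def pencil_def vec_eq_iff) (simp add: mat_def field_simps)
      then show ?thesis by (simp add: matrix_vector_mult_diff_rdistrib flip: matrix_vector_mul_assoc)
    qed
    have "norm (matrix_poly (lin t) A *v x) = norm (u t *s x - ?p) / cmod (u t)"
      unfolding lin_eq norm_smult by (simp add: norm_divide)
    ultimately show ?thesis using u0[of t] by (simp add: divide_le_eq)
  qed
  define P where "P N t = smult (1 / u t) (\<Sum>j<N. lin t ^ j)" for N t
  have telescope: "[:\<gamma> t, - of_real r:] * P N t = 1 - lin t ^ N" for N t
  proof -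
    have "[:\<gamma> t, - of_real r:] = smult (u t) (1 - lin t)"
      using u0[of t] by (simp add: lin_def one_pCons field_simps)
    then have "[:\<gamma> t, - of_real r:] * P N t = (1 - lin t) * (\<Sum>j<N. lin t ^ j)"
      using u0[of t] by (simp add: P_def)
    then show ?thesis by (simp add: one_diff_power_eq)
  qed
  have scalar: "cmod (poly (P N t) z - 1 / (\<gamma> t - of_real r * z)) \<le> \<theta> ^ N * (L / \<delta>)"
    if t: "t \<in> {0..2*pi}" and z: "z \<in> closure \<Omega>" for N t z
  proof -
    define p where "p = \<gamma> t - of_real r * z"
    have "of_real r * z \<in> K" using z by (auto simp: K_def)
    from \<delta>(2)[OF t this] have "\<delta> \<le> cmod (cnj (\<gamma>' t) * (of_real r * z - \<gamma> t))"
      using abs_Im_le_cmod abs_le_D1 order_trans by blast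
    also have "\<dots> \<le> L * cmod p"
      using L(2)[OF t] by (simp add: norm_mult p_def norm_minus_commute mult_right_mono)
    finally have p: "\<delta> \<le> L * cmod p" .
    then have p0: "p \<noteq> 0" using \<delta>(1) by auto
    have "p * poly (P N t) z = 1 - poly (lin t) z ^ N"
      using arg_cong[OF telescope[of t N], of "\<lambda>q. poly q z"]
      by (simp add: p_def poly_power algebra_simps del: mult_pCons_left)
    then have "poly (P N t) z = (1 - poly (lin t) z ^ N) / p" using p0 by (simp add: eq_divide_eq mult.commute)
    then have "poly (P N t) z - 1 / p = - (poly (lin t) z ^ N / p)" by (simp add: diff_divide_distrib)
    then have "cmod (poly (P N t) z - 1 / p) = cmod (poly (lin t) z) ^ N * (1 / cmod p)"
      by (simp add: norm_divide norm_power)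
    also have "\<dots> \<le> \<theta> ^ N * (L / \<delta>)"
      using p p0 \<delta>(1) lin_scalar[OF t z] \<theta>(1) by (intro mult_mono power_mono) (auto simp: field_simps)
    finally show ?thesis by (simp add: p_def)
  qed
  have matrix: "norm (matrix_poly (P N t) A - resolvent r t) \<le> \<theta> ^ N * (sqrt (real CARD('n)) * \<kappa>)"
    if t: "t \<in> {0..2*pi}" for N t
  proof -
    have "matrix_poly [:\<gamma> t, - of_real r:] A = pencil r t"
      by (simp add: pencil_def vec_eq_iff)
    then have "pencil r t ** matrix_poly (P N t) A = mat 1 - matrix_poly (lin t ^ N) A"
      using arg_cong[OF telescope[of t N], of "\<lambda>q. matrix_poly q A"]
      by (simp add: matrix_poly_mult matrix_poly_diff del: mult_pCons_left)
    then have "resolvent r t ** (pencil r t ** matrix_poly (P N t) A) = resolvent r t - resolvent r t ** matrix_poly (lin t ^ N) A"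
      by (simp add: matrix_mult.diff_right)
    then have eq: "matrix_poly (P N t) A - resolvent r t = - (resolvent r t ** matrix_poly (lin t ^ N) A)"
      using resolvent_pencil[OF r01 t] by (simp add: matrix_mul_assoc)
    have pow: "norm (matrix_poly (lin t ^ N) A *v x) \<le> \<theta> ^ N * norm x" for x
    proof (induction N)
      case (Suc N)
      have "norm (matrix_poly (lin t ^ Suc N) A *v x) \<le> \<theta> * norm (matrix_poly (lin t ^ N) A *v x)"
        using lin_matrix[OF t, of "matrix_poly (lin t ^ N) A *v x"] by (simp add: matrix_poly_mult matrix_vector_mul_assoc)
      also have "\<dots> \<le> \<theta> * (\<theta> ^ N * norm x)" by (intro mult_left_mono Suc \<theta>)
      finally show ?case by simp
    qed simp
    have "norm (resolvent r t ** matrix_poly (lin t ^ N) A) \<le> sqrt (real CARD('n)) * (\<kappa> * \<theta> ^ N)"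
    proof (rule norm_matrix_le)
      fix x
      have "norm ((resolvent r t ** matrix_poly (lin t ^ N) A) *v x) \<le> norm (resolvent r t) * norm (matrix_poly (lin t ^ N) A *v x)"
        using norm_matrix_vector_mult_le by (simp flip: matrix_vector_mul_assoc)
      also have "\<dots> \<le> \<kappa> * (\<theta> ^ N * norm x)" using \<kappa>(1) by (intro mult_mono \<kappa>(2)[OF r01 t] pow) auto
      finally show "norm ((resolvent r t ** matrix_poly (lin t ^ N) A) *v x) \<le> \<kappa> * \<theta> ^ N * norm x" by simp
    qed (use \<kappa>(1) \<theta>(1) in simp)
    then show ?thesis by (simp add: eq mult_ac)
  qed
  define C where "C = L / \<delta> + sqrt (real CARD('n)) * \<kappa>"
  have C: "L / \<delta> \<le> C" "sqrt (real CARD('n)) * \<kappa> \<le> C" "C > 0"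
    using L(1) \<delta>(1) \<kappa>(1) by (auto simp: C_def intro: add_pos_nonneg)
  have "(\<lambda>N. \<theta> ^ N * C) \<longlonglongrightarrow> 0 * C" using \<theta> by (intro tendsto_intros LIMSEQ_realpow_zero)
  then have "\<forall>\<^sub>F N in sequentially. \<theta> ^ N * C < e" by (rule order_tendstoD) (simp add: e)
  then obtain N where N: "\<theta> ^ N * C < e" by (auto simp: eventually_sequentially)
  show thesis
  proof (rule that[of "P N" N]; intro allI ballI)
    show "degree (P N t) \<le> N" for t
    proof -
      have "degree (lin t ^ j) \<le> N" if "j < N" for j
      proof -
        have "degree (lin t) \<le> 1" by (simp add: lin_def)
        then have "degree (lin t) * j \<le> 1 * j" by (rule mult_le_mono1)
        then show ?thesis using degree_power_le[of "lin t" j] that by linarith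
      qed
      then have "degree (\<Sum>j<N. lin t ^ j) \<le> N" by (intro degree_sum_le) auto
      then show ?thesis unfolding P_def using degree_smult_le le_trans by blast
    qed
    have contu: "continuous_on {0..2*pi} u" unfolding u_def by (intro continuous_intros continuous_\<gamma>'_on)
    show "continuous_on {0..2*pi} (\<lambda>t. coeff (P N t) k)" for k
      unfolding P_def lin_def coeff_smult coeff_sum
      by (intro continuous_intros continuous_coeff_linear_power contu continuous_\<gamma>) (use u0 in auto)
    show "cmod (poly (P N t) z - 1 / (\<gamma> t - of_real r * z)) \<le> e" if "t \<in> {0..2*pi}" "z \<in> closure \<Omega>" for t z
      using scalar[OF that, of N] mult_left_mono[OF C(1), of "\<theta> ^ N"] \<theta>(1) N by auto
    show "norm (matrix_poly (P N t) A - resolvent r t) \<le> e" if "t \<in> {0..2*pi}" for t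
      using matrix[OF that, of N] mult_left_mono[OF C(2), of "\<theta> ^ N"] \<theta>(1) N by auto
  qed
qed

text \<open>The approximated function is \<open>z \<mapsto> g(r z)\<close> with
  \<open>r < 1\<close>: it is defined on the whole closed domain, inherits the bound
  \<open>M\<close>, and at the matrix it is close to \<open>g(A)\<close> by continuity in the
  scaling.\<close>

lemma conj_cauchy_approximation:
  assumes M: "\<And>z. z \<in> closure \<Omega> \<Longrightarrow> cmod (poly f z) \<le> M" and e: "e > 0"
  obtains p where "\<forall>z\<in>closure \<Omega>. cmod (poly p z) \<le> M + e" "norm (matrix_poly p A - conj_cauchy_matrix 1 f) \<le> e"
proof -
  let ?I = "{0..2*pi}"
  have "\<exists>d>0. \<forall>s\<in>{0..1}. dist s 1 < d \<longrightarrow> dist (conj_cauchy_matrix s f) (conj_cauchy_matrix 1 f) < e / 2"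
    using continuous_conj_cauchy_matrix[of f] e unfolding continuous_on_iff by (metis atLeastAtMost_iff half_gt_zero order_refl zero_le_one)
  then obtain d where d: "d > 0" "\<And>s. s \<in> {0..1} \<Longrightarrow> dist s 1 < d \<Longrightarrow> dist (conj_cauchy_matrix s f) (conj_cauchy_matrix 1 f) < e / 2" by blast
  define r where "r = max 0 (1 - d / 2)"
  have r: "0 \<le> r" "r < 1" "r \<in> {0..1}" "dist r 1 < d" using d(1) by (auto simp: r_def dist_real_def)
  define W where "W t = cnj (poly f (\<gamma> t)) * \<gamma>' t / (2 * pi * \<i>)" for t
  have contW: "continuous_on T W" for T
    unfolding W_def by (intro continuous_intros continuous_\<gamma> continuous_\<gamma>'_on) auto
  have "bounded (W ` ?I)" by (intro compact_imp_bounded compact_continuous_image contW) auto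
  then obtain B where B: "B > 0" "\<And>t. t \<in> ?I \<Longrightarrow> cmod (W t) \<le> B" by (auto simp: bounded_pos)
  \<comment> \<open>Chosen so that integration against \<open>W\<close> over a period costs
    \<open>e / 2\<close>; the other half is spent on moving \<open>r\<close> to
    \<open>1\<close>.\<close>
  define e' where "e' = e / (2 * B * (2 * pi))"
  have e': "e' > 0" "B * e' * (2 * pi) = e / 2" using e B(1) by (auto simp: e'_def)
  obtain P N where P_props: "\<forall>t. degree (P t) \<le> N" "\<forall>k. continuous_on ?I (\<lambda>t. coeff (P t) k)"
    "\<forall>t\<in>?I. \<forall>z\<in>closure \<Omega>. cmod (poly (P t) z - 1 / (\<gamma> t - of_real r * z)) \<le> e'"
    "\<forall>t\<in>?I. norm (matrix_poly (P t) A - resolvent r t) \<le> e'"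
    by (rule resolvent_approximation[OF r(1,2) e'(1)])
  note P = P_props[rule_format]
  define p where "p = (\<Sum>k\<le>N. monom (integral ?I (\<lambda>t. W t * coeff (P t) k)) k)"
  show thesis
  proof (rule that[of p]; (intro ballI)?)
    fix z assume z: "z \<in> closure \<Omega>"
    have rz: "of_real r * z \<in> \<Omega>" using scaled_closure[OF z r(1,2)] .
    have "((\<lambda>t. W t * poly (P t) z) has_integral poly p z) ?I"
      unfolding p_def by (rule poly_integral[OF contW P(2,1)])
    moreover have "((\<lambda>t. W t * (1 / (\<gamma> t - of_real r * z))) has_integral conj_cauchy f (of_real r * z)) ?I"
    proof -
      have "(\<lambda>t. cnj (poly f (\<gamma> t)) * (\<gamma>' t / (\<gamma> t - of_real r * z))) integrable_on ?I"
        by (intro integrable_continuous_real continuous_intros continuous_\<gamma> continuous_\<gamma>'_on) (use \<gamma>_neq[OF rz] in auto)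
      from has_integral_mult_left[OF integrable_integral[OF this], of "1 / (2 * pi * \<i>)"]
      show ?thesis by (simp add: conj_cauchy_def W_def mult_ac)
    qed
    ultimately have "((\<lambda>t. W t * poly (P t) z - W t * (1 / (\<gamma> t - of_real r * z))) has_integral
        poly p z - conj_cauchy f (of_real r * z)) (cbox 0 (2*pi))"
      by (intro has_integral_diff) auto
    then have "cmod (poly p z - conj_cauchy f (of_real r * z)) \<le> (B * e') * measure lborel (cbox 0 (2*pi))"
    proof (rule has_integral_bound[rotated])
      fix t assume "t \<in> cbox 0 (2*pi)"
      then have t: "t \<in> ?I" by simp
      have "cmod (W t * (poly (P t) z - 1 / (\<gamma> t - of_real r * z))) \<le> B * e'"
        unfolding norm_mult using B P(3)[OF t z] e'(1) t by (intro mult_mono) auto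
      then show "cmod (W t * poly (P t) z - W t * (1 / (\<gamma> t - of_real r * z))) \<le> B * e'"
        by (simp add: right_diff_distrib)
    qed (use B e' in simp)
    then have "cmod (poly p z - conj_cauchy f (of_real r * z)) \<le> e / 2" using e'(2) by simp
    moreover have "cmod (conj_cauchy f (of_real r * z)) \<le> M" by (rule conj_cauchy_bound[OF M rz])
    ultimately show "cmod (poly p z) \<le> M + e"
      using norm_triangle_sub[of "poly p z" "conj_cauchy f (of_real r * z)"] e by linarith
  next
    have "((\<lambda>t. mat (W t) ** matrix_poly (P t) A) has_integral matrix_poly p A) ?I"
      unfolding p_def by (rule matrix_poly_integral[OF contW P(2,1)])
    moreover have "((\<lambda>t. mat (W t) ** resolvent r t) has_integral conj_cauchy_matrix r f) ?I"
      unfolding W_def by (rule conj_cauchy_matrix_has_integral[OF r(3)])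
    ultimately have "((\<lambda>t. mat (W t) ** matrix_poly (P t) A - mat (W t) ** resolvent r t) has_integral
        matrix_poly p A - conj_cauchy_matrix r f) (cbox 0 (2*pi))"
      by (intro has_integral_diff) auto
    then have "norm (matrix_poly p A - conj_cauchy_matrix r f) \<le> (B * e') * measure lborel (cbox 0 (2*pi))"
    proof (rule has_integral_bound[rotated])
      fix t assume "t \<in> cbox 0 (2*pi)"
      then have t: "t \<in> ?I" by simp
      have "norm (mat (W t) ** (matrix_poly (P t) A - resolvent r t)) \<le> B * e'"
        unfolding norm_mat_mult using B P(4)[OF t] e'(1) t by (intro mult_mono) auto
      then show "norm (mat (W t) ** matrix_poly (P t) A - mat (W t) ** resolvent r t) \<le> B * e'"
        by (simp add: matrix_mult.diff_right)
    qed (use B e' in simp)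
    then have "norm (matrix_poly p A - conj_cauchy_matrix r f) \<le> e / 2" using e'(2) by simp
    moreover have "norm (conj_cauchy_matrix r f - conj_cauchy_matrix 1 f) < e / 2" using d(2)[OF r(3,4)] by (simp add: dist_norm)
    ultimately show "norm (matrix_poly p A - conj_cauchy_matrix 1 f) \<le> e"
      using norm_triangle_ineq[of "matrix_poly p A - conj_cauchy_matrix r f" "conj_cauchy_matrix r f - conj_cauchy_matrix 1 f"] by simp
  qed
qed

text \<open>Ensures that the extremal constant below is finite; the crude bound comes from Cauchy's
  formula with a bounded resolvent.\<close>

lemma polynomial_calculus_bounded:
  "\<exists>C. \<forall>f. (\<forall>z\<in>closure \<Omega>. cmod (poly f z) \<le> 1) \<longrightarrow> norm (matrix_poly f A) \<le> C"
proof -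
  obtain L where L: "L > 0" "\<And>t. t \<in> {0..2*pi} \<Longrightarrow> norm (\<gamma>' t) \<le> L" by (rule \<gamma>'_bounded) blast
  obtain \<kappa> where \<kappa>: "\<kappa> > 0" "\<And>s t. s \<in> {0..1} \<Longrightarrow> t \<in> {0..2*pi} \<Longrightarrow> norm (resolvent s t) \<le> \<kappa>" by (rule resolvent_bounded) blast
  have "norm (matrix_poly f A) \<le> L * \<kappa>" if f: "\<forall>z\<in>closure \<Omega>. cmod (poly f z) \<le> 1" for f
  proof -
    have "((\<lambda>t. mat (poly f (\<gamma> t) * \<gamma>' t) ** resolvent 1 t) has_integral mat (2 * pi * \<i>) ** matrix_poly f A) (cbox 0 (2*pi))"
      using cauchy_formula[of f] by simp
    then have "norm (mat (2 * pi * \<i>) ** matrix_poly f A) \<le> (1 * L * \<kappa>) * measure lborel (cbox 0 (2*pi))"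
    proof (rule has_integral_bound[rotated])
      fix t assume "t \<in> cbox 0 (2*pi)"
      then show "norm (mat (poly f (\<gamma> t) * \<gamma>' t) ** resolvent 1 t) \<le> 1 * L * \<kappa>"
        unfolding norm_mat_mult norm_mult using bspec[OF f closure_\<gamma>[of t]] L \<kappa> by (intro mult_mono) auto
    qed (use L \<kappa> in simp)
    then show ?thesis by (simp add: norm_mat_mult norm_mult)
  qed
  then show ?thesis by blast
qed

text \<open>Ransford and Schwenninger: \<open>K\<close> is the best constant on \<open>\<Omega>\<close>. With \<open>F = f(A)\<close>, \<open>H\<close> the Cauchy
  transform of the conjugate of \<open>f\<close> at \<open>A\<close> and \<open>T = F + H\<^sup>*\<close> one has
  \<open>F F\<^sup>* F F\<^sup>* = F T\<^sup>* F F\<^sup>* - (F H F) F\<^sup>*\<close>, whence \<open>K\<^sup>4 \<le> 2 K\<^sup>3 + K\<^sup>2\<close>.\<close>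

theorem crouzeix_palencia_loop:
  assumes f: "\<And>z. z \<in> closure \<Omega> \<Longrightarrow> cmod (poly f z) \<le> 1"
  shows "norm (matrix_poly f A *v x) \<le> (1 + sqrt 2) * norm x"
proof -
  define unit where "unit f \<longleftrightarrow> (\<forall>z\<in>closure \<Omega>. cmod (poly f z) \<le> 1)" for f
  define Ks where "Ks = {norm (matrix_poly f A *v x) | f x. unit f \<and> norm x = 1}"
  obtain C where C: "\<forall>f. unit f \<longrightarrow> norm (matrix_poly f A) \<le> C"
    using polynomial_calculus_bounded unfolding unit_def by blast
  have bdd: "bdd_above Ks"
  proof (rule bdd_aboveI)
    fix k assume "k \<in> Ks"
    then obtain f x where fx: "k = norm (matrix_poly f A *v x)" "unit f" "norm x = 1" by (auto simp: Ks_def)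
    have "norm (matrix_poly f A *v x) \<le> norm (matrix_poly f A) * norm x" by (rule norm_matrix_vector_mult_le)
    also have "\<dots> \<le> C" using C fx by simp
    finally show "k \<le> C" using fx by simp
  qed
  define K where "K = Sup Ks"
  \<comment> \<open>The constant polynomial gives \<open>K \<ge> 1\<close>, which later allows
    division by \<open>K^2\<close>.\<close>
  have "1 \<in> Ks"
    unfolding Ks_def by (intro CollectI exI[of _ 1] exI[of _ "axis undefined 1"]) (simp add: unit_def)
  then have K1: "K \<ge> 1" and ne: "Ks \<noteq> {}" unfolding K_def using bdd by (auto intro: cSup_upper)
  have K: "norm (matrix_poly f A *v x) \<le> K * norm x" if "unit f" for f x
  proof (cases "x = 0")
    case False
    have "norm (matrix_poly f A *v ((1 / norm x) *\<^sub>R x)) \<in> Ks"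
      unfolding Ks_def using that False by (intro CollectI exI conjI refl) auto
    then have "norm (matrix_poly f A *v ((1 / norm x) *\<^sub>R x)) \<le> K" unfolding K_def using bdd by (rule cSup_upper)
    then show ?thesis using False by (simp add: matrix_vector.scaleR_right field_simps)
  qed simp
  have key: "norm (matrix_poly f A *v x) ^ 4 \<le> 2 * K ^ 3 + K\<^sup>2" if f: "unit f" and x: "norm x = 1" for f x
  proof -
    define F where "F = matrix_poly f A"
    define Fs where "Fs = conj_transpose F"
    define H where "H = conj_cauchy_matrix 1 f"
    define T where "T = F + conj_transpose H"
    have f1: "cmod (poly f z) \<le> 1" if "z \<in> closure \<Omega>" for z using f that by (simp add: unit_def)
    have nF: "norm (F *v v) \<le> K * norm v" for v unfolding F_def by (rule K[OF f])
    have nFs: "norm (Fs *v v) \<le> K * norm v" for v unfolding Fs_def by (rule conj_transpose_bound[OF nF])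
    have nT: "norm (conj_transpose T *v v) \<le> 2 * norm v" for v
      using conj_transpose_bound[of T 2 v] plus_conj_transpose_bound[of 1 f] f1
      by (simp add: T_def F_def H_def)
    have Ts: "conj_transpose T = Fs + H" by (simp add: T_def Fs_def conj_transpose_add)
    \<comment> \<open>\<open>F H F\<close> is the value at the matrix of \<open>f g f\<close>, again
      bounded by \<open>1\<close>, so extremality bounds it by \<open>K\<close>, where three
      separate norms would multiply. The polynomial \<open>p\<close> stands in for
      \<open>g\<close>.\<close>
    have FHF: "norm (F *v (H *v (F *v v))) \<le> K * norm v" for v
    proof (rule field_le_epsilon)
      fix \<epsilon> :: real assume \<epsilon>: "\<epsilon> > 0"
      define e where "e = \<epsilon> / ((K + K * K) * (norm v + 1))"
      have e: "e > 0" "(K + K * K) * (norm v + 1) * e = \<epsilon>"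
      proof -
        have "(K + K * K) * (norm v + 1) > 0"
          using K1 by (intro mult_pos_pos add_pos_pos add_nonneg_pos) auto
        then show "e > 0" "(K + K * K) * (norm v + 1) * e = \<epsilon>" using \<epsilon> by (auto simp: e_def)
      qed
      obtain p where p: "\<forall>z\<in>closure \<Omega>. cmod (poly p z) \<le> 1 + e" "norm (matrix_poly p A - H) \<le> e"
        unfolding H_def by (rule conj_cauchy_approximation[OF f1 e(1)])
      \<comment> \<open>Division by \<open>1 + e\<close> brings the approximant back into the unit
        ball of the supremum norm.\<close>
      define q where "q = smult (of_real (1 / (1 + e))) (f * p * f)"
      have "unit q"
        unfolding unit_def
      proof
        fix z assume z: "z \<in> closure \<Omega>"
        have "cmod (poly f z) * cmod (poly p z) * cmod (poly f z) \<le> 1 * (1 + e) * 1"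
          using f1[OF z] bspec[OF p(1) z] e(1) by (intro mult_mono) auto
        moreover have "cmod (complex_of_real (1 / (1 + e))) = 1 / (1 + e)"
          unfolding norm_of_real using e(1) by simp
        ultimately show "cmod (poly q z) \<le> 1"
          unfolding q_def poly_smult poly_mult norm_mult using e(1) by (simp add: divide_le_eq)
      qed
      have Q: "F *v (matrix_poly p A *v (F *v v)) = (1 + e) *\<^sub>R (matrix_poly q A *v v)"
      proof -
        have "(1 + e) *\<^sub>R (matrix_poly q A *v v) = of_real (1 + e) *s (of_real (1 / (1 + e)) *s (matrix_poly (f * p * f) A *v v))"
          by (simp add: q_def matrix_poly_smult vec_eq_iff scaleR_conv_of_real[where 'a = complex] flip: matrix_vector_mul_assoc)
        also have "\<dots> = matrix_poly (f * p * f) A *v v"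
          unfolding vector_smult_assoc of_real_mult[symmetric] using e(1) by simp
        finally show ?thesis by (simp add: matrix_poly_mult F_def matrix_vector_mul_assoc matrix_mul_assoc)
      qed
      have a1: "norm (F *v (matrix_poly p A *v (F *v v))) \<le> (1 + e) * (K * norm v)"
        unfolding Q using K[OF \<open>unit q\<close>, of v] e(1) by (auto intro: mult_left_mono)
      have a2: "norm (F *v ((matrix_poly p A - H) *v (F *v v))) \<le> K * (e * (K * norm v))"
        using K1 e(1) by (intro order_trans[OF nF] mult_left_mono order_trans[OF norm_matrix_vector_mult_le] mult_mono p(2) nF) auto
      have eq: "F *v (H *v (F *v v)) = F *v (matrix_poly p A *v (F *v v)) - F *v ((matrix_poly p A - H) *v (F *v v))"
        by (simp add: matrix_vector_mult_diff_rdistrib matrix_vector_mult_diff_distrib)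
      have "norm (F *v (H *v (F *v v))) \<le> (1 + e) * (K * norm v) + K * (e * (K * norm v))"
        unfolding eq by (rule order_trans[OF norm_triangle_ineq4 add_mono[OF a1 a2]])
      also have "\<dots> = K * norm v + (K + K * K) * norm v * e" by (simp add: algebra_simps)
      also have "\<dots> \<le> K * norm v + (K + K * K) * (norm v + 1) * e"
        using K1 e(1) by (intro add_left_mono mult_right_mono mult_left_mono) auto
      finally show "norm (F *v (H *v (F *v v))) \<le> K * norm v + \<epsilon>" using e(2) by simp
    qed
    have four: "norm (F *v (Fs *v (F *v (Fs *v v)))) \<le> (2 * K ^ 3 + K\<^sup>2) * norm v" for v
    proof -
      have eq: "F *v (Fs *v (F *v (Fs *v v)))
          = F *v (conj_transpose T *v (F *v (Fs *v v))) - F *v (H *v (F *v (Fs *v v)))"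
        by (simp add: Ts matrix_vector_mult_add_rdistrib matrix_vector_right_distrib)
      have a1: "norm (F *v (conj_transpose T *v (F *v (Fs *v v)))) \<le> K * (2 * (K * (K * norm v)))"
        using K1 by (intro order_trans[OF nF] mult_left_mono order_trans[OF nT] nFs) auto
      have a2: "norm (F *v (H *v (F *v (Fs *v v)))) \<le> K * (K * norm v)"
        using K1 by (intro order_trans[OF FHF] mult_left_mono nFs) auto
      have "norm (F *v (Fs *v (F *v (Fs *v v)))) \<le> K * (2 * (K * (K * norm v))) + K * (K * norm v)"
        unfolding eq by (rule order_trans[OF norm_triangle_ineq4 add_mono[OF a1 a2]])
      then show ?thesis by (simp add: algebra_simps power2_eq_square power3_eq_cube)
    qed
    \<comment> \<open>\<open>|F^* v|^4 \<le> |v|^2 |F F^* v|^2 \<le> |v|^3 |F F^* F F^* v|\<close>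
      turns the bound on the fourfold product into one on the fourth power of the norm.\<close>
    define c where "c = root 4 (2 * K ^ 3 + K\<^sup>2)"
    have c: "c \<ge> 0" "c ^ 4 = 2 * K ^ 3 + K\<^sup>2" using K1 by (auto simp: c_def)
    have "norm (Fs *v v) \<le> c * norm v" for v
    proof -
      have sq: "(norm (Fs *v w))\<^sup>2 \<le> norm w * norm (F *v (Fs *v w))" for w
      proof -
        have "(norm (Fs *v w))\<^sup>2 = w \<bullet> (F *v (Fs *v w))"
          by (simp add: power2_norm_eq_inner inner_conj_transpose Fs_def)
        then show ?thesis using norm_cauchy_schwarz[of w] by simp
      qed
      have "(norm (F *v (Fs *v v)))\<^sup>2 = v \<bullet> (F *v (Fs *v (F *v (Fs *v v))))"
      proof -
        have "v \<bullet> (F *v z) = (Fs *v v) \<bullet> z" for z by (simp only: inner_conj_transpose Fs_def)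
        moreover have "u \<bullet> (Fs *v w) = (F *v u) \<bullet> w" for u w
          using inner_conj_transpose[of u Fs w] by (simp add: Fs_def)
        ultimately show ?thesis by (simp only: power2_norm_eq_inner)
      qed
      also have "\<dots> \<le> norm v * ((2 * K ^ 3 + K\<^sup>2) * norm v)"
        by (rule order_trans[OF norm_cauchy_schwarz mult_left_mono[OF four]]) simp
      finally have 2: "(norm (F *v (Fs *v v)))\<^sup>2 \<le> c ^ 4 * (norm v)\<^sup>2"
        by (simp add: c(2) power2_eq_square mult_ac)
      have "norm (Fs *v v) ^ 4 = ((norm (Fs *v v))\<^sup>2)\<^sup>2" by simp
      also have "\<dots> \<le> (norm v * norm (F *v (Fs *v v)))\<^sup>2" by (intro power_mono sq) auto
      also have "\<dots> \<le> (norm v)\<^sup>2 * (c ^ 4 * (norm v)\<^sup>2)"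
        unfolding power_mult_distrib by (intro mult_left_mono 2) auto
      also have "\<dots> = (c * norm v) ^ 4" by (simp add: power_mult_distrib power2_eq_square power4_eq_xxxx mult_ac)
      finally show ?thesis by (rule power_le_imp_le_base[where n = 3, simplified]) (use c in simp)
    qed
    from conj_transpose_bound[OF this, of x] have "norm (F *v x) \<le> c" by (simp add: Fs_def x)
    then have "norm (F *v x) ^ 4 \<le> c ^ 4" by (intro power_mono) auto
    then show ?thesis by (simp add: c(2) F_def)
  qed
  have "K \<le> root 4 (2 * K ^ 3 + K\<^sup>2)"
    unfolding K_def
  proof (rule cSup_least[OF ne], fold K_def)
    fix k assume "k \<in> Ks"
    then have "k ^ 4 \<le> 2 * K ^ 3 + K\<^sup>2" "k \<ge> 0" using key by (auto simp: Ks_def)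
    then show "k \<le> root 4 (2 * K ^ 3 + K\<^sup>2)"
      using real_root_le_mono[of 4 "k ^ 4" "2 * K ^ 3 + K\<^sup>2"] by (simp add: real_root_power_cancel)
  qed
  then have "K ^ 4 \<le> root 4 (2 * K ^ 3 + K\<^sup>2) ^ 4" using K1 by (intro power_mono) auto
  also have "\<dots> = 2 * K ^ 3 + K\<^sup>2" using K1 by (intro real_root_pow_pos2) auto
  \<comment> \<open>Cancelling \<open>K^2\<close> leaves \<open>(K - 1)^2 \<le> 2\<close>.\<close>
  finally have "K\<^sup>2 * K\<^sup>2 \<le> K\<^sup>2 * (2 * K + 1)" by (simp add: power2_eq_square power3_eq_cube power4_eq_xxxx algebra_simps)
  then have "K\<^sup>2 \<le> 2 * K + 1" using K1 by (subst (asm) mult_le_cancel_left_pos) auto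
  then have "(K - 1)\<^sup>2 \<le> 2" by (simp add: power2_eq_square algebra_simps)
  then have "K - 1 \<le> sqrt 2" by (rule real_le_rsqrt)
  then have "K \<le> 1 + sqrt 2" by simp
  then have "K * norm x \<le> (1 + sqrt 2) * norm x" by (rule mult_right_mono) simp
  then show ?thesis using K[of f x] f unfolding unit_def by (meson order_trans)
qed

end

section \<open>From smooth domains to the numerical range\<close>

lemma le_if_le_add_mult_eps:
  fixes y a b :: real
  assumes "\<And>e. e > 0 \<Longrightarrow> y \<le> a + b * e" "b \<ge> 0"
  shows "y \<le> a"
proof (rule field_le_epsilon)
  fix e :: real assume e: "e > 0"
  have "y \<le> a + b * (e / (b + 1))" using e assms(2) by (intro assms(1)) auto
  also have "b * (e / (b + 1)) \<le> e" using e assms(2) by (simp add: field_simps)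
  finally show "y \<le> a + e" by simp
qed

text \<open>The version for curves is applied on a domain whose closure keeps the polynomial below
  \<open>m + e\<close>, and \<open>e\<close> is sent to \<open>0\<close>. Normalising by
  \<open>m + e\<close> also covers \<open>m = 0\<close>.\<close>

theorem crouzeix_palencia:
  fixes A :: "complex^'n^'n"
  assumes p: "\<And>z. z \<in> numerical_range A \<Longrightarrow> cmod (poly p z) \<le> m"
  shows "norm (matrix_poly p A *v x) \<le> (1 + sqrt 2) * m * norm x"
proof (rule le_if_le_add_mult_eps[where b = "(1 + sqrt 2) * norm x"])
  fix e :: real assume e: "e > 0"
  obtain c where c: "c \<in> numerical_range A" using numerical_range_nonempty[of A] by blast
  have m0: "m \<ge> 0" using p[OF c] norm_ge_zero order_trans by blast
  define B where "B = A - mat c"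
  define q where "q = p \<circ>\<^sub>p [:c, 1:]"
  define S where "S = numerical_range B"
  have S: "S = (\<lambda>w. w - c) ` numerical_range A" unfolding S_def B_def by (rule numerical_range_shift)
  define U where "U = {z. cmod (poly q z) < m + e}"
  have U: "open U" unfolding U_def by (intro open_Collect_less continuous_intros)
  have SU: "S \<subseteq> U"
  proof
    fix z assume "z \<in> S"
    then obtain w where "w \<in> numerical_range A" "z = w - c" by (auto simp: S)
    then show "z \<in> U" using p[of w] e by (auto simp: U_def q_def poly_pcompose)
  qed
  have cS: "compact S" "convex S" unfolding S_def by (rule compact_numerical_range convex_numerical_range)+
  have "0 \<in> S" using c by (force simp: S)
  then obtain \<gamma> \<gamma>' \<Omega> where loop: "convex_loop \<gamma> \<gamma>' \<Omega>" "S \<subseteq> \<Omega>" "closure \<Omega> \<subseteq> U"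
    using convex_loop_exists[OF cS _ U SU] by blast
  interpret convex_loop \<gamma> \<gamma>' \<Omega> by fact
  interpret convex_loop_matrix \<gamma> \<gamma>' \<Omega> B
    by unfold_locales (use loop(2) in \<open>simp add: S_def\<close>)
  have "norm (matrix_poly (smult (of_real (1 / (m + e))) q) B *v x) \<le> (1 + sqrt 2) * norm x"
  proof (rule crouzeix_palencia_loop)
    fix z assume "z \<in> closure \<Omega>"
    then have "cmod (poly q z) \<le> m + e" using loop(3) by (auto simp: U_def)
    moreover have "cmod (complex_of_real (1 / (m + e))) = 1 / (m + e)"
      unfolding norm_of_real using m0 e by simp
    ultimately show "cmod (poly (smult (of_real (1 / (m + e))) q) z) \<le> 1"
      unfolding poly_smult norm_mult using m0 e by (simp add: divide_le_eq)
  qed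
  moreover have "matrix_poly (smult (of_real (1 / (m + e))) q) B *v x = (1 / (m + e)) *\<^sub>R (matrix_poly p A *v x)"
    unfolding q_def B_def matrix_poly_smult matrix_poly_pcompose_shift
    by (simp only: smult_of_real mat_vector_mult flip: matrix_vector_mul_assoc)
  ultimately have "norm (matrix_poly p A *v x) / (m + e) \<le> (1 + sqrt 2) * norm x"
    using m0 e by simp
  then show "norm (matrix_poly p A *v x) \<le> (1 + sqrt 2) * m * norm x + (1 + sqrt 2) * norm x * e"
    using m0 e by (simp add: divide_le_eq algebra_simps)
qed simp

section \<open>Normal matrices\<close>

lemma commute_matrix_poly:
  assumes "X ** A = A ** X"
  shows "X ** matrix_poly q A = matrix_poly q A ** X"
proof (induction q)
  case (pCons a q)
  have "X ** matrix_poly (pCons a q) A = X ** mat a + (X ** A) ** matrix_poly q A"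
    by (simp add: matrix_add_ldistrib matrix_mul_assoc)
  also have "\<dots> = mat a ** X + A ** (X ** matrix_poly q A)"
    by (simp add: assms matrix_mul_assoc mat_mult_commute[of X])
  also have "\<dots> = matrix_poly (pCons a q) A ** X"
    unfolding pCons.IH by (simp add: matrix_mult.add_left matrix_mul_assoc)
  finally show ?case .
qed (simp add: matrix_mult.zero_left matrix_mult.zero_right)

text \<open>Through this form, normality makes \<open>A\<close> commute with the adjoint of
  \<open>p(A)\<close>.\<close>

lemma conj_transpose_matrix_poly:
  "\<exists>q. conj_transpose (matrix_poly p A) = matrix_poly q (conj_transpose A)"
proof (induction p)
  case 0
  show ?case by (intro exI[of _ 0]) (simp add: conj_transpose_def vec_eq_iff)
next
  case (pCons a p)
  then obtain q where q: "conj_transpose (matrix_poly p A) = matrix_poly q (conj_transpose A)" by blast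
  have "conj_transpose (matrix_poly (pCons a p) A) = matrix_poly (pCons (cnj a) q) (conj_transpose A)"
    by (simp add: conj_transpose_add conj_transpose_mult q matrix_poly_commute_self)
  then show ?case by blast
qed

text \<open>Eigenspaces of \<open>H\<close> are invariant under the commuting \<open>A\<close>. The
  annihilating polynomial of least degree is taken relative to \<open>v\<close>, so that splitting
  off a root gives an eigenvector of the form \<open>r(A) v\<close>, which stays in the
  eigenspace.\<close>

lemma eigenvector_in_invariant_subspace:
  fixes A H :: "complex^'n^'n"
  assumes comm: "H ** A = A ** H" and v: "v \<noteq> 0" "H *v v = l *s v"
  obtains \<mu> w where "w \<noteq> 0" "A *v w = \<mu> *s w" "H *v w = l *s w"
proof -
  have "\<exists>q. q \<noteq> 0 \<and> matrix_poly q A *v v = 0" using annihilating_poly_exists[of A] by auto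
  then obtain q where q: "q \<noteq> 0" "matrix_poly q A *v v = 0"
    "\<And>r. r \<noteq> 0 \<Longrightarrow> matrix_poly r A *v v = 0 \<Longrightarrow> degree q \<le> degree r"
    using ex_has_least_nat[of "\<lambda>q. q \<noteq> 0 \<and> matrix_poly q A *v v = 0" _ degree] by blast
  have "degree q \<noteq> 0"
  proof
    assume "degree q = 0"
    then obtain c where c: "q = [:c:]" by (rule degree_eq_zeroE)
    then have "c *s v = 0" "c \<noteq> 0" using q(1,2) by (auto simp: matrix_mult.zero_right)
    then show False using v(1) by (simp add: vector_mul_eq_0)
  qed
  then have "\<not> constant (poly q)" by (simp add: constant_degree)
  then obtain \<mu> where "poly q \<mu> = 0" using fundamental_theorem_of_algebra by blast
  then obtain r where r: "q = [:-\<mu>, 1:] * r" by (auto simp: poly_eq_0_iff_dvd)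
  have r0: "r \<noteq> 0" using q(1) r by auto
  then have "degree r < degree q" unfolding r by (subst degree_mult_eq) auto
  then have w: "matrix_poly r A *v v \<noteq> 0" using q(3)[OF r0] by force
  have "matrix_poly [:-\<mu>, 1:] A *v (matrix_poly r A *v v) = 0"
    using q(2) unfolding r matrix_poly_mult by (simp add: matrix_vector_mul_assoc)
  then have "A *v (matrix_poly r A *v v) = \<mu> *s (matrix_poly r A *v v)"
    by (simp add: matrix_vector_mult_add_rdistrib vector_smult_lneg)
  moreover have "H *v (matrix_poly r A *v v) = l *s (matrix_poly r A *v v)"
    using commute_matrix_poly[OF comm, of r] v(2) by (simp add: matrix_vector_mul_assoc)
      (simp add: matrix_mult_smult flip: matrix_vector_mul_assoc)
  ultimately show thesis using w that by blast
qed

text \<open>First-order condition at a maximum: the form \<open>l |w|^2 - |B w|^2\<close> is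
  nonnegative and vanishes at \<open>v\<close>, so its gradient there, twice the residual
  \<open>y\<close>, must be \<open>0\<close>.\<close>

lemma maximal_vector_eigenvector:
  fixes B :: "complex^'n^'n"
  assumes max: "\<And>w. (norm (B *v w))\<^sup>2 \<le> l * (norm w)\<^sup>2" and v: "(norm (B *v v))\<^sup>2 = l * (norm v)\<^sup>2"
  shows "conj_transpose B *v (B *v v) = l *\<^sub>R v"
proof (rule ccontr)
  assume neq: "\<not> ?thesis"
  define y where "y = l *\<^sub>R v - conj_transpose B *v (B *v v)"
  have y: "y \<bullet> y > 0" using neq by (simp add: y_def)
  define P where "P = l * (norm y)\<^sup>2 - (norm (B *v y))\<^sup>2"
  have P: "P \<ge> 0" using max[of y] by (simp add: P_def)
  have ineq: "2 * s * (y \<bullet> y) \<le> s\<^sup>2 * P" for s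
  proof -
    have "0 \<le> l * (norm (v - s *\<^sub>R y))\<^sup>2 - (norm (B *v (v - s *\<^sub>R y)))\<^sup>2" using max[of "v - s *\<^sub>R y"] by simp
    also have "\<dots> = (l * (norm v)\<^sup>2 - (norm (B *v v))\<^sup>2) - 2 * s * (l * (v \<bullet> y) - (B *v v) \<bullet> (B *v y)) + s\<^sup>2 * P"
      unfolding P_def power2_norm_eq_inner
      by (simp add: matrix_vector_mult_diff_distrib matrix_vector.scaleR_right inner_diff_left inner_diff_right
          inner_commute algebra_simps power2_eq_square)
    also have "l * (v \<bullet> y) - (B *v v) \<bullet> (B *v y) = y \<bullet> y"
      using inner_conj_transpose[of "B *v v" B y] by (simp add: y_def inner_diff_left)
    finally show ?thesis using v by simp
  qed
  define s where "s = (y \<bullet> y) / (P + 1)"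
  have s: "s > 0" using y P by (simp add: s_def)
  have "s * (2 * (y \<bullet> y)) \<le> s * (s * P)" using ineq[of s] by (simp add: power2_eq_square mult_ac)
  then have "2 * (y \<bullet> y) \<le> s * P" using s by simp
  also have "s * P \<le> s * (P + 1)" using s by simp
  also have "\<dots> = y \<bullet> y" using P by (simp add: s_def)
  finally show False using y by simp
qed

text \<open>Normality makes \<open>A\<close> commute with \<open>p(A)^* p(A)\<close>, so the
  operator norm of \<open>p(A)\<close> is the modulus of \<open>p\<close> at an eigenvalue, which
  lies in the numerical range.\<close>

theorem normal_matrix_poly_bound:
  fixes A :: "complex^'n^'n"
  assumes A: "normal_matrix A" and p: "\<And>z. z \<in> numerical_range A \<Longrightarrow> cmod (poly p z) \<le> m"
  shows "norm (matrix_poly p A *v x) \<le> m * norm x"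
proof -
  define B where "B = matrix_poly p A"
  have "continuous_on (sphere 0 1) (\<lambda>x. norm (B *v x))"
    by (intro continuous_intros matrix_vector.continuous_on)
  moreover have "sphere (0 :: complex^'n) 1 \<noteq> {}" by simp
  ultimately obtain v where v: "norm v = 1" "\<And>w. norm w = 1 \<Longrightarrow> norm (B *v w) \<le> norm (B *v v)"
    using continuous_attains_sup[of "sphere (0 :: complex^'n) 1" "\<lambda>x. norm (B *v x)"] by auto
  define l where "l = (norm (B *v v))\<^sup>2"
  have max: "norm (B *v w) \<le> norm (B *v v) * norm w" for w
  proof (cases "w = 0")
    case False
    then show ?thesis using v(2)[of "(1 / norm w) *\<^sub>R w"] by (simp add: matrix_vector.scaleR_right field_simps)
  qed simp
  have "(norm (B *v w))\<^sup>2 \<le> l * (norm w)\<^sup>2" for w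
    using power_mono[OF max[of w], of 2] by (simp add: l_def power_mult_distrib)
  from maximal_vector_eigenvector[OF this] have "conj_transpose B *v (B *v v) = l *\<^sub>R v" by (simp add: l_def v(1))
  then have Hv: "(conj_transpose B ** B) *v v = of_real l *s v"
    by (simp only: smult_of_real flip: matrix_vector_mul_assoc)
  obtain q where q: "conj_transpose B = matrix_poly q (conj_transpose A)"
    using conj_transpose_matrix_poly[of p A] by (auto simp: B_def)
  have "A ** conj_transpose B = conj_transpose B ** A"
    unfolding q using A by (intro commute_matrix_poly) (simp add: normal_matrix_def)
  moreover have "A ** B = B ** A" unfolding B_def by (rule matrix_poly_commute_self)
  ultimately have "(conj_transpose B ** B) ** A = A ** (conj_transpose B ** B)"
    by (metis matrix_mul_assoc)
  moreover have "v \<noteq> 0" using v(1) by auto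
  ultimately obtain \<mu> w where w: "w \<noteq> 0" "A *v w = \<mu> *s w" "(conj_transpose B ** B) *v w = of_real l *s w"
    using Hv by (rule eigenvector_in_invariant_subspace)
  have "\<mu> \<in> numerical_range A" using w(1,2) spectrum_subset_numerical_range[of A] by (auto simp: spectrum_def)
  then have pm: "cmod (poly p \<mu>) \<le> m" by (rule p)
  have "(norm (B *v w))\<^sup>2 = (of_real l *s w) \<bullet> w"
    using inner_conj_transpose[of "B *v w" B w] w(3)
    by (simp add: power2_norm_eq_inner matrix_vector_mul_assoc)
  also have "\<dots> = l * (norm w)\<^sup>2"
    by (simp add: smult_of_real power2_norm_eq_inner)
  also have "B *v w = poly p \<mu> *s w" unfolding B_def by (rule matrix_poly_eigenvector[OF w(2)])
  finally have "(cmod (poly p \<mu>))\<^sup>2 = l" using w(1) by (simp add: power_mult_distrib)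
  then have "cmod (poly p \<mu>) = norm (B *v v)" unfolding l_def by (rule power2_eq_imp_eq) auto
  then have "norm (B *v v) * norm x \<le> m * norm x" using pm by (intro mult_right_mono) auto
  then show ?thesis using max[of x] unfolding B_def by linarith
qed

section \<open>Graph distance and colourings\<close>

lemma graph_dist_le_iff: "graph_dist A i j \<le> enat d \<longleftrightarrow> (\<exists>l\<le>d. (i, j) \<in> undirected_edges A ^^ l)"
proof
  assume le: "graph_dist A i j \<le> enat d"
  show "\<exists>l\<le>d. (i, j) \<in> undirected_edges A ^^ l"
  proof (rule ccontr)
    assume "\<not> ?thesis"
    then have "enat (Suc d) \<le> graph_dist A i j"
      unfolding graph_dist_def by (intro INF_greatest) (auto simp: not_le Suc_le_eq)
    from order_trans[OF this le] show False by simp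
  qed
next
  assume "\<exists>l\<le>d. (i, j) \<in> undirected_edges A ^^ l"
  then obtain l where l: "l \<le> d" "(i, j) \<in> undirected_edges A ^^ l" by blast
  then have "graph_dist A i j \<le> enat l" unfolding graph_dist_def by (intro INF_lower) simp
  also have "\<dots> \<le> enat d" using l(1) by simp
  finally show "graph_dist A i j \<le> enat d" .
qed

lemma undirected_walk_sym: "(i, j) \<in> undirected_edges A ^^ l \<Longrightarrow> (j, i) \<in> undirected_edges A ^^ l"
proof (induction l arbitrary: j)
  case (Suc l)
  then obtain k where k: "(i, k) \<in> undirected_edges A ^^ l" "(k, j) \<in> undirected_edges A" by auto
  then have "(j, k) \<in> undirected_edges A" by (auto simp: undirected_edges_def)
  then show ?case using Suc.IH[OF k(1)] by (rule relpow_Suc_I2)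
qed auto

text \<open>Reversing one walk joins the two through \<open>i\<close>. This is where the colouring
  distance \<open>2 * d\<close> comes from.\<close>

lemma graph_dist_common_neighbour:
  assumes "graph_dist A i j \<le> enat d" "graph_dist A i k \<le> enat d"
  shows "graph_dist A j k \<le> enat (2 * d)"
proof -
  obtain a where a: "a \<le> d" "(i, j) \<in> undirected_edges A ^^ a" using assms(1) by (auto simp: graph_dist_le_iff)
  obtain b where b: "b \<le> d" "(i, k) \<in> undirected_edges A ^^ b" using assms(2) by (auto simp: graph_dist_le_iff)
  have "(j, k) \<in> undirected_edges A ^^ (a + b)"
    unfolding relpow_add using undirected_walk_sym[OF a(2)] b(2) by blast
  then show ?thesis unfolding graph_dist_le_iff using a(1) b(1) by (intro exI[of _ "a + b"]) auto
qed

text \<open>A nonzero entry needs a nonzero term in the expansion of the power. Diagonal entries may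
  occur in it but are not edges, so the walk can be shorter than \<open>k\<close>.\<close>

lemma matrix_power_walk:
  assumes "matrix_power A k $ i $ j \<noteq> 0"
  shows "\<exists>l\<le>k. (i, j) \<in> undirected_edges A ^^ l"
  using assms
proof (induction k arbitrary: i)
  case 0
  then have "i = j" by (simp add: mat_def split: if_splits)
  then show ?case by auto
next
  case (Suc k)
  then have "(\<Sum>h\<in>UNIV. A $ i $ h * matrix_power A k $ h $ j) \<noteq> 0" by (simp add: matrix_matrix_mult_def)
  then obtain h where h: "A $ i $ h \<noteq> 0" "matrix_power A k $ h $ j \<noteq> 0"
    by (metis (mono_tags, lifting) mult_eq_0_iff sum.neutral)
  obtain l where l: "l \<le> k" "(h, j) \<in> undirected_edges A ^^ l" using Suc.IH[OF h(2)] by blast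
  show ?case
  proof (cases "h = i")
    case True
    then show ?thesis using l le_SucI by blast
  next
    case False
    then have "(i, h) \<in> undirected_edges A" using h(1) by (auto simp: undirected_edges_def graph_edges_def)
    then have "(i, j) \<in> undirected_edges A ^^ Suc l" using l(2) by (rule relpow_Suc_I2)
    then show ?thesis using l(1) by (intro exI[of _ "Suc l"]) auto
  qed
qed

lemma matrix_poly_banded:
  assumes "degree p \<le> d" "\<not> graph_dist A i j \<le> enat d"
  shows "matrix_poly p A $ i $ j = 0"
proof -
  have "matrix_power A k $ i $ j = 0" if "k \<le> d" for k
    using matrix_power_walk[of A k i j] assms(2) that unfolding graph_dist_le_iff by (meson order_trans)
  then show ?thesis by (simp add: matrix_poly_altdef[OF assms(1)])
qed

lemma probing_vector_component: "probing_vector col l $ i = (if col i = l then 1 else 0)"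
  by (simp add: probing_vector_def color_class_def axis_def if_distrib sum.If_cases cong: if_cong)

lemma mult_probing_vector: "(M *v probing_vector col l) $ i = (\<Sum>k\<in>color_class col l. M $ i $ k)"
  by (simp add: matrix_vector_mult_def probing_vector_component color_class_def if_distrib sum.If_cases cong: if_cong)

text \<open>In each row the mask selects at most one index of every colour class.\<close>

lemma masked_probing_norm:
  fixes E :: "complex^'n^'n"
  assumes E: "\<And>x. norm (E *v x) \<le> \<kappa> * norm x"
    and uniq: "\<And>i j k. B i j \<Longrightarrow> B i k \<Longrightarrow> col j = col k \<Longrightarrow> j = k"
  shows "(norm (\<chi> i j. if B i j then (E *v probing_vector col (col j)) $ i else 0))\<^sup>2 \<le> \<kappa>\<^sup>2 * real CARD('n)"
proof -
  define v where "v l = probing_vector col l" for l :: nat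
  let ?cols = "range col"
  have "(norm (\<chi> i j. if B i j then (E *v v (col j)) $ i else 0))\<^sup>2
      = (\<Sum>i\<in>UNIV. \<Sum>j\<in>UNIV. (cmod (if B i j then (E *v v (col j)) $ i else 0))\<^sup>2)"
    by (simp add: norm_vec_def L2_set_def sum_nonneg)
  also have "\<dots> \<le> (\<Sum>i\<in>UNIV. \<Sum>l\<in>?cols. (cmod ((E *v v l) $ i))\<^sup>2)"
  proof (rule sum_mono)
    fix i
    let ?g = "\<lambda>j. (cmod (if B i j then (E *v v (col j)) $ i else 0))\<^sup>2"
    have "sum ?g UNIV = (\<Sum>l\<in>?cols. sum ?g {j \<in> UNIV. col j = l})"
      by (rule sum.image_gen) simp
    also have "\<dots> \<le> (\<Sum>l\<in>?cols. (cmod ((E *v v l) $ i))\<^sup>2)"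
    proof (rule sum_mono)
      fix l
      show "sum ?g {j \<in> UNIV. col j = l} \<le> (cmod ((E *v v l) $ i))\<^sup>2"
      proof (cases "\<exists>j. col j = l \<and> B i j")
        case True
        then obtain j where j: "col j = l" "B i j" by blast
        have "sum ?g {j \<in> UNIV. col j = l} = sum ?g {j}"
        proof (rule sum.mono_neutral_right)
          show "\<forall>k\<in>{j \<in> UNIV. col j = l} - {j}. ?g k = 0"
          proof
            fix k assume k: "k \<in> {j \<in> UNIV. col j = l} - {j}"
            then have "\<not> B i k" using uniq[OF j(2), of k] j(1) by blast
            then show "?g k = 0" by simp
          qed
        qed (use j in auto)
        then show ?thesis using j by simp
      next
        case False
        then have "sum ?g {j \<in> UNIV. col j = l} = 0" by (intro sum.neutral) auto
        then show ?thesis by simp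
      qed
    qed
    finally show "sum ?g UNIV \<le> (\<Sum>l\<in>?cols. (cmod ((E *v v l) $ i))\<^sup>2)" .
  qed
  also have "\<dots> = (\<Sum>l\<in>?cols. \<Sum>i\<in>UNIV. (cmod ((E *v v l) $ i))\<^sup>2)" by (rule sum.swap)
  also have "\<dots> = (\<Sum>l\<in>?cols. (norm (E *v v l))\<^sup>2)"
    by (simp add: norm_vec_def L2_set_def sum_nonneg)
  also have "\<dots> \<le> (\<Sum>l\<in>?cols. \<kappa>\<^sup>2 * (norm (v l))\<^sup>2)"
    using power_mono[OF E norm_ge_zero, of _ 2] by (intro sum_mono) (simp add: power_mult_distrib)
  also have "\<dots> = \<kappa>\<^sup>2 * (\<Sum>l\<in>?cols. \<Sum>i\<in>UNIV. (cmod (v l $ i))\<^sup>2)"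
    by (simp add: sum_distrib_left norm_vec_def L2_set_def sum_nonneg)
  also have "(\<Sum>l\<in>?cols. \<Sum>i\<in>UNIV. (cmod (v l $ i))\<^sup>2) = (\<Sum>i\<in>UNIV. \<Sum>l\<in>?cols. (cmod (v l $ i))\<^sup>2)"
    by (rule sum.swap)
  \<comment> \<open>Every index carries exactly one colour, so the squared norms of the probing
    vectors add up to \<open>n\<close>.\<close>
  also have "\<dots> = (\<Sum>i\<in>(UNIV :: 'n set). 1)"
  proof (intro sum.cong refl)
    fix i
    have "(cmod (v l $ i))\<^sup>2 = (if col i = l then 1 else 0)" for l
      by (simp add: v_def probing_vector_component)
    then show "(\<Sum>l\<in>?cols. (cmod (v l $ i))\<^sup>2) = 1" by simp
  qed
  finally show ?thesis unfolding v_def by simp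
qed

lemma probing_error:
  fixes A :: "complex^'n^'n"
  assumes col: "distance_coloring (2 * d) A m col" and p: "degree p \<le> d"
    and E: "\<And>x. norm ((matrix_fun f A - matrix_poly p A) *v x) \<le> \<kappa> * norm x" and \<kappa>: "\<kappa> \<ge> 0"
  shows "norm (matrix_fun f A - probing_approx f A col d) \<le> 2 * \<kappa> * sqrt (real CARD('n))"
proof -
  define P where "P = matrix_poly p A"
  define E where "E = matrix_fun f A - P"
  define B where "B i j \<longleftrightarrow> graph_dist A i j \<le> enat d" for i j
  define M where "M = (\<chi> i j. if B i j then (E *v probing_vector col (col j)) $ i else 0)"
  have uniq: "j = k" if "B i j" "B i k" "col j = col k" for i j k
  proof (rule ccontr)
    assume "j \<noteq> k"
    moreover have "graph_dist A j k \<le> enat (2 * d)"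
      using that(1,2) unfolding B_def by (rule graph_dist_common_neighbour)
    ultimately show False using col that(3) unfolding distance_coloring_def by blast
  qed
  have diff_eq: "matrix_fun f A - probing_approx f A col d = E - M"
  proof -
    have "(matrix_fun f A - probing_approx f A col d) $ i $ j = (E - M) $ i $ j" for i j
    proof (cases "B i j")
      case True
      \<comment> \<open>The other members of the class of \<open>j\<close> are farther than
        \<open>d\<close> from \<open>i\<close>, where \<open>P\<close> vanishes; probing therefore
        reproduces the entry of \<open>P\<close> exactly.\<close>
      have "(P *v probing_vector col (col j)) $ i = (\<Sum>k\<in>color_class col (col j). P $ i $ k)"
        by (rule mult_probing_vector)
      also have "\<dots> = (\<Sum>k\<in>{j}. P $ i $ k)"
      proof (rule sum.mono_neutral_right)
        show "\<forall>k\<in>color_class col (col j) - {j}. P $ i $ k = 0"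
        proof
          fix k assume "k \<in> color_class col (col j) - {j}"
          then have "\<not> B i k" using uniq[OF True, of k] by (auto simp: color_class_def)
          then show "P $ i $ k = 0" unfolding P_def B_def by (rule matrix_poly_banded[OF p])
        qed
      qed (auto simp: color_class_def)
      finally have "(E *v probing_vector col (col j)) $ i = (matrix_fun f A *v probing_vector col (col j)) $ i - P $ i $ j"
        by (simp add: E_def matrix_vector_mult_diff_rdistrib)
      then show ?thesis using True by (simp add: M_def E_def probing_approx_def B_def)
    next
      case False
      then have "P $ i $ j = 0" unfolding P_def B_def by (rule matrix_poly_banded[OF p])
      then show ?thesis using False by (simp add: M_def E_def probing_approx_def B_def)
    qed
    then show ?thesis by (simp add: vec_eq_iff)
  qed
  have "norm E \<le> sqrt (real CARD('n)) * \<kappa>"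
    using assms(3) \<kappa> by (intro norm_matrix_le) (auto simp: E_def P_def)
  moreover have "norm M \<le> sqrt (real CARD('n)) * \<kappa>"
  proof (rule power2_le_imp_le)
    show "(norm M)\<^sup>2 \<le> (sqrt (real CARD('n)) * \<kappa>)\<^sup>2"
    proof -
      have "norm (E *v x) \<le> \<kappa> * norm x" for x using assms(3) by (simp add: E_def P_def)
      then have "(norm M)\<^sup>2 \<le> \<kappa>\<^sup>2 * real CARD('n)"
        unfolding M_def using uniq by (rule masked_probing_norm)
      then show ?thesis by (simp add: power_mult_distrib mult.commute)
    qed
  qed (use \<kappa> in simp)
  ultimately have "norm (E - M) \<le> sqrt (real CARD('n)) * \<kappa> + sqrt (real CARD('n)) * \<kappa>"
    using norm_triangle_ineq4[of E M] by linarith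
  then show ?thesis unfolding diff_eq by (simp add: mult_ac)
qed

section \<open>Passing to the matrix function\<close>

text \<open>The infimum over polynomials is not assumed to be attained, hence the slack
  \<open>e\<close>.\<close>

lemma best_approx_errorE:
  assumes "best_approx_error f W s \<le> ereal b" "e > 0"
  obtains p where "degree p \<le> s" "\<forall>z\<in>W. cmod (f z - poly p z) \<le> b + e"
proof -
  have "best_approx_error f W s < ereal (b + e)" using assms by (simp add: le_less_trans)
  then obtain p where p: "degree p \<le> s" "(SUP z\<in>W. ereal (cmod (f z - poly p z))) < ereal (b + e)"
    unfolding best_approx_error_def INF_less_iff by auto
  have "cmod (f z - poly p z) \<le> b + e" if "z \<in> W" for z
  proof -
    have "ereal (cmod (f z - poly p z)) \<le> (SUP z\<in>W. ereal (cmod (f z - poly p z)))"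
      using that by (rule SUP_upper)
    also have "\<dots> < ereal (b + e)" by (rule p)
    finally show ?thesis by simp
  qed
  then show thesis using that p(1) by blast
qed

text \<open>The bound \<open>calc\<close> concerns polynomials only. Approximants \<open>P t\<close>
  converge uniformly to \<open>f\<close> on \<open>W\<close>, so their values at \<open>A\<close>
  tend to \<open>f(A)\<close>, while \<open>P t - p\<close> is bounded on \<open>W\<close> by
  \<open>\<epsilon>\<close> plus a null sequence.\<close>

lemma matrix_fun_approximation_error:
  fixes A :: "complex^'n^'n"
  assumes W: "numerical_range A \<subseteq> W"
    and calc: "\<And>p m x. (\<And>z. z \<in> numerical_range A \<Longrightarrow> cmod (poly p z) \<le> m) \<Longrightarrow> norm (matrix_poly p A *v x) \<le> K * m * norm x"
    and q: "0 \<le> q" "q < 1" and approx: "\<And>s. best_approx_error f W s \<le> ereal (C * q ^ s)"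
    and p: "\<And>z. z \<in> W \<Longrightarrow> cmod (f z - poly p z) \<le> \<epsilon>"
  shows "norm ((matrix_fun f A - matrix_poly p A) *v x) \<le> K * \<epsilon> * norm x"
proof -
  \<comment> \<open>The second summand is the slack for an infimum that need not be
    attained.\<close>
  define b where "b t = C * q ^ t + 1 / real (Suc t)" for t
  have "\<exists>P. \<forall>z\<in>W. cmod (f z - poly P z) \<le> b t" for t
  proof -
    have "1 / real (Suc t) > 0" by simp
    from best_approx_errorE[OF approx[of t] this] show ?thesis unfolding b_def by blast
  qed
  then obtain P where P: "\<And>t z. z \<in> W \<Longrightarrow> cmod (f z - poly (P t) z) \<le> b t" by metis
  have b: "b \<longlonglongrightarrow> 0"
    unfolding b_def using q tendsto_add[OF tendsto_mult[OF tendsto_const LIMSEQ_realpow_zero] LIMSEQ_Suc[OF lim_1_over_n], of q C]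
    by simp
  have "uniform_limit W (\<lambda>t. poly (P t)) f sequentially"
  proof (rule uniform_limitI)
    fix e :: real assume "e > 0"
    with b have "\<forall>\<^sub>F t in sequentially. b t < e" by (rule order_tendstoD)
    then show "\<forall>\<^sub>F t in sequentially. \<forall>x\<in>W. dist (poly (P t) x) (f x) < e"
      by eventually_elim (use P in \<open>auto simp: dist_norm norm_minus_commute intro: le_less_trans\<close>)
  qed
  from matrix_fun_uniform_limit[OF W this]
  have l1: "(\<lambda>t. norm ((matrix_poly (P t) A - matrix_poly p A) *v x)) \<longlonglongrightarrow> norm ((matrix_fun f A - matrix_poly p A) *v x)"
    by (intro tendsto_norm matrix_vector.tendsto tendsto_diff tendsto_const)
  have l2: "(\<lambda>t. K * (b t + \<epsilon>) * norm x) \<longlonglongrightarrow> K * (0 + \<epsilon>) * norm x" by (intro tendsto_intros b)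
  have "norm ((matrix_poly (P t) A - matrix_poly p A) *v x) \<le> K * (b t + \<epsilon>) * norm x" for t
    unfolding matrix_poly_diff[symmetric]
  proof (rule calc)
    fix z assume "z \<in> numerical_range A"
    then have z: "z \<in> W" using W by blast
    have "poly (P t - p) z = (f z - poly p z) - (f z - poly (P t) z)" by simp
    then show "cmod (poly (P t - p) z) \<le> b t + \<epsilon>"
      using norm_triangle_ineq4[of "f z - poly p z" "f z - poly (P t) z"] P[OF z, of t] p[OF z] by simp
  qed
  then show ?thesis using LIMSEQ_le[OF l1 l2] by simp
qed

theorem theorem3p9:
  fixes A :: "complex^'n^'n"
    and f :: "complex \<Rightarrow> complex"
    and W :: "complex set"
    and C q :: real
    and d m :: nat
    and col :: "'n \<Rightarrow> nat"
  assumes "defined_on_spectrum f A"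
    and "compact W"
    and "numerical_range A \<subseteq> W"
    and "C > 0"
    and "0 \<le> q" and "q < 1"
    and "\<And>s. best_approx_error f W s \<le> ereal (C * q ^ s)"
    and "d > 0"
    and "distance_coloring (2 * d) A m col"
  shows "frobenius_norm (matrix_fun f A - probing_approx f A col d)
           \<le> 2 * (if normal_matrix A then 1 else 1 + sqrt 2) * sqrt (real CARD('n)) * (C * q ^ d)"
proof -
  define K :: real where "K = (if normal_matrix A then 1 else 1 + sqrt 2)"
  have K: "K \<ge> 0" by (simp add: K_def)
  have calc: "norm (matrix_poly p A *v x) \<le> K * m * norm x"
    if "\<And>z. z \<in> numerical_range A \<Longrightarrow> cmod (poly p z) \<le> m" for p m x
    using crouzeix_palencia[of A p m x] normal_matrix_poly_bound[of A p m x] that by (simp add: K_def)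
  have "norm (matrix_fun f A - probing_approx f A col d) \<le> 2 * K * sqrt (real CARD('n)) * (C * q ^ d)"
  proof (rule le_if_le_add_mult_eps[where b = "2 * K * sqrt (real CARD('n))"])
    fix e :: real assume e: "e > 0"
    \<comment> \<open>A polynomial of degree at most \<open>d\<close> that is optimal up to
      \<open>e\<close>; the surrounding rule lets \<open>e\<close> tend to \<open>0\<close>.\<close>
    obtain p where p: "degree p \<le> d" "\<forall>z\<in>W. cmod (f z - poly p z) \<le> C * q ^ d + e"
      using best_approx_errorE[OF assms(7)[of d] e] by blast
    have "norm (matrix_fun f A - probing_approx f A col d) \<le> 2 * (K * (C * q ^ d + e)) * sqrt (real CARD('n))"
    proof (rule probing_error[OF assms(9) p(1)])
      show "norm ((matrix_fun f A - matrix_poly p A) *v x) \<le> K * (C * q ^ d + e) * norm x" for x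
        by (rule matrix_fun_approximation_error[OF assms(3) calc assms(5-7) bspec[OF p(2)]])
      show "0 \<le> K * (C * q ^ d + e)" using K e assms(4,5) by simp
    qed
    then show "norm (matrix_fun f A - probing_approx f A col d)
        \<le> 2 * K * sqrt (real CARD('n)) * (C * q ^ d) + 2 * K * sqrt (real CARD('n)) * e"
      by (simp add: algebra_simps)
  qed (use K in simp)
  then show ?thesis by (simp add: frobenius_norm_eq_norm K_def)
qed

end
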